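(* Let $T$ be a triangulation and let $e$ be a flippable edge of $T$. Then there exists a realizer $R$ of $T$ such that the edge $e$, with the orientation it has in $R$, is colored flippable in $R$.
   Context: A triangulation is a maximal planar (simple) graph with a plane embedding and a fixed outer face with vertices $r_0,r_1,r_2$; all faces are triangles. Interior vertices/edges are those not on the outer face. Indices are modulo $3$. A realizer $R$ of a triangulation $T$ is a partition of its interior edges into three sets $T_0,T_1,T_2$ of directed edges such that for each interior vertex $u$: (1) $u$ has out-degree exactly one in each of $T_0,T_1,T_2$, and these outgoing edges appear in this counter-clockwise order around $u$; (2) all incoming edges of $T_i$ at $u$ occur between the outgoing edges of $T_{i+1}$ and $T_{i-1}$ of $u$ (in the sector not containing the outgoing edge of $T_i$). Each outer vertex is a sink, and $T_i$ is a tree directed towards its root $r_i$. An edge in $T_i$ is said to have label (color) $i$. The notation $\vec{uv}$ means the edge $uv$ oriented from $u$ to $v$. Diagonal flips: let $uv$ be an interior edge of $T$ whose two incident faces form the quadrilateral $uwvz$. A diagonal flip replaces the diagonal $uv$ by $wz$. The edge $uv$ is flippable if $wz$ is not an edge of $T$. Colored flips: let $R$ be a realizer of $T$, let $\vec{uv}$ be a flippable edge of label $i$, the diagonal of the quadrilateral $uwvz$, and suppose $\vec{wu}$ is an edge of $R$, with label $j$. The colored flip of $\vec{uv}$ with respect to $\vec{wu}$ replaces $\vec{uv}\in T_i$ by $\vec{uw}\in T_i$ and $\vec{wu}\in T_j$ by $\vec{wz}\in T_j$ (so the underlying triangulation undergoes the diagonal flip of $uv$). It is of type $f_1^i$ if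 $j=i-1$ and of type $f_2^i$ if $j=i+1$ (modulo $3$). The roles of $w$ and $z$ may be exchanged. The edge $\vec{uv}$ is colored flippable in $R$ if it admits such a colored flip whose result is again a realizer (of the flipped triangulation). *)

theory Defs
  imports
    "HOL-Library.Numeral_Type"
    "HOL-Combinatorics.Orbits"
    "Graph_Theory.Pair_Digraph"
    "Graph_Theory.Digraph_Component"
begin

text \<open>
  Plane embeddings are represented by rotation systems. A simple graph is a symmetric loop-free
  digraph \<open>G\<close> without parallel arcs (\<^locale>\<open>pair_graph\<close>); \<open>\<rho> v u\<close> is the neighbour of \<open>v\<close> that
  follows \<open>u\<close> in counterclockwise order around \<open>v\<close>. Arriving at \<open>v\<close> along \<open>(u, v)\<close>, the arc
  \<open>(v, \<rho> v u)\<close> is the next one on the boundary of the face to the right of \<open>(u, v)\<close>. Hence the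
  orbits of \<open>face_succ \<rho>\<close> are the face boundaries, each traversed with the face on its right, that
  is, clockwise for bounded faces and counterclockwise for the outer face.
\<close>

definition neighbours :: "'a pair_pre_digraph \<Rightarrow> 'a \<Rightarrow> 'a set" where
  "neighbours G v = {u. (v, u) \<in> parcs G}"

definition face_succ :: "('a \<Rightarrow> 'a \<Rightarrow> 'a) \<Rightarrow> 'a \<times> 'a \<Rightarrow> 'a \<times> 'a" where
  "face_succ \<rho> = (\<lambda>(u, v). (v, \<rho> v u))"

definition faces :: "'a pair_pre_digraph \<Rightarrow> ('a \<Rightarrow> 'a \<Rightarrow> 'a) \<Rightarrow> ('a \<times> 'a) set set" where
  "faces G \<rho> = {orbit (face_succ \<rho>) a | a. a \<in> parcs G}"

text \<open>
  A rotation system of a connected graph describes an embedding into the sphere iff it satisfies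
  Euler's formula. Every undirected edge contributes two arcs. (The one-vertex graph has no rotation
  system in this sense; it plays no role below.)
\<close>

definition plane_embedding :: "'a pair_pre_digraph \<Rightarrow> ('a \<Rightarrow> 'a \<Rightarrow> 'a) \<Rightarrow> bool" where
  "plane_embedding G \<rho> \<longleftrightarrow>
     pair_graph G \<and> connected (with_proj G) \<and>
     (\<forall>v\<in>pverts G. cyclic_on (\<rho> v) (neighbours G v)) \<and>
     card (pverts G) + card (faces G \<rho>) = card (parcs G) div 2 + 2"

text \<open>
  Maximality quantifies over connected plane graphs only; this is no restriction for connected \<open>G\<close>,
  since adding edges preserves connectedness.
\<close>

definition maximal_planar :: "'a pair_pre_digraph \<Rightarrow> bool" where
  "maximal_planar G \<longleftrightarrow>
     (\<exists>\<rho>. plane_embedding G \<rho>) \<and>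
     (\<forall>H. pverts H = pverts G \<and> parcs G \<subseteq> parcs H \<and> (\<exists>\<rho>. plane_embedding H \<rho>)
          \<longrightarrow> parcs H = parcs G)"

text \<open>
  The outer vertices are indexed by the type \<open>3\<close> of integers modulo 3 and listed in counterclockwise
  order. This is the order forced by the conditions on realizers: with the opposite one, only the
  triangle itself would have a realizer.
\<close>

record 'a plane_graph =
  skeleton :: "'a pair_pre_digraph"
  rot :: "'a \<Rightarrow> 'a \<Rightarrow> 'a"
  outer :: "3 \<Rightarrow> 'a"

definition outer_arcs :: "'a plane_graph \<Rightarrow> ('a \<times> 'a) set" where
  "outer_arcs T = {(outer T i, outer T (i + 1)) | i. True}"

definition triangulation :: "'a plane_graph \<Rightarrow> bool" where
  "triangulation T \<longleftrightarrow>
     maximal_planar (skeleton T) \<and>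
     plane_embedding (skeleton T) (rot T) \<and>
     (\<forall>F\<in>faces (skeleton T) (rot T). card F = 3) \<and>
     outer_arcs T \<in> faces (skeleton T) (rot T) \<and>
     (\<forall>i. face_succ (rot T) (outer T i, outer T (i + 1)) = (outer T (i + 1), outer T (i + 2)))"

definition interior_verts :: "'a plane_graph \<Rightarrow> 'a set" where
  "interior_verts T = pverts (skeleton T) - range (outer T)"

definition interior_arcs :: "'a plane_graph \<Rightarrow> ('a \<times> 'a) set" where
  "interior_arcs T = {(u, v) \<in> parcs (skeleton T). (u, v) \<notin> outer_arcs T \<and> (v, u) \<notin> outer_arcs T}"

text \<open>
  For distinct neighbours \<open>a\<close>, \<open>b\<close> of \<open>u\<close>, \<open>sector T u a b\<close> consists of the neighbours of \<open>u\<close>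
  met strictly between \<open>a\<close> and \<open>b\<close> when turning counterclockwise around \<open>u\<close> from \<open>a\<close> to \<open>b\<close>.
\<close>

definition sector :: "'a plane_graph \<Rightarrow> 'a \<Rightarrow> 'a \<Rightarrow> 'a \<Rightarrow> 'a set" where
  "sector T u a b =
     {(rot T u ^^ k) a | k. 0 < k \<and> (\<forall>l. 0 < l \<and> l \<le> k \<longrightarrow> (rot T u ^^ l) a \<noteq> b)}"

text \<open>
  A tree with all edges directed towards the root \<open>r\<close>. The vertex set is \<open>insert r (Field A)\<close>.
\<close>

definition in_tree :: "('a \<times> 'a) set \<Rightarrow> 'a \<Rightarrow> bool" where
  "in_tree A r \<longleftrightarrow> single_valued A \<and> acyclic A \<and> (\<forall>v\<in>Field A. (v, r) \<in> A\<^sup>*)"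

definition realizer :: "'a plane_graph \<Rightarrow> (3 \<Rightarrow> ('a \<times> 'a) set) \<Rightarrow> bool" where
  "realizer T R \<longleftrightarrow>
     triangulation T \<and>
     (\<forall>i. R i \<subseteq> interior_arcs T) \<and>
     (\<forall>(u, v)\<in>interior_arcs T. \<exists>!(i, x, y). {x, y} = {u, v} \<and> (x, y) \<in> R i) \<and>
     (\<forall>u\<in>interior_verts T. \<exists>out.
        (\<forall>i v. (u, v) \<in> R i \<longleftrightarrow> v = out i) \<and>
        out 1 \<in> sector T u (out 0) (out 2) \<and>
        (\<forall>i x. (x, u) \<in> R i \<longrightarrow> x \<in> sector T u (out (i + 1)) (out (i - 1)))) \<and>
     (\<forall>i j v. (outer T i, v) \<notin> R j) \<and>
     (\<forall>i. in_tree (R i) (outer T i))"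

text \<open>The third vertex of the triangle to the right of the arc \<open>(u, v)\<close>.\<close>

definition apex :: "'a plane_graph \<Rightarrow> 'a \<Rightarrow> 'a \<Rightarrow> 'a" where
  "apex T u v = rot T v u"

definition flippable :: "'a plane_graph \<Rightarrow> 'a \<Rightarrow> 'a \<Rightarrow> bool" where
  "flippable T u v \<longleftrightarrow>
     (u, v) \<in> interior_arcs T \<and> (apex T u v, apex T v u) \<notin> parcs (skeleton T)"

text \<open>
  With \<open>w = apex T u v\<close> and \<open>z = apex T v u\<close>, the quadrilateral around \<open>uv\<close> is \<open>u, w, v, z\<close> in
  counterclockwise order. Around \<open>u\<close> the sequence \<open>w, v, z\<close> becomes \<open>w, z\<close>, around \<open>v\<close> the
  sequence \<open>z, u, w\<close> becomes \<open>z, w\<close>, around \<open>w\<close> the new neighbour \<open>z\<close> is inserted between \<open>v\<close>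
  and \<open>u\<close>, and around \<open>z\<close> the new neighbour \<open>w\<close> is inserted between \<open>u\<close> and \<open>v\<close>.
\<close>

definition flip :: "'a plane_graph \<Rightarrow> 'a \<Rightarrow> 'a \<Rightarrow> 'a plane_graph" where
  "flip T u v = (let w = apex T u v; z = apex T v u; G = skeleton T in
     T\<lparr>skeleton := \<lparr>pverts = pverts G, parcs = (parcs G - {(u, v), (v, u)}) \<union> {(w, z), (z, w)}\<rparr>,
       rot := (rot T)
         (u := (rot T u)(w := z),
          v := (rot T v)(z := w),
          w := (rot T w)(v := z, z := u),
          z := (rot T z)(u := w, w := v))\<rparr>)"

text \<open>
  The effect on the labels of the colored flip of \<open>(u, v) \<in> R i\<close> with respect to \<open>(w, u) \<in> R j\<close>.
  In a realizer \<open>j \<noteq> i\<close> whenever \<open>w\<close> is one of the two apices of \<open>uv\<close>: the flip is of the first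
  type if \<open>j = i - 1\<close> and of the second type if \<open>j = i + 1\<close>.
\<close>

definition colored_flip ::
  "(3 \<Rightarrow> ('a \<times> 'a) set) \<Rightarrow> 3 \<Rightarrow> 3 \<Rightarrow> 'a \<Rightarrow> 'a \<Rightarrow> 'a \<Rightarrow> 'a \<Rightarrow> 3 \<Rightarrow> ('a \<times> 'a) set" where
  "colored_flip R i j u v w z = (\<lambda>k.
     (R k - {(u, v), (w, u)}) \<union> (if k = i then {(u, w)} else {}) \<union> (if k = j then {(w, z)} else {}))"

definition colored_flippable ::
  "'a plane_graph \<Rightarrow> (3 \<Rightarrow> ('a \<times> 'a) set) \<Rightarrow> 'a \<Rightarrow> 'a \<Rightarrow> bool" where
  "colored_flippable T R u v \<longleftrightarrow>
     flippable T u v \<and>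
     (\<exists>i j w z. {w, z} = {apex T u v, apex T v u} \<and> (u, v) \<in> R i \<and> (w, u) \<in> R j \<and>
        realizer (flip T u v) (colored_flip R i j u v w z))"

end

theory Submission
  imports Defs
begin

text \<open>
  The angles of a realizer of \<open>T\<close> carry labels in the integers modulo 3, as in Schnyder's work. Orienting
  the interior edges with outdegree 3 at every interior vertex determines the increments of such an
  angle labelling around every vertex and along every edge; these increments are consistent around
  every face, so the labelling exists because the first cohomology of the sphere with values in the
  integers modulo 3 vanishes. Conversely, an orientation and a labelling give a realizer: the local
  conditions are immediate, and a monochromatic component that misses the outer vertices would
  enclose a region violating Euler's formula.

  Let \<open>u \<rightarrow> v\<close> be the given edge and \<open>w\<close>, \<open>z\<close> the apices of its two faces. If \<open>w \<rightarrow> u\<close> or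
  \<open>z \<rightarrow> u\<close>, the colored flip changes only three angle labels and again yields a labelling. Otherwise
  \<open>u \<rightarrow> w\<close> and \<open>u \<rightarrow> z\<close>, and one of \<open>w\<close>, \<open>z\<close> reaches \<open>u\<close> along the orientation: the vertices that do
  not reach \<open>u\<close> induce a triangulation with \<open>u\<close> inside one of its faces, so \<open>w\<close> and \<open>z\<close>
  would be adjacent. Reversing the resulting directed cycle through \<open>u\<close> makes the colored flip possible.

  All topological input is Euler's formula for the subgraphs of a plane graph, whose faces are
  represented by unions of faces of the whole graph.
\<close>

subsection \<open>Connected components\<close>

text \<open>Orientations rather than realizers are manipulated because reversing a directed path
  changes only the outdegrees of its two ends, and the colours can be recovered afterwards. Labels
  live modulo 3 because both obstructions to their existence are multiples of 3: the increments
  around an interior vertex sum to its outdegree, and each of the three arcs of a face contributes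
  the same constant. The edges of the outer triangle have no colour; for the labelling alone they
  are directed cyclically, which contributes another 3 on the outer face.

  The order of colours around a vertex is local and can be read off a labelling, but acyclicity of a
  colour class is global. Proving it once for every labelling means that after a flip only labels
  near the quadrilateral need checking, and no tree has to be traced.

  Subgraphs occurring in the counts may be disconnected or have isolated vertices. Merging faces of
  the whole graph across deleted edges describes their faces without giving them rotation systems of
  their own.\<close>

definition conn :: "('b \<times> 'b) set \<Rightarrow> ('b \<times> 'b) set" where
  "conn r = (r \<union> r\<inverse>)\<^sup>*"

lemma conn_refl [simp]: "(x, x) \<in> conn r"
  by (simp add: conn_def)

lemma conn_sym: "(x, y) \<in> conn r \<Longrightarrow> (y, x) \<in> conn r"
  unfolding conn_def by (metis sym_Un_converse sym_rtrancl symD)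

lemma conn_trans: "(x, y) \<in> conn r \<Longrightarrow> (y, z) \<in> conn r \<Longrightarrow> (x, z) \<in> conn r"
  unfolding conn_def by (rule rtrancl_trans)

lemma conn_base: "(x, y) \<in> r \<Longrightarrow> (x, y) \<in> conn r"
  unfolding conn_def by auto

lemma conn_closed:
  assumes "(x, y) \<in> conn r" "x \<in> X" "\<And>a b. (a, b) \<in> r \<Longrightarrow> a \<in> X \<longleftrightarrow> b \<in> X"
  shows "y \<in> X"
  using assms(1,2) unfolding conn_def by induction (use assms(3) in auto)

lemma conn_least:
  assumes "r \<subseteq> conn s" shows "conn r \<subseteq> conn s"
proof clarify
  fix x y assume "(x, y) \<in> conn r"
  then have "y \<in> {y. (x, y) \<in> conn s}"
    by (rule conn_closed) (use assms in \<open>auto intro: conn_trans conn_sym\<close>)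
  then show "(x, y) \<in> conn s" by simp
qed

lemma conn_mono: "r \<subseteq> s \<Longrightarrow> conn r \<subseteq> conn s"
  by (rule conn_least) (auto intro: conn_base)

lemma conn_edge_iff: "(x, y) \<in> r \<Longrightarrow> (a, x) \<in> conn r \<longleftrightarrow> (a, y) \<in> conn r"
  by (meson conn_base conn_sym conn_trans)

lemma conn_class_eq: "conn r `` {x} = conn r `` {y} \<longleftrightarrow> (x, y) \<in> conn r"
  by (auto intro: conn_trans conn_sym)

lemma conn_insert_eq:
  assumes "(a, b) \<in> conn r" shows "conn (insert (a, b) r) = conn r"
proof
  show "conn (insert (a, b) r) \<subseteq> conn r"
    by (rule conn_least) (use assms in \<open>auto intro: conn_base\<close>)
qed (rule conn_mono, auto)

text \<open>An undirected edge consists of two arcs, and deleting it concerns both at once. For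
  connectivity the pair counts as a single insertion, so that \<open>ncls_insert\<close> applies to
  it.\<close>

lemma conn_insert_swap: "conn (insert (a, b) (insert (b, a) r)) = conn (insert (a, b) r)"
  by (rule conn_insert_eq[of b a "insert (a, b) r", unfolded insert_commute[of "(b, a)"]])
     (blast intro: conn_sym conn_base)

lemma conn_insertD:
  assumes "(x, y) \<in> conn (insert (a, b) r)"
  shows "(x, y) \<in> conn r \<or> (x, a) \<in> conn r \<and> (b, y) \<in> conn r \<or> (x, b) \<in> conn r \<and> (a, y) \<in> conn r"
proof -
  let ?X = "{y. (x, y) \<in> conn r \<or> (x, a) \<in> conn r \<and> (b, y) \<in> conn r \<or> (x, b) \<in> conn r \<and> (a, y) \<in> conn r}"
  have "y \<in> ?X"
  proof (rule conn_closed[OF assms])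
    fix c d assume cd: "(c, d) \<in> insert (a, b) r"
    show "c \<in> ?X \<longleftrightarrow> d \<in> ?X"
    proof (cases "(c, d) \<in> r")
      case True
      then have "(z, c) \<in> conn r \<longleftrightarrow> (z, d) \<in> conn r" for z
        by (rule conn_edge_iff)
      then show ?thesis by simp
    next
      case False
      then have "c = a" "d = b" using cd by auto
      then show ?thesis by (auto intro: conn_trans conn_sym)
    qed
  qed simp
  then show ?thesis by simp
qed

definition ncls :: "'b set \<Rightarrow> ('b \<times> 'b) set \<Rightarrow> nat" where
  "ncls A r = card ((\<lambda>x. conn r `` {x}) ` A)"

text \<open>Only the class of \<open>a\<close> can get lost: by \<open>conn_insertD\<close>, two
  points outside this class that become connected were connected before.\<close>

lemma ncls_insert:
  assumes "finite A"
  shows "ncls A r \<le> ncls A (insert (a, b) r) + 1"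
proof -
  let ?c = "\<lambda>x. conn r `` {x}" and ?c' = "\<lambda>x. conn (insert (a, b) r) `` {x}"
  let ?B = "{x \<in> A. (x, a) \<notin> conn r}"
  have inj: "(x, y) \<in> conn r"
    if "x \<in> ?B" "y \<in> ?B" "(x, y) \<in> conn (insert (a, b) r)" for x y
    using conn_insertD[OF that(3)] that(1,2) by (auto dest: conn_sym)
  have "?c ` A \<subseteq> insert (?c a) (?c ` ?B)"
  proof
    fix X assume "X \<in> ?c ` A"
    then obtain x where x: "x \<in> A" "X = ?c x" by auto
    show "X \<in> insert (?c a) (?c ` ?B)"
      using x conn_class_eq[of r x a] by (cases "(x, a) \<in> conn r") auto
  qed
  then have "card (?c ` A) \<le> card (insert (?c a) (?c ` ?B))"
    using assms by (intro card_mono) auto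
  also have "\<dots> \<le> card (?c ` ?B) + 1"
    using assms by (simp add: card_insert_if)
  also have "card (?c ` ?B) \<le> card (?c' ` ?B)"
  proof -
    \<comment> \<open>The old class is recovered from the new one through any representative in
      \<open>?B\<close>, since old classes other than that of \<open>a\<close> stay
      distinct.\<close>
    have "?c ` ?B \<subseteq> (\<lambda>X. ?c (SOME x. x \<in> ?B \<and> X = ?c' x)) ` ?c' ` ?B"
    proof
      fix X assume "X \<in> ?c ` ?B"
      then obtain x where x: "x \<in> ?B" "X = ?c x" by auto
      define y where "y = (SOME y. y \<in> ?B \<and> ?c' x = ?c' y)"
      have y: "y \<in> ?B \<and> ?c' x = ?c' y" unfolding y_def by (rule someI[of _ x]) (use x in auto)
      have "(x, y) \<in> conn r" using inj[of x y] x y conn_class_eq by metis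
      then have "X = ?c y" using x conn_class_eq by metis
      then show "X \<in> (\<lambda>X. ?c (SOME x. x \<in> ?B \<and> X = ?c' x)) ` ?c' ` ?B"
        using x unfolding y_def by blast
    qed
    then show ?thesis
      using assms by (intro surj_card_le) auto
  qed
  also have "card (?c' ` ?B) \<le> card (?c' ` A)"
    using assms by (intro card_mono) auto
  finally show ?thesis by (simp add: ncls_def)
qed

lemma ncls_ge:
  assumes "finite A" "W \<subset> A" "\<And>a b. (a, b) \<in> r \<Longrightarrow> a \<notin> W \<and> b \<notin> W"
  shows "card W + 1 \<le> ncls A r"
proof -
  obtain k where k: "k \<in> A" "k \<notin> W" using assms(2) by auto
  have iso: "(x, y) \<in> conn r \<Longrightarrow> x \<in> W \<Longrightarrow> y = x" for x y
    using conn_closed[of x y r "{x}"] assms(3) by blast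
  have "inj_on (\<lambda>x. conn r `` {x}) (insert k W)"
  proof (rule inj_onI)
    fix x y assume "x \<in> insert k W" "y \<in> insert k W" "conn r `` {x} = conn r `` {y}"
    then show "x = y" using iso[of x y] iso[of y x] conn_class_eq[of r x y] conn_sym k by fastforce
  qed
  then have "card (insert k W) = card ((\<lambda>x. conn r `` {x}) ` insert k W)"
    by (rule card_image[symmetric])
  also have "\<dots> \<le> ncls A r" unfolding ncls_def
    using assms(1,2) k by (intro card_mono) auto
  moreover have "finite W" using assms(1,2) by (auto intro: finite_subset)
  ultimately show ?thesis using k by simp
qed

lemma ncls_le:
  assumes "finite A" "W \<subseteq> A" "\<And>x. x \<in> A - W \<Longrightarrow> (x, k) \<in> conn r"
  shows "ncls A r \<le> card W + 1"
proof -
  have "(\<lambda>x. conn r `` {x}) ` A \<subseteq> (\<lambda>x. conn r `` {x}) ` insert k W"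
    using assms(3) conn_class_eq[of r _ k] by fastforce
  then have "ncls A r \<le> card ((\<lambda>x. conn r `` {x}) ` insert k W)"
    unfolding ncls_def using assms(1,2) by (intro card_mono) (auto intro: finite_subset)
  also have "\<dots> \<le> card (insert k W)" using assms(1,2) by (intro card_image_le) (auto intro: finite_subset)
  also have "\<dots> \<le> card W + 1" by (simp add: card_insert_le_m1 card_insert_if assms finite_subset[OF assms(2,1)])
  finally show ?thesis .
qed

section \<open>Cyclic permutations and sums over symmetric sets of arcs\<close>

lemma cyclic_on_image_eq:
  assumes "cyclic_on f S" shows "f ` S = S"
proof
  show "f ` S \<subseteq> S" using cyclic_on_inI[OF assms] by auto
  show "S \<subseteq> f ` S"
  proof
    fix s assume s: "s \<in> S"
    then have "s \<in> orbit f s" "S = orbit f s" using assms by (auto simp: cyclic_on_alldef)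
    then show "s \<in> f ` S" using s by cases auto
  qed
qed

lemma cyclic_on_inj: "cyclic_on f S \<Longrightarrow> inj_on f S"
  using cyclic_on_image_eq[of f S] finite_cyclic_on[of f S] by (simp add: eq_card_imp_inj_on)

text \<open>Edges with both arcs in a region cancel in double counts. To conclude that the sum
  vanishes, 2 must be cancellable, which holds for \<open>int\<close> and, by
  \<open>three_eq_minus\<close>, modulo 3.\<close>

lemma sum_swap_antisym:
  fixes h :: "'b \<times> 'b \<Rightarrow> 'c :: ab_group_add"
  assumes "\<And>d. d \<in> Y \<Longrightarrow> prod.swap d \<in> Y" "\<And>d. d \<in> Y \<Longrightarrow> h (prod.swap d) = - h d"
  shows "sum h Y = - sum h Y"
proof -
  have "sum h Y = (\<Sum>d\<in>Y. h (prod.swap d))"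
    by (rule sum.reindex_bij_witness[where i = prod.swap and j = prod.swap]) (use assms in auto)
  also have "\<dots> = (\<Sum>d\<in>Y. - h d)" using assms by (intro sum.cong) auto
  finally show ?thesis by (simp add: sum_negf)
qed

lemma even_card_sym:
  assumes "finite H" "sym H" "\<And>x. (x, x) \<notin> H"
  shows "even (card H)"
  using assms
proof (induction "card H" arbitrary: H rule: less_induct)
  case less
  show ?case
  proof (cases "H = {}")
    case False
    then obtain a b where e: "(a, b) \<in> H" by auto
    then have e': "(b, a) \<in> H" "a \<noteq> b" using less.prems by (auto dest: symD)
    let ?H = "H - {(a, b), (b, a)}"
    have "card {(a, b), (b, a)} \<le> card H"
      using e e' less.prems(1) by (intro card_mono) auto
    then have c: "card H = card ?H + 2"
      using e e' by (subst card_Diff_subset) auto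
    have "even (card ?H)"
      using c less.prems by (intro less.hyps) (auto simp: sym_def)
    then show ?thesis using c by simp
  qed simp
qed

subsection \<open>Rotation systems\<close>

text \<open>Euler's formula is kept apart, since for a flipped triangulation it is derived from the
  face sizes, which are computed inside this locale.\<close>

locale rotation_system =
  fixes V :: "'a set" and D :: "('a \<times> 'a) set" and \<rho> :: "'a \<Rightarrow> 'a \<Rightarrow> 'a"
  assumes finV: "finite V"
    and DV: "D \<subseteq> V \<times> V"
    and symmD: "sym D"
    and irr: "(x, x) \<notin> D"
    and connected: "x \<in> V \<Longrightarrow> y \<in> V \<Longrightarrow> (x, y) \<in> conn D"
    and nonempty: "V \<noteq> {}"
    and cyc: "v \<in> V \<Longrightarrow> cyclic_on (\<rho> v) {u. (v, u) \<in> D}"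
begin

abbreviation \<phi> :: "'a \<times> 'a \<Rightarrow> 'a \<times> 'a" where "\<phi> \<equiv> face_succ \<rho>"

lemma phi_simp: "\<phi> (x, y) = (y, \<rho> y x)"
  by (simp add: face_succ_def)

lemma finD: "finite D"
  using DV finV by (meson finite_SigmaI finite_subset)

lemma DVD: "(x, y) \<in> D \<Longrightarrow> x \<in> V" "(x, y) \<in> D \<Longrightarrow> y \<in> V"
  using DV by auto

lemma D_rev: "(x, y) \<in> D \<Longrightarrow> (y, x) \<in> D"
  using symmD by (rule symD)

lemma swap_D: "d \<in> D \<Longrightarrow> prod.swap d \<in> D"
  by (cases d) (simp add: D_rev)

lemma evenD: "even (card D)"
  using even_card_sym[OF finD symmD] irr by blast

lemma nbr_ex: "v \<in> V \<Longrightarrow> \<exists>u. (v, u) \<in> D"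
  using cyc[of v] unfolding cyclic_on_def by auto

lemma rho_D: "(v, x) \<in> D \<Longrightarrow> (v, \<rho> v x) \<in> D"
  using cyclic_on_inI[OF cyc[of v], of x] DVD by auto

lemma rho_inj: "(v, x) \<in> D \<Longrightarrow> (v, y) \<in> D \<Longrightarrow> \<rho> v x = \<rho> v y \<Longrightarrow> x = y"
  using cyclic_on_inj[OF cyc[of v]] DVD by (auto simp: inj_on_def)

lemma rho_reach:
  assumes "(v, x) \<in> D" "(v, y) \<in> D"
  shows "\<exists>k. y = (\<rho> v ^^ k) x"
proof -
  have "y \<in> orbit (\<rho> v) x" using cyc[of v] assms DVD by (force simp: cyclic_on_alldef)
  then show ?thesis by (auto simp: orbit_altdef)
qed

lemma phi_D: "d \<in> D \<Longrightarrow> \<phi> d \<in> D"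
  by (cases d) (simp add: phi_simp rho_D D_rev)

lemma phi_inj: "inj_on \<phi> D"
proof (rule inj_onI)
  fix d e assume "d \<in> D" "e \<in> D" "\<phi> d = \<phi> e"
  then show "d = e" using rho_inj[OF D_rev D_rev] by (cases d; cases e) (auto simp: phi_simp)
qed

lemma phi_image: "Y \<subseteq> D \<Longrightarrow> (\<And>d. d \<in> Y \<Longrightarrow> \<phi> d \<in> Y) \<Longrightarrow> \<phi> ` Y = Y"
  by (rule endo_inj_surj) (auto intro: finite_subset[OF _ finD] inj_on_subset[OF phi_inj])

lemma phi_bij: "Y \<subseteq> D \<Longrightarrow> (\<And>d. d \<in> Y \<Longrightarrow> \<phi> d \<in> Y) \<Longrightarrow> bij_betw \<phi> Y Y"
  using phi_image inj_on_subset[OF phi_inj] by (simp add: bij_betw_def)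

lemma sum_phi:
  assumes "Y \<subseteq> D" "\<And>d. d \<in> Y \<Longrightarrow> \<phi> d \<in> Y"
  shows "(\<Sum>d\<in>Y. h (\<phi> d)) = sum h Y"
  by (rule sum.reindex_bij_betw[OF phi_bij]) (use assms in auto)

lemma orbit_D: "d \<in> D \<Longrightarrow> orbit \<phi> d \<subseteq> D"
proof
  fix e assume "d \<in> D" "e \<in> orbit \<phi> d"
  from this(2,1) show "e \<in> D" by induction (auto intro: phi_D)
qed

text \<open>\<open>orbit\<close> starts with \<open>\<phi> d\<close>. That it returns to
  \<open>d\<close> relies on \<open>\<phi>\<close> being injective on a finite set.\<close>

lemma self_in_face: "d \<in> D \<Longrightarrow> d \<in> orbit \<phi> d"
proof -
  assume d: "d \<in> D"
  have "inj_on \<phi> (orbit \<phi> d \<union> {d})" by (rule inj_on_subset[OF phi_inj]) (use d orbit_D in auto)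
  moreover have "finite (orbit \<phi> d)" using orbit_D[OF d] finD finite_subset by blast
  ultimately have "\<phi> ` (orbit \<phi> d) = orbit \<phi> d"
    by (intro endo_inj_surj) (auto intro: orbit.intros inj_on_subset)
  then have "\<phi> d \<in> \<phi> ` orbit \<phi> d" by (metis orbit.base)
  then obtain e where "e \<in> orbit \<phi> d" "\<phi> d = \<phi> e" by auto
  then show ?thesis using phi_inj d orbit_D[OF d] by (metis inj_onD subsetD)
qed

lemma face_eq: "d \<in> D \<Longrightarrow> e \<in> orbit \<phi> d \<Longrightarrow> orbit \<phi> e = orbit \<phi> d"
  using self_in_face[of d] by (meson cyclic_on_singleI orbit_cyclic_eq3)

lemma face_closed: "orbit \<phi> d \<subseteq> Y" if "d \<in> Y" "\<And>d. d \<in> Y \<Longrightarrow> \<phi> d \<in> Y"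
proof
  fix e assume "e \<in> orbit \<phi> d"
  then show "e \<in> Y" by induction (use that in auto)
qed

lemma sum_faces:
  assumes "Y \<subseteq> D" "\<And>d. d \<in> Y \<Longrightarrow> \<phi> d \<in> Y"
  shows "sum g Y = (\<Sum>F\<in>orbit \<phi> ` Y. sum g F)"
proof -
  have Y: "Y = \<Union> (orbit \<phi> ` Y)"
    using assms self_in_face face_closed[of _ Y] by blast
  have "sum g (\<Union> (orbit \<phi> ` Y)) = (\<Sum>F\<in>orbit \<phi> ` Y. sum g F)"
  proof (subst sum.Union_disjoint)
    show "\<forall>F\<in>orbit \<phi> ` Y. finite F"
      using assms(1) orbit_D finD by (blast intro: finite_subset)
    show "\<forall>F\<in>orbit \<phi> ` Y. \<forall>G\<in>orbit \<phi> ` Y. F \<noteq> G \<longrightarrow> F \<inter> G = {}"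
      using assms(1) face_eq by blast
  qed simp
  then show ?thesis using Y by simp
qed

lemma face_triangleI:
  assumes "\<And>x y. (x, y) \<in> D \<Longrightarrow> \<rho> (\<rho> y x) y = x" "d \<in> D"
  shows "card (orbit \<phi> d) = 3"
proof -
  have loop: "\<phi> e \<noteq> e" if "e \<in> D" for e
    using that irr by (cases e) (auto simp: phi_simp)
  obtain x y where d: "d = (x, y)" by (cases d)
  have "(y, \<rho> y x) \<in> D" using phi_D[OF assms(2)] by (simp add: d phi_simp)
  then have cycle: "\<phi> (\<phi> (\<phi> d)) = d"
    using assms(1)[of x y] assms(1)[of y "\<rho> y x"] assms(2) by (simp add: d phi_simp)
  have "orbit \<phi> d = {(\<phi> ^^ m) d | m. m < 3}"
    by (rule orbit_altdef_bounded) (simp_all add: cycle numeral_3_eq_3)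
  also have "\<dots> = (\<lambda>m. (\<phi> ^^ m) d) ` {..<3}" by blast
  also have "{..<3} = {0, 1, 2 :: nat}" by auto
  finally have "orbit \<phi> d = {d, \<phi> d, \<phi> (\<phi> d)}" by (simp add: numeral_2_eq_2)
  moreover have "\<phi> d \<noteq> d" "\<phi> (\<phi> d) \<noteq> \<phi> d" by (intro loop phi_D assms(2))+
  moreover have "\<phi> (\<phi> d) \<noteq> d" using cycle \<open>\<phi> d \<noteq> d\<close> by metis
  ultimately show ?thesis by simp
qed

text \<open>Four successive arcs cannot be distinct in an orbit of size 3. Fixed points are excluded
  by the absence of loops, and a 2-cycle would make the orbit too small, so the fourth arc is the
  first.\<close>

lemma face_triangleD:
  assumes "card (orbit \<phi> (x, y)) = 3" "(x, y) \<in> D"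
  shows "\<rho> (\<rho> y x) y = x" "\<rho> x (\<rho> y x) = y"
proof -
  let ?d = "(x, y)"
  define d1 d2 d3 where ds: "d1 = \<phi> ?d" "d2 = \<phi> d1" "d3 = \<phi> d2"
  have D: "d1 \<in> D" "d2 \<in> D" "d3 \<in> D" using assms(2) phi_D by (simp_all add: ds)
  have loop: "\<phi> e \<noteq> e" if "e \<in> D" for e
    using that irr by (cases e) (auto simp: phi_simp)
  have inj: "\<phi> d = \<phi> e \<Longrightarrow> d = e" if "d \<in> D" "e \<in> D" for d e
    using phi_inj that by (auto dest: inj_onD)
  have ne: "?d \<noteq> d1" "d1 \<noteq> d2" "d2 \<noteq> d3"
    using loop[OF assms(2)] loop[OF D(1)] loop[OF D(2)] by (auto simp: ds)
  have sub: "{?d, d1, d2, d3} \<subseteq> orbit \<phi> ?d"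
    using self_in_face[OF assms(2)] by (auto simp: ds intro: orbit.intros)
  have fin: "finite (orbit \<phi> ?d)" using assms(1) by (simp add: card_ge_0_finite)
  have "d2 \<noteq> ?d"
  proof
    assume "d2 = ?d"
    then have "orbit \<phi> ?d \<subseteq> {?d, d1}" by (intro face_closed) (auto simp: ds)
    then have "card (orbit \<phi> ?d) \<le> card {?d, d1}" by (intro card_mono) auto
    also have "\<dots> \<le> 2" by (simp add: card_insert_if)
    finally show False using assms(1) by simp
  qed
  moreover have "d1 \<noteq> d3" using calculation inj[OF assms(2) D(2)] by (auto simp: ds)
  ultimately have "d3 = ?d"
  proof -
    assume a: "d2 \<noteq> ?d" "d1 \<noteq> d3"
    show ?thesis
    proof (rule ccontr)
      assume "d3 \<noteq> ?d"
      then have "card {?d, d1, d2, d3} = 4" using a ne by auto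
      then show False using card_mono[OF fin sub] assms(1) by simp
    qed
  qed
  then show "\<rho> (\<rho> y x) y = x" "\<rho> x (\<rho> y x) = y" by (auto simp: ds phi_simp)
qed

end

subsection \<open>Euler's formula for subgraphs\<close>

locale plane_map = rotation_system V D \<rho> for V :: "'a set" and D \<rho> +
  assumes euler: "card V + card (orbit (face_succ \<rho>) ` D) = card D div 2 + 2"
begin

text \<open>
  The faces that remain after deleting the edges outside \<open>H\<close> are the classes of arcs under
  \<open>reg H\<close>.
\<close>

definition reg :: "('a \<times> 'a) set \<Rightarrow> (('a \<times> 'a) \<times> ('a \<times> 'a)) set" where
  "reg H = {(d, \<phi> d) | d. d \<in> D} \<union> {(d, prod.swap d) | d. d \<in> D - H}"

definition region :: "('a \<times> 'a) set \<Rightarrow> 'a \<times> 'a \<Rightarrow> ('a \<times> 'a) set" where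
  "region H d = conn (reg H) `` {d}"

lemma region_iff: "e \<in> region H d \<longleftrightarrow> (d, e) \<in> conn (reg H)"
  by (simp add: region_def)

lemma region_self [simp]: "d \<in> region H d"
  by (simp add: region_iff)

lemma region_D:
  assumes "d \<in> D" shows "region H d \<subseteq> D"
proof
  fix e assume "e \<in> region H d"
  then show "e \<in> D" unfolding region_iff
    by (rule conn_closed) (use assms phi_D swap_D in \<open>auto simp: reg_def\<close>)
qed

lemma region_phi:
  assumes "e \<in> region H d" "e \<in> D" shows "\<phi> e \<in> region H d"
proof -
  have "(e, \<phi> e) \<in> reg H" using assms(2) unfolding reg_def by blast
  then show ?thesis using assms(1) conn_trans conn_base unfolding region_iff by metis
qed

lemma region_swap:
  assumes "e \<in> region H d" "e \<in> D - H" shows "prod.swap e \<in> region H d"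
proof -
  have "(e, prod.swap e) \<in> reg H" using assms(2) unfolding reg_def by blast
  then show ?thesis using assms(1) conn_trans conn_base unfolding region_iff by metis
qed

lemma region_eq: "region H d = region H e \<longleftrightarrow> (d, e) \<in> conn (reg H)"
  unfolding region_def by (rule conn_class_eq)

lemma region_eqI: "e \<in> region H d \<Longrightarrow> region H e = region H d"
  using region_eq region_iff by metis

text \<open>
  The number of arcs leaving \<open>X\<close> equals the number of arcs entering \<open>X\<close> along the boundary of any
  face; summing over a region in which the only arc of \<open>H\<close> leaving \<open>X\<close> is \<open>(a, b)\<close> gives a
  contradiction.
\<close>

lemma bridge_same_region:
  assumes H: "H \<subseteq> D" "sym H" and ab: "(a, b) \<in> H"
    and bridge: "(a, b) \<notin> conn (H - {(a, b), (b, a)})"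
  shows "((a, b), (b, a)) \<in> conn (reg H)"
proof (rule ccontr)
  assume sep: "((a, b), (b, a)) \<notin> conn (reg H)"
  let ?H = "H - {(a, b), (b, a)}"
  define X where "X = conn ?H `` {a}"
  define Y where "Y = region H (a, b)"
  define h :: "'a \<times> 'a \<Rightarrow> int" where "h = (\<lambda>(x, y). of_bool (y \<in> X) - of_bool (x \<in> X))"
  have YD: "Y \<subseteq> D" unfolding Y_def using ab H by (intro region_D) auto
  have Yphi: "\<phi> d \<in> Y" if "d \<in> Y" for d
    using that YD unfolding Y_def by (auto intro: region_phi)
  have fin: "finite Y" using YD finD finite_subset by blast
  have "sum h Y = (\<Sum>d\<in>Y. of_bool (fst (\<phi> d) \<in> X)) - (\<Sum>d\<in>Y. of_bool (fst d \<in> X))"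
    unfolding sum_subtractf[symmetric] by (intro sum.cong) (auto simp: h_def phi_simp)
  also have "\<dots> = 0" using sum_phi[OF YD Yphi, of "\<lambda>d. of_bool (fst d \<in> X)"] by simp
  finally have zero: "sum h Y = 0" .
  have "sum h (Y - H) = - sum h (Y - H)"
  proof (rule sum_swap_antisym)
    fix d assume "d \<in> Y - H"
    then show "prod.swap d \<in> Y - H" using region_swap[of d H "(a, b)"] YD H(2)
      unfolding Y_def by (cases d) (auto dest: symD)
  qed (auto simp: h_def)
  then have "sum h (Y - H) = 0" by simp
  moreover have "sum h (Y \<inter> H) = sum h {(a, b)}"
  proof (rule sum.mono_neutral_right)
    show "{(a, b)} \<subseteq> Y \<inter> H" using ab by (simp add: Y_def)
    show "\<forall>d\<in>Y \<inter> H - {(a, b)}. h d = 0"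
    proof
      fix d assume d: "d \<in> Y \<inter> H - {(a, b)}"
      obtain x y where [simp]: "d = (x, y)" by (cases d)
      have "(b, a) \<notin> Y" using sep by (simp add: Y_def region_iff)
      then have "(x, y) \<in> ?H" using d by auto
      then have "x \<in> X \<longleftrightarrow> y \<in> X"
        unfolding X_def by (simp only: Image_singleton_iff conn_edge_iff)
      then show "h d = 0" by (simp add: h_def)
    qed
  qed (use fin in auto)
  moreover have "h (a, b) = -1" using bridge by (simp add: h_def X_def)
  ultimately have "sum h Y = -1" using sum.Int_Diff[OF fin, of h H] by simp
  then show False using zero by simp
qed

abbreviation nreg :: "('a \<times> 'a) set \<Rightarrow> nat" where "nreg H \<equiv> ncls D (reg H)"
abbreviation ncomp :: "('a \<times> 'a) set \<Rightarrow> nat" where "ncomp H \<equiv> ncls V H"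

lemma conn_reg_remove:
  assumes "(a, b) \<in> H" "H \<subseteq> D" "sym H"
  shows "conn (reg (H - {(a, b), (b, a)})) = conn (insert ((a, b), (b, a)) (reg H))"
proof -
  have "(b, a) \<in> H" using assms by (auto dest: symD)
  then have "reg (H - {(a, b), (b, a)}) = insert ((a, b), (b, a)) (insert ((b, a), (a, b)) (reg H))"
    using assms unfolding reg_def by auto
  then show ?thesis by (simp add: conn_insert_swap)
qed

lemma conn_remove:
  assumes "(a, b) \<in> H" "sym H"
  shows "conn H = conn (insert (a, b) (H - {(a, b), (b, a)}))"
proof -
  have "H = insert (a, b) (insert (b, a) (H - {(a, b), (b, a)}))"
    using assms by (auto dest: symD)
  then show ?thesis using conn_insert_swap by metis
qed

lemma ncls_cong: "conn r = conn s \<Longrightarrow> ncls A r = ncls A s"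
  by (simp add: ncls_def)

text \<open>An edge on a cycle can be deleted without changing components, and at most two regions
  merge; a bridge has the same region on both sides, so regions are unchanged and at most one
  component is gained. One-sided bounds suffice, because inductions from both ends of the chain of
  subgraphs make them sharp.\<close>

lemma remove_edge:
  assumes "(a, b) \<in> H" "H \<subseteq> D" "sym H"
  defines "H' \<equiv> H - {(a, b), (b, a)}"
  shows "(a, b) \<in> conn H' \<Longrightarrow> ncomp H' = ncomp H" "nreg H \<le> nreg H' + 1"
    "(a, b) \<notin> conn H' \<Longrightarrow> nreg H' = nreg H" "ncomp H' \<le> ncomp H + 1"
proof -
  have c: "conn H = conn (insert (a, b) H')"
    using conn_remove[OF assms(1,3)] by (simp add: H'_def)
  have r: "conn (reg H') = conn (insert ((a, b), (b, a)) (reg H))"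
    using conn_reg_remove[OF assms(1-3)] by (simp add: H'_def)
  show "(a, b) \<in> conn H' \<Longrightarrow> ncomp H' = ncomp H"
    using c conn_insert_eq[of a b H'] by (intro ncls_cong) simp
  show "nreg H \<le> nreg H' + 1"
    using ncls_insert[OF finD, of "reg H" "(a, b)" "(b, a)"] ncls_cong[OF r] by simp
  show "ncomp H' \<le> ncomp H + 1"
    using ncls_insert[OF finV, of H' a b] ncls_cong[OF c] by simp
  assume "(a, b) \<notin> conn H'"
  then have "((a, b), (b, a)) \<in> conn (reg H)"
    unfolding H'_def by (intro bridge_same_region assms)
  then show "nreg H' = nreg H"
    using r conn_insert_eq by (intro ncls_cong) simp
qed

lemma card_remove_edge:
  assumes "(a, b) \<in> H" "H \<subseteq> D" "sym H"
  shows "card H = card (H - {(a, b), (b, a)}) + 2"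
proof -
  have "(b, a) \<in> H" "a \<noteq> b" "finite H" using assms irr finD finite_subset by (auto dest: symD)
  moreover then have "card {(a, b), (b, a)} \<le> card H"
    using assms by (intro card_mono) auto
  ultimately show ?thesis using assms by (subst card_Diff_subset) auto
qed

lemma nreg_full: "nreg D = card (orbit \<phi> ` D)"
proof -
  have "conn (reg D) `` {d} = orbit \<phi> d" if d: "d \<in> D" for d
  proof
    show "conn (reg D) `` {d} \<subseteq> orbit \<phi> d"
    proof
      fix e assume "e \<in> conn (reg D) `` {d}"
      then have "(d, e) \<in> conn (reg D)" by simp
      then show "e \<in> orbit \<phi> d"
      proof (rule conn_closed)
        show "d \<in> orbit \<phi> d" using d by (rule self_in_face)
        fix a b assume "(a, b) \<in> reg D"
        then have "a \<in> D" "b = \<phi> a" by (auto simp: reg_def)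
        then show "a \<in> orbit \<phi> d \<longleftrightarrow> b \<in> orbit \<phi> d"
          using face_eq[of a b] face_eq[of d] d self_in_face[of a] self_in_face[of b] phi_D
          by (metis orbit.intros)
      qed
    qed
    show "orbit \<phi> d \<subseteq> conn (reg D) `` {d}"
      using region_phi[of _ D d] region_D[OF d, of D] region_self[of d D] unfolding region_def
      by (intro face_closed) auto
  qed
  then show ?thesis by (simp add: ncls_def cong: image_cong)
qed

text \<open>\<open>\<phi>\<close> after \<open>prod.swap\<close> is one turn around the tail of an
  arc. So closure under both fills all arcs at a vertex, and connectedness carries this to every
  vertex.\<close>

lemma region_connected_full:
  assumes Y: "Y \<subseteq> D" "Y \<noteq> {}" "\<And>d. d \<in> Y \<Longrightarrow> \<phi> d \<in> Y" "\<And>d. d \<in> Y \<Longrightarrow> prod.swap d \<in> Y"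
  shows "Y = D"
proof -
  have rot: "(v, y) \<in> Y" if vx: "(v, x) \<in> Y" and vy: "(v, y) \<in> D" for v x y
  proof -
    obtain k where k: "y = (\<rho> v ^^ k) x" using rho_reach[of v x y] vx vy Y(1) by blast
    have "(v, (\<rho> v ^^ k) x) \<in> Y" for k
    proof (induction k)
      case (Suc k)
      then have "\<phi> (prod.swap (v, (\<rho> v ^^ k) x)) \<in> Y" using Y by blast
      then show ?case by (simp add: phi_simp)
    qed (use vx in simp)
    then show ?thesis using k by simp
  qed
  obtain a b where ab: "(a, b) \<in> Y" using Y(2) by auto
  let ?P = "{v. \<forall>y. (v, y) \<in> D \<longrightarrow> (v, y) \<in> Y}"
  have step: "y \<in> ?P" if xy: "(x, y) \<in> D" and "x \<in> ?P" for x y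
  proof -
    have "(x, y) \<in> Y" using that by blast
    then have "(y, x) \<in> Y" using Y(4)[of "(x, y)"] by simp
    then show ?thesis using rot by blast
  qed
  have "v \<in> ?P" if "v \<in> V" for v
  proof (rule conn_closed[OF connected[of a v]])
    show "a \<in> V" "v \<in> V" using ab Y(1) DVD that by auto
    show "a \<in> ?P" using rot ab by auto
    fix x y assume xy: "(x, y) \<in> D"
    show "x \<in> ?P \<longleftrightarrow> y \<in> ?P" using step[OF xy] step[OF D_rev[OF xy]] by blast
  qed
  note P = this
  have "(x, y) \<in> Y" if "(x, y) \<in> D" for x y
    using P[OF DVD(1)[OF that]] that by simp
  then have "D \<subseteq> Y" by (rule subrelI)
  with Y(1) show ?thesis by (rule equalityI)
qed

lemma nreg_empty: "nreg {} = 1"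
proof -
  obtain d where d: "d \<in> D" using nonempty nbr_ex by fastforce
  have "region {} e = D" if "e \<in> D" for e
  proof (rule region_connected_full)
    show sub: "region {} e \<subseteq> D" by (rule region_D[OF that])
    show "region {} e \<noteq> {}" using region_self[of e "{}"] by blast
    show "\<phi> d \<in> region {} e" if "d \<in> region {} e" for d
      using that sub by (blast intro: region_phi)
    show "prod.swap d \<in> region {} e" if "d \<in> region {} e" for d
      using that sub by (blast intro: region_swap)
  qed
  then have "(\<lambda>x. conn (reg {}) `` {x}) ` D = {D}" using d by (auto simp: region_def)
  then show ?thesis by (simp add: ncls_def)
qed

lemma ncomp_empty: "ncomp {} = card V"
  unfolding ncls_def conn_def by (simp add: card_image)

lemma ncomp_full: "ncomp D = 1"
proof -
  obtain v where v: "v \<in> V" using nonempty by auto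
  have "conn D `` {x} = conn D `` {v}" if "x \<in> V" for x
    using connected[OF that v] by (simp add: conn_class_eq)
  then have "(\<lambda>x. conn D `` {x}) ` V = (\<lambda>x. conn D `` {v}) ` V" by (rule image_cong[OF refl])
  also have "\<dots> = {conn D `` {v}}" using v by auto
  finally show ?thesis by (simp add: ncls_def)
qed

text \<open>Edges are added to the empty graph, which has one region and only isolated vertices, so
  that equality holds at the start.\<close>

lemma euler_le:
  assumes "H \<subseteq> D" "sym H"
  shows "2 * card V + 2 * nreg H \<le> card H + 2 * ncomp H + 2"
  using assms
proof (induction "card H" arbitrary: H rule: less_induct)
  case less
  show ?case
  proof (cases "H = {}")
    case True
    then show ?thesis by (simp add: nreg_empty ncomp_empty)
  next
    case False
    then obtain a b where ab: "(a, b) \<in> H" by auto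
    let ?H = "H - {(a, b), (b, a)}"
    note c = card_remove_edge[OF ab less.prems]
    have "2 * card V + 2 * nreg ?H \<le> card ?H + 2 * ncomp ?H + 2"
      using c less.prems by (intro less.hyps) (auto simp: sym_def)
    then show ?thesis
      using c remove_edge[OF ab less.prems] by (cases "(a, b) \<in> conn ?H") simp_all
  qed
qed

text \<open>The bounds are read downwards from \<open>D\<close>, where equality is the hypothesis
  \<open>euler\<close>. With \<open>euler_le\<close> this forces an edge on a cycle to separate two
  regions, a combinatorial Jordan curve theorem.\<close>

lemma euler_ge:
  assumes "H \<subseteq> D" "sym H"
  shows "card H + 2 * ncomp H + 2 \<le> 2 * card V + 2 * nreg H"
  using assms
proof (induction "card (D - H)" arbitrary: H rule: less_induct)
  case less
  show ?case
  proof (cases "H = D")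
    case True
    then show ?thesis using euler evenD by (auto simp: nreg_full ncomp_full)
  next
    case False
    then obtain a b where ab: "(a, b) \<in> D" "(a, b) \<notin> H" using less.prems by auto
    then have ba: "(b, a) \<notin> H" using less.prems by (auto dest: symD)
    let ?H = "insert (a, b) (insert (b, a) H)"
    have H: "?H \<subseteq> D" "sym ?H" using ab less.prems D_rev by (auto simp: sym_def)
    have *: "?H - {(a, b), (b, a)} = H" using ab ba by auto
    have "card (D - ?H) < card (D - H)"
      using ab finD by (intro psubset_card_mono) auto
    then have "card ?H + 2 * ncomp ?H + 2 \<le> 2 * card V + 2 * nreg ?H"
      using H by (rule less.hyps)
    then show ?thesis
      using card_remove_edge[OF _ H, of a b] remove_edge[OF _ H, of a b, unfolded *]
      unfolding * by (cases "(a, b) \<in> conn H") simp_all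
  qed
qed

lemma euler_subgraph:
  assumes "H \<subseteq> D" "sym H"
  shows "card H + 2 * ncomp H + 2 = 2 * card V + 2 * nreg H"
  using euler_le[OF assms] euler_ge[OF assms] by simp

end

subsection \<open>Cohomology of the sphere modulo 3\<close>

lemma three_cases: "(x::3) = 0 \<or> x = 1 \<or> x = 2"
proof -
  obtain z where z: "x = of_int z" "0 \<le> z" "z < 3"
    by (rule bit1_cases[of x]) simp
  then have "z = 0 \<or> z = 1 \<or> z = 2" by auto
  then show ?thesis using z by auto
qed

lemma three_eq_minus: "(x::3) = - x \<Longrightarrow> x = 0"
  using three_cases[of x] by auto

context plane_map
begin

text \<open>
  For a potential \<open>p\<close> that is correct on as many arcs as possible, the
  correct arcs connect all vertices; by Euler's formula, any other edge separates two regions, and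
  summing over one of them shows that \<open>p\<close> is correct on this edge, too.
\<close>

lemma closed_imp_exact:
  fixes g :: "'a \<times> 'a \<Rightarrow> 3"
  assumes anti: "\<And>d. d \<in> D \<Longrightarrow> g (prod.swap d) = - g d"
    and closed: "\<And>d. d \<in> D \<Longrightarrow> sum g (orbit \<phi> d) = 0"
  shows "\<exists>p. \<forall>(x, y)\<in>D. g (x, y) = p y - p x"
proof -
  define E where "E p = {(x, y) \<in> D. g (x, y) = p y - p x}" for p :: "'a \<Rightarrow> 3"
  have ED: "E p \<subseteq> D" for p by (auto simp: E_def)
  have symE: "sym (E p)" for p
  proof (rule symI)
    fix x y assume "(x, y) \<in> E p"
    then show "(y, x) \<in> E p"
      using anti[of "(x, y)"] D_rev[of x y] by (simp add: E_def)
  qed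
  have "\<exists>p. \<forall>q. card (E q) \<le> card (E p)"
    using ex_has_greatest_nat[of "\<lambda>_. True" undefined "\<lambda>p. card (E p)" "Suc (card D)"]
      card_mono[OF finD ED] by (auto simp: less_Suc_eq_le)
  then obtain p where p: "\<And>q. card (E q) \<le> card (E p)" by blast
  have con: "(a, b) \<in> conn (E p)" if ab: "(a, b) \<in> D" for a b
  proof (rule ccontr)
    assume nc: "(a, b) \<notin> conn (E p)"
    define X where "X = conn (E p) `` {b}"
    \<comment> \<open>Shifting \<open>p\<close> on the component of \<open>b\<close> by the defect
      of \<open>(a, b)\<close> corrects this arc and spoils no correct one, because correct arcs do
      not leave the component.\<close>
    define q where "q x = (if x \<in> X then p x + (g (a, b) - (p b - p a)) else p x)" for x
    have "E p \<subseteq> E q"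
    proof
      fix d assume d: "d \<in> E p"
      obtain x y where [simp]: "d = (x, y)" by (cases d)
      have "x \<in> X \<longleftrightarrow> y \<in> X" using d unfolding X_def by (simp only: \<open>d = _\<close> Image_singleton_iff conn_edge_iff)
      then show "d \<in> E q" using d by (auto simp: E_def q_def)
    qed
    moreover have "(a, b) \<in> E q - E p"
      using nc ab conn_base[of a b "E p"] conn_sym[of b a] by (auto simp: E_def q_def X_def)
    ultimately have "card (E p) < card (E q)"
      by (intro psubset_card_mono finite_subset[OF ED finD]) blast
    then show False using p[of q] by simp
  qed
  have "(a, b) \<in> E p" if ab: "(a, b) \<in> D" for a b
  proof (rule ccontr)
    assume nE: "(a, b) \<notin> E p"
    then have nE': "(b, a) \<notin> E p" using symE by (auto dest: symD)
    let ?H = "insert (a, b) (insert (b, a) (E p))"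
    have H: "?H \<subseteq> D" "sym ?H" using ab ED symE D_rev by (auto simp: sym_def)
    have E: "?H - {(a, b), (b, a)} = E p" using nE nE' by auto
    \<comment> \<open>Since the ends are already connected by correct arcs, Euler's formula turns
      the added edge into an additional region, so its two arcs lie in different regions.\<close>
    have "ncomp (E p) = ncomp ?H"
      using remove_edge(1)[of a b ?H] H con[OF ab] E by simp
    moreover have "card ?H = card (E p) + 2"
      using card_remove_edge[of a b ?H] H E by simp
    ultimately have "nreg ?H = nreg (E p) + 1"
      using euler_subgraph[OF ED symE, of p] euler_subgraph[OF H] by simp
    then have "conn (reg (E p)) \<noteq> conn (reg ?H)" using ncls_cong[of "reg (E p)" "reg ?H" D] by auto
    moreover have "conn (reg (E p)) = conn (insert ((a, b), (b, a)) (reg ?H))"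
      using conn_reg_remove[OF _ H, of a b] E by simp
    ultimately have sep: "((a, b), (b, a)) \<notin> conn (reg ?H)"
      using conn_insert_eq[of "(a, b)" "(b, a)" "reg ?H"] by fastforce
    define Y where "Y = region ?H (a, b)"
    define g' where "g' = (\<lambda>(x, y). g (x, y) - (p y - p x))"
    have YD: "Y \<subseteq> D" unfolding Y_def using ab by (rule region_D)
    have Yphi: "\<phi> d \<in> Y" if "d \<in> Y" for d
      using that YD unfolding Y_def by (auto intro: region_phi)
    have fin: "finite Y" using YD finD finite_subset by blast
    have "sum g' Y = sum g Y - ((\<Sum>d\<in>Y. p (fst (\<phi> d))) - (\<Sum>d\<in>Y. p (fst d)))"
      unfolding sum_subtractf[symmetric] by (intro sum.cong) (auto simp: g'_def phi_simp)
    also have "\<dots> = sum g Y"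
      using sum_phi[OF YD Yphi, of "\<lambda>d. p (fst d)"] by simp
    also have "\<dots> = (\<Sum>F\<in>orbit \<phi> ` Y. sum g F)" by (rule sum_faces[OF YD Yphi])
    also have "\<dots> = 0" by (rule sum.neutral) (use closed YD in blast)
    finally have zero: "sum g' Y = 0" .
    have "sum g' (Y - ?H) = - sum g' (Y - ?H)"
    proof (rule sum_swap_antisym)
      fix d assume d: "d \<in> Y - ?H"
      then have "prod.swap d \<in> Y" using region_swap[of d ?H "(a, b)"] YD unfolding Y_def by blast
      moreover have "prod.swap d \<notin> ?H" using d H(2) by (cases d) (auto dest: symD)
      ultimately show "prod.swap d \<in> Y - ?H" by blast
      show "g' (prod.swap d) = - g' d" using anti[of d] d YD by (cases d) (auto simp: g'_def)
    qed
    then have "sum g' (Y - ?H) = 0" by (rule three_eq_minus)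
    \<comment> \<open>Correct arcs have defect 0 and \<open>(b, a)\<close> lies outside
      \<open>Y\<close>, which leaves only the defect of \<open>(a, b)\<close>.\<close>
    moreover have "sum g' (Y \<inter> ?H) = sum g' {(a, b)}"
    proof (rule sum.mono_neutral_right)
      show "{(a, b)} \<subseteq> Y \<inter> ?H" by (simp add: Y_def)
      have "(b, a) \<notin> Y" using sep by (simp add: Y_def region_iff)
      then show "\<forall>d\<in>Y \<inter> ?H - {(a, b)}. g' d = 0"
        by (auto simp: g'_def E_def)
    qed (use fin in auto)
    ultimately have "g' (a, b) = 0" using zero sum.Int_Diff[OF fin, of g' ?H] by simp
    then show False using nE ab by (simp add: g'_def E_def)
  qed
  then show ?thesis by (auto simp: E_def)
qed

subsection \<open>Induced subgraphs\<close>

definition boundary :: "('a \<times> 'a) set \<Rightarrow> ('a \<times> 'a) set" where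
  "boundary Y = {d \<in> Y. prod.swap d \<notin> Y}"

text \<open>As \<open>\<phi>\<close> permutes \<open>Y\<close>, as many arcs of \<open>Y\<close>
  enter \<open>b\<close> as leave it. Arcs whose reverse is in \<open>Y\<close> cancel, so boundary
  arcs entering and leaving \<open>b\<close> are balanced, too.\<close>

lemma boundary_successor:
  assumes Y: "Y \<subseteq> D" "\<And>d. d \<in> Y \<Longrightarrow> \<phi> d \<in> Y" and ab: "(a, b) \<in> boundary Y"
  shows "\<exists>c. (b, c) \<in> boundary Y"
proof (rule ccontr)
  assume none: "\<nexists>c. (b, c) \<in> boundary Y"
  define h :: "'a \<times> 'a \<Rightarrow> int" where "h = (\<lambda>(x, y). of_bool (y = b) - of_bool (x = b))"
  have fin: "finite Y" using Y(1) finD finite_subset by blast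
  have "sum h Y = (\<Sum>d\<in>Y. of_bool (fst (\<phi> d) = b)) - (\<Sum>d\<in>Y. of_bool (fst d = b))"
    unfolding sum_subtractf[symmetric] by (intro sum.cong) (auto simp: h_def phi_simp)
  also have "\<dots> = 0" using sum_phi[OF Y, of "\<lambda>d. of_bool (fst d = b)"] by simp
  finally have zero: "sum h Y = 0" .
  have "sum h (Y - boundary Y) = - sum h (Y - boundary Y)"
    by (rule sum_swap_antisym) (auto simp: h_def boundary_def)
  moreover have "sum h Y = sum h (Y \<inter> boundary Y) + sum h (Y - boundary Y)"
    using fin by (rule sum.Int_Diff)
  moreover have "Y \<inter> boundary Y = boundary Y" by (auto simp: boundary_def)
  ultimately have "sum h (boundary Y) = 0" using zero by simp
  moreover have "h (a, b) \<le> sum h (boundary Y)"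
  proof (rule member_le_sum[OF ab])
    show "finite (boundary Y)" using fin by (auto simp: boundary_def)
    show "0 \<le> h d" if "d \<in> boundary Y - {(a, b)}" for d
      using none that by (cases d) (auto simp: h_def)
  qed
  moreover have "(a, b) \<in> D" using ab Y(1) by (auto simp: boundary_def)
  then have "h (a, b) = 1" using irr by (auto simp: h_def)
  ultimately show False by simp
qed

lemma boundary_triangle:
  assumes Y: "Y \<subseteq> D" "\<And>d. d \<in> Y \<Longrightarrow> \<phi> d \<in> Y" and "Y \<noteq> {}" "Y \<noteq> D"
  shows "3 \<le> card (boundary Y)" "card (boundary Y) = 3 \<Longrightarrow> \<exists>a b c. boundary Y = {(a, b), (b, c), (c, a)}"
proof -
  have "boundary Y \<noteq> {}" using region_connected_full[OF Y(1) assms(3) Y(2)] assms(4) by (auto simp: boundary_def)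
  then obtain a b where ab: "(a, b) \<in> boundary Y" by auto
  obtain c where bc: "(b, c) \<in> boundary Y" using boundary_successor[OF Y ab] by auto
  obtain e where ce: "(c, e) \<in> boundary Y" using boundary_successor[OF Y bc] by auto
  obtain f where ef: "(e, f) \<in> boundary Y" using boundary_successor[OF Y ce] by auto
  have loop: "x \<noteq> y" "(y, x) \<notin> boundary Y" if "(x, y) \<in> boundary Y" for x y
    using that irr Y(1) by (auto simp: boundary_def)
  have ne: "a \<noteq> b" "b \<noteq> c" "c \<noteq> e" "a \<noteq> c" "b \<noteq> e" using loop ab bc ce by auto
  have fin: "finite (boundary Y)" using Y(1) finD by (auto simp: boundary_def intro: finite_subset)
  have three: "card {(a, b), (b, c), (c, e)} = 3" using ne by auto
  then show "3 \<le> card (boundary Y)"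
    using card_mono[OF fin, of "{(a, b), (b, c), (c, e)}"] ab bc ce by simp
  assume "card (boundary Y) = 3"
  then have "boundary Y = {(a, b), (b, c), (c, e)}"
    using card_subset_eq[OF fin, of "{(a, b), (b, c), (c, e)}"] ab bc ce three by simp
  \<comment> \<open>The arc \<open>(e, f)\<close> must be one of the three, and \<open>e\<close>
    differs from \<open>b\<close> and \<open>c\<close>; hence \<open>e = a\<close> and the walk
    closes up.\<close>
  then show "\<exists>a b c. boundary Y = {(a, b), (b, c), (c, a)}"
    using ef ne by auto
qed

lemma boundary_region: "d \<in> D \<Longrightarrow> boundary (region H d) \<subseteq> region H d \<inter> H"
  using region_D[of d H] by (auto simp: boundary_def dest: region_swap)

lemma sum_card_regions:
  assumes "H \<subseteq> D"
  shows "(\<Sum>R\<in>region H ` D. card (R \<inter> H)) = card H"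
proof -
  have "card (\<Union>((\<lambda>R. R \<inter> H) ` region H ` D)) = (\<Sum>R\<in>region H ` D. card (R \<inter> H))"
  proof (rule card_UN_disjoint)
    show "finite (region H ` D)" using finD by simp
    show "\<forall>R\<in>region H ` D. finite (R \<inter> H)" using finD assms by (auto intro: finite_subset)
    show "\<forall>R\<in>region H ` D. \<forall>R'\<in>region H ` D. R \<noteq> R' \<longrightarrow> (R \<inter> H) \<inter> (R' \<inter> H) = {}"
      using region_eqI by blast
  qed
  moreover have "\<Union>((\<lambda>R. R \<inter> H) ` region H ` D) = H"
    using assms by (auto intro: region_self)
  ultimately show ?thesis by simp
qed

lemma nreg_region: "nreg H = card (region H ` D)"
  by (simp add: ncls_def region_def)

lemma region_card_ge:
  assumes "d \<in> D" "nreg H \<ge> 2"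
  shows "3 \<le> card (boundary (region H d))"
    "card (boundary (region H d)) = 3 \<Longrightarrow> \<exists>a b c. boundary (region H d) = {(a, b), (b, c), (c, a)}"
proof -
  have "region H d \<noteq> D"
  proof
    assume "region H d = D"
    then have "region H e = D" if "e \<in> D" for e using region_eqI[of e H d] that by simp
    then have "region H ` D \<subseteq> {D}" by auto
    then have "nreg H \<le> 1" unfolding nreg_region using card_mono[of "{D}" "region H ` D"] by simp
    then show False using assms(2) by simp
  qed
  moreover have "region H d \<noteq> {}" using region_self[of d H] by blast
  moreover have "\<phi> e \<in> region H d" if "e \<in> region H d" for e
    using that region_D[OF assms(1)] by (blast intro: region_phi)
  ultimately show "3 \<le> card (boundary (region H d))"
    "card (boundary (region H d)) = 3 \<Longrightarrow> \<exists>a b c. boundary (region H d) = {(a, b), (b, c), (c, a)}"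
    using boundary_triangle[OF region_D[OF assms(1)]] by blast+
qed

text \<open>If no edge of \<open>H\<close> at \<open>v\<close> bounds the region from inside,
  turning around \<open>v\<close> never crosses \<open>H\<close>.\<close>

lemma region_rotate:
  assumes "(v, x) \<in> region H d" "d \<in> D" "(v, y) \<in> D"
    and "\<And>y. (v, y) \<in> region H d \<Longrightarrow> (v, y) \<notin> H"
  shows "(v, y) \<in> region H d"
proof -
  have "(v, x) \<in> D" using assms(1,2) region_D by blast
  then obtain k where k: "y = (\<rho> v ^^ k) x" using rho_reach assms(3) by blast
  have "(v, (\<rho> v ^^ k) x) \<in> region H d" for k
  proof (induction k)
    case (Suc k)
    let ?e = "(v, (\<rho> v ^^ k) x)"
    have "?e \<in> D - H" using Suc assms(4) region_D[OF assms(2)] by blast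
    then have "prod.swap ?e \<in> region H d" "prod.swap ?e \<in> D"
      using Suc region_swap swap_D by blast+
    then have "\<phi> (prod.swap ?e) \<in> region H d" by (rule region_phi)
    then show ?case by (simp add: phi_simp)
  qed (use assms(1) in simp)
  then show ?thesis using k by simp
qed

context
  fixes S
  assumes S: "S \<subseteq> V" "3 \<le> card S"
begin

private definition "H = D \<inter> S \<times> S"

private lemma H: "H \<subseteq> D" "sym H"
  using D_rev by (auto simp: H_def sym_def)

private lemma cards: "card (V - S) + card S = card V"
  using S finV by (simp add: card_Diff_subset finite_subset card_mono)

private lemma eul: "card H + 4 \<le> 2 * card S + 2 * nreg H"
proof -
  have "card (V - S) + 1 \<le> ncomp H"
  proof (rule ncls_ge[OF finV])
    have "S \<noteq> {}" using S(2) by auto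
    then show "V - S \<subset> V" using S(1) by blast
  qed (auto simp: H_def)
  then show ?thesis using euler_subgraph[OF H] cards by linarith
qed

private lemma regs: "nreg H \<ge> 2 \<Longrightarrow> 3 * nreg H \<le> card H"
proof -
  assume f: "nreg H \<ge> 2"
  have "3 \<le> card (R \<inter> H)" if R: "R \<in> region H ` D" for R
  proof -
    obtain d where d: "d \<in> D" "R = region H d" using R by blast
    have "card (boundary R) \<le> card (R \<inter> H)"
      using d boundary_region[of d H] H finD by (intro card_mono) (auto intro: finite_subset)
    then show ?thesis using region_card_ge(1)[OF d(1) f] d by simp
  qed
  then have "of_nat (card (region H ` D)) * 3 \<le> (\<Sum>R\<in>region H ` D. card (R \<inter> H))"
    by (rule sum_bounded_below)
  then show ?thesis using sum_card_regions[OF H(1)] by (simp add: nreg_region)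
qed

text \<open>This is the bound of 3n - 6 edges, counted in arcs. With at least two regions each has
  three boundary arcs; with fewer, the component count in Euler's formula is already enough.\<close>

lemma induced_card_le: "card (D \<inter> S \<times> S) + 12 \<le> 6 * card S"
  using eul regs S(2) unfolding H_def[symmetric] by (cases "nreg H \<ge> 2") linarith+

text \<open>In an extremal subgraph every region has exactly three arcs of \<open>H\<close>. The
  region around \<open>u\<close> is thus bounded by a triangle, and all neighbours of
  \<open>u\<close> in \<open>S\<close> are corners of it.\<close>

lemma induced_tight:
  assumes tight: "card (D \<inter> S \<times> S) + 12 = 6 * card S"
    and u: "u \<notin> S" and w: "w \<in> S" "(u, w) \<in> D" and z: "z \<in> S" "(u, z) \<in> D"
  shows "w = z \<or> (w, z) \<in> D"
proof -
  note t = tight[folded H_def]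
  \<comment> \<open>Tightness turns \<open>eul\<close> and \<open>regs\<close> into opposite bounds
    on the number of regions.\<close>
  have f: "nreg H \<ge> 2" "nreg H = 2 * card S - 4" using eul regs t S(2) by linarith+
  define Y where "Y = region H (u, w)"
  have YD: "Y \<subseteq> D" unfolding Y_def using w by (intro region_D)
  have bY: "boundary Y \<subseteq> Y \<inter> H" unfolding Y_def using w by (intro boundary_region)
  have bd3: "3 \<le> card (boundary (region H d))" if "d \<in> D" for d by (rule region_card_ge[OF that f(1)])
  have finH: "finite H" using H finD finite_subset by blast
  have le: "card (boundary R) \<le> card (R \<inter> H)" if "R \<in> region H ` D" for R
    using that boundary_region[of _ H] finH by (intro card_mono) auto
  have "card (Y \<inter> H) = 3"
  proof (rule ccontr)
    assume "card (Y \<inter> H) \<noteq> 3"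
    have YR: "Y \<in> region H ` D" using w by (auto simp: Y_def)
    have "(\<Sum>R\<in>region H ` D. 3) < (\<Sum>R\<in>region H ` D. card (R \<inter> H))"
    proof (rule sum_strict_mono_ex1)
      show "finite (region H ` D)" using finD by simp
      show "\<forall>R\<in>region H ` D. 3 \<le> card (R \<inter> H)" using bd3 le by fastforce
      then show "\<exists>R\<in>region H ` D. 3 < card (R \<inter> H)"
        using YR \<open>card (Y \<inter> H) \<noteq> 3\<close> by (intro bexI[of _ Y]) fastforce+
    qed
    then show False using sum_card_regions[OF H(1)] f t S(2) by (simp add: nreg_region)
  qed
  moreover have "3 \<le> card (boundary Y)" unfolding Y_def using w by (intro bd3)
  ultimately have Y3: "boundary Y = Y \<inter> H" "card (boundary Y) = 3"
    using card_seteq[OF _ bY] finH by simp_all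
  then have "\<exists>a b c. boundary Y = {(a, b), (b, c), (c, a)}"
    using region_card_ge(2)[OF w(2) f(1)] by (simp only: Y_def)
  then obtain a b c where abc: "Y \<inter> H = {(a, b), (b, c), (c, a)}"
    by (auto simp only: Y3)
  have uY: "(u, x) \<in> Y" if "(u, x) \<in> D" for x
    unfolding Y_def by (rule region_rotate[of u w]) (use that w u in \<open>auto simp: H_def\<close>)
  have on: "x \<in> {a, b, c}" if x: "x \<in> S" "(u, x) \<in> D" for x
  proof -
    \<comment> \<open>An isolated vertex of \<open>S\<close> would add a component, which Euler's
      formula leaves no room for in the extremal case.\<close>
    have "\<exists>y. (x, y) \<in> H"
    proof (rule ccontr)
      assume n: "\<nexists>y. (x, y) \<in> H"
      have "insert x (V - S) \<subset> V"
      proof -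
        have "card {x} < card S" using S by simp
        then have "\<not> S \<subseteq> {x}" using card_mono[of "{x}" S] by auto
        then show ?thesis using S x by auto
      qed
      moreover have "d \<notin> insert x (V - S) \<and> e \<notin> insert x (V - S)" if "(d, e) \<in> H" for d e
        using that n H(2) by (auto simp: H_def dest: symD)
      ultimately have "card (insert x (V - S)) + 1 \<le> ncomp H"
        by (intro ncls_ge[OF finV])
      then have "card (V - S) + 2 \<le> ncomp H" using x finV by simp
      then show False using euler_subgraph[OF H] cards f t S(2) by linarith
    qed
    then obtain y where y: "(x, y) \<in> H" by auto
    \<comment> \<open>Otherwise one could turn around \<open>x\<close> from the arc to
      \<open>u\<close> up to \<open>(x, y)\<close> without crossing \<open>H\<close>, and
      \<open>(x, y)\<close> itself would lie in \<open>Y\<close>.\<close>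
    have "\<exists>y'. (x, y') \<in> Y \<inter> H"
    proof (rule ccontr)
      assume n: "\<nexists>y'. (x, y') \<in> Y \<inter> H"
      have "(u, x) \<notin> H" using u by (simp add: H_def)
      then have xu: "(x, u) \<in> Y" using uY x region_swap[of "(u, x)" H "(u, w)"] unfolding Y_def by simp
      have "(x, y) \<in> region H (u, w)"
      proof (rule region_rotate)
        show "(x, u) \<in> region H (u, w)" using xu by (simp add: Y_def)
        show "(x, y) \<in> D" using y H by auto
      qed (use n w in \<open>auto simp: Y_def\<close>)
      then show False using n y by (auto simp: Y_def)
    qed
    then show ?thesis using abc by auto
  qed
  have "{(a, b), (b, c), (c, a)} \<subseteq> D" using abc YD by auto
  then show ?thesis using on[OF w] on[OF z] D_rev by auto
qed

end

end

subsection \<open>Orientations with outdegree three\<close>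

lemma three_zero: "(3::3) = 0"
  by simp

text \<open>Cutting a walk at its last departure from \<open>x\<close> keeps the rest disjoint from
  the arcs leaving \<open>x\<close>, so reversing the first arc does not disturb the rest.\<close>

lemma rtrancl_last_exit:
  assumes "(x, y) \<in> P\<^sup>*" "x \<noteq> y"
  shows "\<exists>x'. (x, x') \<in> P \<and> (x', y) \<in> (P - {x} \<times> UNIV)\<^sup>*"
  using assms
proof (induction rule: rtrancl_induct)
  case (step y z)
  show ?case
  proof (cases "x = y")
    case True
    then show ?thesis using step by auto
  next
    case False
    then have "(y, z) \<in> P - {x} \<times> UNIV" using step by auto
    then show ?thesis using step False by (meson rtrancl.rtrancl_into_rtrancl)
  qed
qed simp

lemma rtrancl_first_visit:
  assumes "(x, y) \<in> P\<^sup>*" shows "(x, y) \<in> (P - {y} \<times> UNIV)\<^sup>*"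
  using assms
proof (induction rule: converse_rtrancl_induct)
  case (step x z)
  show ?case
  proof (cases "x = y")
    case False
    then have "(x, z) \<in> P - {y} \<times> UNIV" using step by auto
    then show ?thesis using step by (meson converse_rtrancl_into_rtrancl)
  qed simp
qed simp

locale triangulated = plane_map V D \<rho> for V :: "'a set" and D \<rho> +
  fixes r :: "3 \<Rightarrow> 'a"
  assumes face3: "d \<in> D \<Longrightarrow> card (orbit \<phi> d) = 3"
    and outer_face: "\<exists>d\<in>D. {(r i, r (i + 1)) | i. True} = orbit \<phi> d"
    and outer_succ: "\<phi> (r i, r (i + 1)) = (r (i + 1), r (i + 2))"
begin

definition outer_cycle where "outer_cycle = {(r i, r (i + 1)) | i. True}"
definition inner_verts where "inner_verts = V - range r"
definition inner_arcs where "inner_arcs = {(u, v) \<in> D. (u, v) \<notin> outer_cycle \<and> (v, u) \<notin> outer_cycle}"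

lemma outer_cycle_D: "outer_cycle \<subseteq> D"
  using outer_face orbit_D unfolding outer_cycle_def by metis

lemma outer_cycle_face: "\<exists>d\<in>D. outer_cycle = orbit \<phi> d"
  using outer_face unfolding outer_cycle_def .

lemma r_adj: "(r i, r (i + 1)) \<in> D"
  using outer_cycle_D by (auto simp: outer_cycle_def)

lemma r_V: "r i \<in> V"
  using r_adj DVD by blast

lemma r_inj: "inj r"
proof (rule injI)
  fix i j assume eq: "r i = r j"
  have "r 0 \<noteq> r 1" "r 1 \<noteq> r 2" "r 2 \<noteq> r 0"
    using r_adj[of 0] r_adj[of 1] r_adj[of 2] irr three_zero by auto
  then show "i = j" using eq three_cases[of i] three_cases[of j] by auto
qed

lemma card_range_r: "card (range r) = 3"
  by (simp add: card_image r_inj)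

lemma outer_cycle_eq: "outer_cycle = {(r 0, r 1), (r 1, r 2), (r 2, r 0)}"
proof -
  have "outer_cycle = (\<lambda>i. (r i, r (i + 1))) ` UNIV" by (auto simp: outer_cycle_def)
  also have "(UNIV :: 3 set) = {0, 1, 2}" using three_cases by auto
  finally show ?thesis using three_zero by simp
qed

lemma card_V: "card inner_verts + 3 = card V"
proof -
  have "range r \<subseteq> V" using r_V by auto
  then show ?thesis unfolding inner_verts_def
    using card_range_r finV card_mono[OF finV, of "range r"] by (simp add: card_Diff_subset finite_subset)
qed

lemma card_D: "card D + 12 = 6 * card V"
proof -
  have "card D = (\<Sum>F\<in>orbit \<phi> ` D. card F)"
    using sum_faces[OF subset_refl phi_D, of "\<lambda>_. 1::nat"] by simp
  also have "\<dots> = (\<Sum>F\<in>orbit \<phi> ` D. 3)" using face3 by (intro sum.cong) auto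
  finally have "card D = 3 * card (orbit \<phi> ` D)" by simp
  then show ?thesis using euler evenD by auto
qed

lemma inner_arcs_rev: "(u, v) \<in> inner_arcs \<longleftrightarrow> (v, u) \<in> inner_arcs"
  using D_rev by (auto simp: inner_arcs_def)

lemma inner_arcs_D: "inner_arcs \<subseteq> D"
  by (auto simp: inner_arcs_def)

lemma inner_arcs_I: "(u, v) \<in> D \<Longrightarrow> u \<notin> range r \<or> v \<notin> range r \<Longrightarrow> (u, v) \<in> inner_arcs"
  unfolding inner_arcs_def outer_cycle_def by auto

lemma card_inner_arcs: "card inner_arcs = 6 * card inner_verts"
proof -
  let ?B = "{(r 0, r 1), (r 1, r 2), (r 2, r 0), (r 1, r 0), (r 2, r 1), (r 0, r 2)}"
  have ne: "r 0 \<noteq> r 1" "r 1 \<noteq> r 2" "r 2 \<noteq> r 0"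
    using r_inj by (auto dest: injD)
  have "inner_arcs = D - ?B" unfolding inner_arcs_def outer_cycle_eq by auto
  moreover have "?B \<subseteq> D" using outer_cycle_D D_rev by (auto simp: outer_cycle_eq)
  moreover have "card ?B = 6" using ne by auto
  ultimately have "card inner_arcs + 6 = card D" using finD card_mono[of D ?B] by (simp add: card_Diff_subset)
  then show ?thesis using card_D card_V by simp
qed

section \<open>Orientations of the interior edges and reversal of directed paths\<close>

definition orientation :: "('a \<times> 'a) set \<Rightarrow> bool" where
  "orientation Q \<longleftrightarrow> Q \<subseteq> inner_arcs \<and> (\<forall>(u, v)\<in>inner_arcs. ((u, v) \<in> Q) \<noteq> ((v, u) \<in> Q))"

lemma orientationD:
  assumes "orientation Q"
  shows "Q \<subseteq> inner_arcs" "(u, v) \<in> Q \<Longrightarrow> (v, u) \<notin> Q" "(u, v) \<in> inner_arcs \<Longrightarrow> (u, v) \<in> Q \<or> (v, u) \<in> Q"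
  using assms unfolding orientation_def by blast+

lemma orientation_fin: "orientation Q \<Longrightarrow> finite Q"
  using orientationD(1) inner_arcs_D finD finite_subset by metis

abbreviation outdeg :: "('a \<times> 'a) set \<Rightarrow> 'a \<Rightarrow> nat" where
  "outdeg Q x \<equiv> card (Q `` {x})"

lemma fin_out: "orientation Q \<Longrightarrow> finite (Q `` {x})"
  using orientation_fin by (simp add: finite_Image)

lemma sum_outdeg:
  assumes "orientation Q" "finite S"
  shows "(\<Sum>x\<in>S. outdeg Q x) = card (Q \<inter> S \<times> UNIV)"
proof -
  have "Q \<inter> S \<times> UNIV = Sigma S (\<lambda>x. Q `` {x})" by auto
  then show ?thesis using fin_out[OF assms(1)] assms(2) by simp
qed

lemma card_half:
  assumes "orientation Q" "\<And>u v. (u, v) \<in> B \<Longrightarrow> (v, u) \<in> B" "B \<subseteq> inner_arcs"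
  shows "card B = 2 * card (Q \<inter> B)"
proof -
  have B: "B = (Q \<inter> B) \<union> (Q \<inter> B)\<inverse>"
  proof (rule set_eqI)
    fix d
    show "d \<in> B \<longleftrightarrow> d \<in> (Q \<inter> B) \<union> (Q \<inter> B)\<inverse>"
      using assms(2)[of "fst d" "snd d"] assms(2)[of "snd d" "fst d"] assms(3)
        orientationD(3)[OF assms(1), of "fst d" "snd d"] by (cases d) auto
  qed
  have "card ((Q \<inter> B) \<union> (Q \<inter> B)\<inverse>) = card (Q \<inter> B) + card ((Q \<inter> B)\<inverse>)"
    using orientation_fin[OF assms(1)] orientationD(2)[OF assms(1)]
    by (intro card_Un_disjoint) auto
  then show ?thesis using B by (simp add: card_inverse)
qed

lemma orientation_ex: "\<exists>Q. orientation Q"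
proof -
  obtain f :: "'a \<Rightarrow> nat" where f: "inj_on f V"
    using finite_imp_inj_to_nat_seg[OF finV] by auto
  have "orientation {(u, v) \<in> inner_arcs. f u < f v}"
    unfolding orientation_def
  proof (intro conjI ballI, blast, clarify)
    fix u v assume uv: "(u, v) \<in> inner_arcs"
    then have "f u \<noteq> f v" using f inner_arcs_D DVD irr by (metis inj_onD subsetD)
    then show "(((u, v) \<in> {(u, v) \<in> inner_arcs. f u < f v}) = ((v, u) \<in> {(u, v) \<in> inner_arcs. f u < f v})) \<Longrightarrow> False"
      using uv inner_arcs_rev by auto
  qed
  then show ?thesis by blast
qed

lemma induced_interior:
  assumes Q: "orientation Q" and S: "S \<subseteq> V" "range r \<subseteq> S"
  shows "card (D \<inter> S \<times> S) = 2 * card (Q \<inter> S \<times> S) + 6" "card S = card (S \<inter> inner_verts) + 3" "3 \<le> card S"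
proof -
  have finS: "finite S" using S finV finite_subset by blast
  have "inner_arcs \<inter> S \<times> S \<union> (D - inner_arcs) = D \<inter> S \<times> S" "inner_arcs \<inter> S \<times> S \<inter> (D - inner_arcs) = {}"
    using S(2) inner_arcs_D by (auto simp: inner_arcs_def outer_cycle_def)
  then have "card (D \<inter> S \<times> S) = card (inner_arcs \<inter> S \<times> S) + card (D - inner_arcs)"
    using finD inner_arcs_D by (metis card_Un_disjoint finite_Diff finite_Int finite_subset)
  moreover have "card (D - inner_arcs) = 6"
    using card_D card_inner_arcs card_V inner_arcs_D finD by (simp add: card_Diff_subset finite_subset)
  moreover have "card (inner_arcs \<inter> S \<times> S) = 2 * card (Q \<inter> (inner_arcs \<inter> S \<times> S))"
    using Q inner_arcs_rev by (intro card_half) auto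
  moreover have "Q \<inter> (inner_arcs \<inter> S \<times> S) = Q \<inter> S \<times> S" using orientationD(1)[OF Q] by auto
  ultimately show "card (D \<inter> S \<times> S) = 2 * card (Q \<inter> S \<times> S) + 6" by simp
  have "S \<inter> inner_verts = S - range r" using S by (auto simp: inner_verts_def)
  then show "card S = card (S \<inter> inner_verts) + 3"
    using card_range_r S card_mono[OF finS S(2)] finS by (simp add: card_Diff_subset finite_subset)
  then show "3 \<le> card S" by simp
qed

text \<open>Adjoin the outer triangle: with k interior vertices, 3(k + 3) - 6 bounds all edges, and
  three of them are outer edges.\<close>

lemma orientation_sparse:
  assumes "orientation Q" "S \<subseteq> V"
  shows "card (Q \<inter> S \<times> S) \<le> 3 * card (S \<inter> inner_verts)"
proof -
  let ?S = "S \<union> range r"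
  have S: "?S \<subseteq> V" using assms r_V by auto
  have "card (Q \<inter> S \<times> S) \<le> card (Q \<inter> ?S \<times> ?S)"
    using orientation_fin[OF assms(1)] by (intro card_mono) auto
  also have "\<dots> \<le> 3 * card (?S \<inter> inner_verts)"
    using induced_interior[OF assms(1) S] induced_card_le[OF S] by auto
  also have "?S \<inter> inner_verts = S \<inter> inner_verts" by (auto simp: inner_verts_def)
  finally show ?thesis .
qed

lemma reverse_arc:
  assumes Q: "orientation Q" and ab: "(a, b) \<in> Q"
  defines "Q' \<equiv> insert (b, a) (Q - {(a, b)})"
  shows "orientation Q'" "outdeg Q' a + 1 = outdeg Q a" "outdeg Q' b = outdeg Q b + 1"
    "z \<noteq> a \<Longrightarrow> z \<noteq> b \<Longrightarrow> outdeg Q' z = outdeg Q z"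
proof -
  have ne: "a \<noteq> b" using ab orientationD[OF Q] by auto
  have ba: "(b, a) \<notin> Q" using orientationD(2)[OF Q ab] .
  have inner_arcs: "(a, b) \<in> inner_arcs" "(b, a) \<in> inner_arcs" using ab orientationD(1)[OF Q] inner_arcs_rev by auto
  show "orientation Q'"
    unfolding orientation_def
  proof (intro conjI ballI)
    show "Q' \<subseteq> inner_arcs" using inner_arcs orientationD(1)[OF Q] by (auto simp: Q'_def)
    fix d assume d: "d \<in> inner_arcs"
    obtain u v where [simp]: "d = (u, v)" by (cases d)
    have "((u, v) \<in> Q) \<noteq> ((v, u) \<in> Q)"
      using orientationD(2)[OF Q, of u v] orientationD(3)[OF Q, of u v] d by auto
    then show "case d of (u, v) \<Rightarrow> ((u, v) \<in> Q') \<noteq> ((v, u) \<in> Q')"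
      using ab ba ne by (auto simp: Q'_def)
  qed
  have "Q `` {a} = insert b (Q' `` {a})" "b \<notin> Q' `` {a}" "Q' `` {b} = insert a (Q `` {b})" "a \<notin> Q `` {b}"
    using ne ab ba by (auto simp: Q'_def)
  then show "outdeg Q' a + 1 = outdeg Q a" "outdeg Q' b = outdeg Q b + 1"
    using fin_out[OF Q] fin_out[OF \<open>orientation Q'\<close>] by simp_all
  assume "z \<noteq> a" "z \<noteq> b"
  then have "Q' `` {z} = Q `` {z}" by (auto simp: Q'_def)
  then show "outdeg Q' z = outdeg Q z" by simp
qed

text \<open>The path remains implicit; \<open>P\<close> is the set of arcs that may be reversed.
  Discarding the arcs leaving \<open>x\<close> makes \<open>P\<close> smaller and keeps it inside
  the new orientation.\<close>

lemma reverse_path: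
  assumes "orientation Q" "P \<subseteq> Q" "(x, y) \<in> P\<^sup>*" "x \<noteq> y"
  shows "\<exists>Q'. orientation Q' \<and> Q - P \<subseteq> Q' \<and> outdeg Q' x + 1 = outdeg Q x \<and>
    outdeg Q' y = outdeg Q y + 1 \<and> (\<forall>z. z \<noteq> x \<longrightarrow> z \<noteq> y \<longrightarrow> outdeg Q' z = outdeg Q z)"
  using assms
proof (induction "card P" arbitrary: P Q x rule: less_induct)
  case less
  obtain x' where x': "(x, x') \<in> P" "(x', y) \<in> (P - {x} \<times> UNIV)\<^sup>*"
    using rtrancl_last_exit[OF less.prems(3,4)] by blast
  let ?P = "P - {x} \<times> UNIV" and ?Q = "insert (x', x) (Q - {(x, x')})"
  have xx': "(x, x') \<in> Q" using x' less.prems by auto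
  note rev = reverse_arc[OF less.prems(1) xx']
  have xne: "x \<noteq> x'" using orientationD(2)[OF less.prems(1) xx'] xx' by auto
  have x'x: "(x', x) \<notin> P" using orientationD(2)[OF less.prems(1) xx'] less.prems by auto
  show ?case
  proof (cases "x' = y")
    case True
    then show ?thesis using rev less.prems x' by (intro exI[of _ ?Q]) auto
  next
    case False
    have "finite P" using less.prems orientation_fin finite_subset by metis
    then have "card ?P < card P" using x' by (intro psubset_card_mono) auto
    moreover have "?P \<subseteq> ?Q" using less.prems by auto
    ultimately obtain Q' where Q': "orientation Q'" "?Q - ?P \<subseteq> Q'" "outdeg Q' x' + 1 = outdeg ?Q x'"
      "outdeg Q' y = outdeg ?Q y + 1" "\<And>z. z \<noteq> x' \<Longrightarrow> z \<noteq> y \<Longrightarrow> outdeg Q' z = outdeg ?Q z"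
      using less.hyps[of ?P ?Q x'] rev(1) x'(2) False by blast
    have "Q - P \<subseteq> Q'" using Q'(2) x' by auto
    moreover have "outdeg Q' z = outdeg Q z" if "z \<noteq> x" "z \<noteq> y" for z
      using Q'(3) Q'(5)[of z] rev(3) rev(4)[of z] that by (cases "z = x'") auto
    moreover have "outdeg Q' x + 1 = outdeg Q x"
      using Q'(5)[of x] rev(2) xne less.prems(4) by simp
    moreover have "outdeg Q' y = outdeg Q y + 1"
      using Q'(4) rev(4)[of y] False less.prems(4) by simp
    ultimately show ?thesis using Q'(1) by blast
  qed
qed

section \<open>Existence of orientations with outdegree three, and reversal of a cycle through a
  vertex\<close>

definition target :: "'a \<Rightarrow> nat" where
  "target x = (if x \<in> inner_verts then 3 else 0)"

lemma sum_target: "finite S \<Longrightarrow> sum target S = 3 * card (S \<inter> inner_verts)"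
  by (simp add: target_def sum.If_cases Int_def)

definition three_orientation :: "('a \<times> 'a) set \<Rightarrow> bool" where
  "three_orientation Q \<longleftrightarrow> orientation Q \<and> (\<forall>x\<in>V. outdeg Q x = target x)"

lemma reach_V: "orientation Q \<Longrightarrow> x \<in> V \<Longrightarrow> (x, y) \<in> Q\<^sup>* \<Longrightarrow> y \<in> V"
  by (rotate_tac 2, induction rule: rtrancl_induct) (use orientationD(1) inner_arcs_D DVD in blast)+

text \<open>Minimise the total excess. The set reachable from an overfull vertex is closed under
  out-arcs, so by sparsity it contains a deficient vertex, and reversing a path to it lowers the
  excess.\<close>

lemma three_orientation_ex: "\<exists>Q. three_orientation Q"
proof -
  \<comment> \<open>The subtraction is truncated, so only excess counts and deficient vertices
    contribute 0.\<close>
  define \<Phi> where "\<Phi> Q = (\<Sum>x\<in>V. outdeg Q x - target x)" for Q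
  obtain Q where Q: "orientation Q" and min: "\<And>Q'. orientation Q' \<Longrightarrow> \<Phi> Q \<le> \<Phi> Q'"
    using orientation_ex ex_has_least_nat[of orientation _ \<Phi>] by metis
  have le: "outdeg Q x \<le> target x" if x: "x \<in> V" for x
  proof (rule ccontr)
    assume gt: "\<not> outdeg Q x \<le> target x"
    define S where "S = Q\<^sup>* `` {x}"
    have SV: "S \<subseteq> V" using reach_V[OF Q x] by (auto simp: S_def)
    have fin: "finite S" using SV finV finite_subset by blast
    have "Q \<inter> S \<times> UNIV = Q \<inter> S \<times> S" unfolding S_def by auto
    then have "(\<Sum>s\<in>S. outdeg Q s) \<le> sum target S"
      using orientation_sparse[OF Q SV] by (simp add: sum_outdeg[OF Q fin] sum_target[OF fin])
    moreover have "x \<in> S" by (simp add: S_def)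
    ultimately have "\<exists>y\<in>S. outdeg Q y < target y"
      using sum_strict_mono_ex1[OF fin, of target "outdeg Q"] gt by (meson leD not_le)
    then obtain y where y: "(x, y) \<in> Q\<^sup>*" "outdeg Q y < target y" by (auto simp: S_def)
    have "x \<noteq> y" using gt y by auto
    then obtain Q' where Q': "orientation Q'" "outdeg Q' x + 1 = outdeg Q x"
      "outdeg Q' y = outdeg Q y + 1" "\<And>z. z \<noteq> x \<Longrightarrow> z \<noteq> y \<Longrightarrow> outdeg Q' z = outdeg Q z"
      using reverse_path[OF Q subset_refl y(1)] by blast
    have "\<Phi> Q' < \<Phi> Q"
      unfolding \<Phi>_def
    proof (rule sum_strict_mono_ex1[OF finV])
      show "\<forall>z\<in>V. outdeg Q' z - target z \<le> outdeg Q z - target z"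
      proof
        fix z
        show "outdeg Q' z - target z \<le> outdeg Q z - target z"
          using Q'(2,3) Q'(4)[of z] y(2) by (cases "z = x"; cases "z = y") auto
      qed
      show "\<exists>z\<in>V. outdeg Q' z - target z < outdeg Q z - target z"
        using Q'(2) gt x by (intro bexI[of _ x]) auto
    qed
    then show False using min[OF Q'(1)] by simp
  qed
  \<comment> \<open>Without excess there is no deficiency either: the total outdegree is the number
    of interior edges, three times the number of interior vertices.\<close>
  have "outdeg Q x = target x" if "x \<in> V" for x
  proof (rule ccontr)
    assume "outdeg Q x \<noteq> target x"
    then have "(\<Sum>x\<in>V. outdeg Q x) < sum target V"
      using le that by (intro sum_strict_mono_ex1[OF finV]) (auto intro!: bexI[of _ x] le_neq_trans)
    moreover have "Q \<inter> V \<times> UNIV = Q" using orientationD(1)[OF Q] inner_arcs_D DV by auto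
    moreover have "V \<inter> inner_verts = inner_verts" by (auto simp: inner_verts_def)
    moreover have "card inner_arcs = 2 * card (Q \<inter> inner_arcs)" using Q inner_arcs_rev by (intro card_half) auto
    moreover have "Q \<inter> inner_arcs = Q" using orientationD(1)[OF Q] by auto
    ultimately show False using card_inner_arcs by (simp add: sum_outdeg[OF Q finV] sum_target[OF finV])
  qed
  then show ?thesis using Q unfolding three_orientation_def by blast
qed

lemma outer_no_out:
  assumes "three_orientation Q" shows "(r i, x) \<notin> Q"
proof -
  have "outdeg Q (r i) = 0"
    using assms r_V[of i] by (simp add: three_orientation_def target_def inner_verts_def)
  then have "Q `` {r i} = {}" using assms fin_out[of Q "r i"] by (simp add: three_orientation_def)
  then show ?thesis by auto
qed

lemma tail_interior:
  assumes "three_orientation Q" "(u, x) \<in> Q" shows "u \<in> inner_verts"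
proof -
  have "u \<in> V" using assms orientationD(1) inner_arcs_D DVD unfolding three_orientation_def by blast
  moreover have "u \<notin> range r" using outer_no_out[OF assms(1)] assms(2) by auto
  ultimately show ?thesis by (simp add: inner_verts_def)
qed

text \<open>
  If neither \<open>w\<close> nor \<open>z\<close> reaches \<open>u\<close>, the vertices that do not reach \<open>u\<close> induce a triangulation,
  one of whose faces contains \<open>u\<close>; the vertices of this face include \<open>w\<close> and \<open>z\<close>.
\<close>

lemma three_orientation_reversal:
  assumes Q: "three_orientation Q" and uv: "(u, v) \<in> Q"
    and D: "(u, w) \<in> D" "(u, z) \<in> D" and wz: "w \<noteq> z" "(w, z) \<notin> D" and v: "v \<noteq> w" "v \<noteq> z"
  shows "\<exists>Q'. three_orientation Q' \<and> (u, v) \<in> Q' \<and> ((w, u) \<in> Q' \<or> (z, u) \<in> Q')"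
proof (cases "(w, u) \<in> Q \<or> (z, u) \<in> Q")
  case True
  then show ?thesis using Q uv by blast
next
  case False
  have orO: "orientation Q" using Q by (simp add: three_orientation_def)
  have u: "u \<in> inner_verts" using tail_interior[OF Q uv] .
  have out: "(u, w) \<in> Q" "(u, z) \<in> Q"
    using orientationD(3)[OF orO, OF inner_arcs_I[OF D(1)]] orientationD(3)[OF orO, OF inner_arcs_I[OF D(2)]] u False
    by (auto simp: inner_verts_def)
  define S where "S = {x \<in> V. (x, u) \<notin> Q\<^sup>*}"
  have "\<exists>y\<in>{w, z}. (y, u) \<in> Q\<^sup>*"
  proof (rule ccontr)
    assume none: "\<not> (\<exists>y\<in>{w, z}. (y, u) \<in> Q\<^sup>*)"
    have S: "S \<subseteq> V" "finite S" using finV by (auto simp: S_def)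
    have rS: "range r \<subseteq> S"
    proof clarify
      fix i
      have "(r i, u) \<notin> Q\<^sup>*"
      proof
        assume "(r i, u) \<in> Q\<^sup>*"
        then show False
          by (cases rule: converse_rtranclE) (use u outer_no_out[OF Q] in \<open>auto simp: inner_verts_def\<close>)
      qed
      then show "r i \<in> S" using r_V by (simp add: S_def)
    qed
    have "y \<in> S" if "(x, y) \<in> Q" "x \<in> S" for x y
    proof -
      have "y \<in> V" using that(1) orientationD(1)[OF orO] inner_arcs_D DVD(2)[of x y] by blast
      then show ?thesis using that converse_rtrancl_into_rtrancl[of x y Q u] by (auto simp: S_def)
    qed
    \<comment> \<open>\<open>S\<close> is closed under \<open>Q\<close> and contains the outer
      vertices, so its arcs attain the sparsity bound and \<open>induced_tight\<close>
      applies.\<close>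
    then have "Q \<inter> S \<times> UNIV = Q \<inter> S \<times> S" by auto
    then have "card (Q \<inter> S \<times> S) = (\<Sum>x\<in>S. outdeg Q x)" by (simp add: sum_outdeg[OF orO S(2)])
    also have "\<dots> = sum target S"
      using Q S(1) by (intro sum.cong) (auto simp: three_orientation_def)
    finally have "card (Q \<inter> S \<times> S) = 3 * card (S \<inter> inner_verts)" by (simp add: sum_target[OF S(2)])
    then have "card (D \<inter> S \<times> S) + 12 = 6 * card S" "3 \<le> card S"
      using induced_interior[OF orO S(1) rS] by simp_all
    moreover have "u \<notin> S" "w \<in> S" "z \<in> S" using none D DVD by (auto simp: S_def)
    ultimately show False using induced_tight[OF S(1)] D wz by blast
  qed
  then obtain y where y: "y \<in> {w, z}" "(y, u) \<in> Q\<^sup>*" by blast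
  have uy: "(u, y) \<in> Q" using out y by auto
  \<comment> \<open>Reversing \<open>(u, y)\<close> is compensated by reversing a path from
    \<open>y\<close> to \<open>u\<close>. That path avoids arcs leaving \<open>u\<close>, so both
    \<open>(u, v)\<close> and the new arc \<open>(y, u)\<close> survive.\<close>
  let ?Q = "insert (y, u) (Q - {(u, y)})" and ?P = "Q - {u} \<times> UNIV"
  note rev = reverse_arc[OF orO uy]
  have yu: "y \<noteq> u" using uy orientationD(2)[OF orO uy] by auto
  obtain Q' where Q': "orientation Q'" "?Q - ?P \<subseteq> Q'" "outdeg Q' y + 1 = outdeg ?Q y"
    "outdeg Q' u = outdeg ?Q u + 1" "\<And>x. x \<noteq> y \<Longrightarrow> x \<noteq> u \<Longrightarrow> outdeg Q' x = outdeg ?Q x"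
    using reverse_path[OF rev(1), of ?P y u] rtrancl_first_visit[OF y(2)] yu by blast
  have "outdeg Q' x = outdeg Q x" for x
    using Q'(3,4) Q'(5)[of x] rev(2,3) rev(4)[of x] yu by (cases "x = y"; cases "x = u") auto
  then have "three_orientation Q'" using Q Q'(1) by (simp add: three_orientation_def)
  moreover have "(u, v) \<in> ?Q - ?P" using uv v y by auto
  moreover have "(y, u) \<in> ?Q - ?P" using orientationD(2)[OF orO uy] by auto
  ultimately show ?thesis using Q'(2) y by blast
qed

end

subsection \<open>Angle labellings\<close>

lemma cyclic_on_obtain:
  assumes "cyclic_on f S" "b \<in> S"
  obtains n where "0 < n" "(f ^^ n) b = b" "S = (\<lambda>k. (f ^^ k) b) ` {0..<n}" "inj_on (\<lambda>k. (f ^^ k) b) {0..<n}"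
proof -
  have b: "b \<in> orbit f b" and S: "S = orbit f b"
    using assms by (auto simp: cyclic_on_alldef)
  show ?thesis
    using that[of "funpow_dist1 f b b"] orbit_conv_funpow_dist1[OF b] inj_on_funpow_dist1[OF b]
      funpow_dist1_prop[OF b] S by blast
qed

text \<open>Partial sums along the cycle integrate \<open>h\<close>; a vanishing total makes them
  depend on the index modulo the length only, so any choice of index will do.\<close>

lemma cyclic_cocycle:
  fixes h :: "'b \<Rightarrow> 'c :: comm_monoid_add"
  assumes cyc: "cyclic_on f S" and zero: "sum h S = 0"
  shows "\<exists>s. \<forall>x\<in>S. s (f x) = s x + h (f x)"
proof -
  obtain b where b: "b \<in> S" using cyc by (auto simp: cyclic_on_def)
  obtain n where n: "0 < n" "(f ^^ n) b = b" "S = (\<lambda>k. (f ^^ k) b) ` {0..<n}"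
    "inj_on (\<lambda>k. (f ^^ k) b) {0..<n}" using cyclic_on_obtain[OF cyc b] .
  define t where "t k = (\<Sum>j<k. h ((f ^^ Suc j) b))" for k
  have "bij_betw f S S"
    using cyclic_on_inj[OF cyc] cyclic_on_image_eq[OF cyc] by (simp add: bij_betw_def)
  then have "(\<Sum>x\<in>S. h (f x)) = sum h S" by (rule sum.reindex_bij_betw)
  moreover have "t n = (\<Sum>x\<in>S. h (f x))"
    unfolding n(3) sum.reindex[OF n(4)] t_def by (simp add: atLeast0LessThan)
  ultimately have tn: "t n = 0" using zero by simp
  have t0: "t 0 = 0" by (simp add: t_def)
  have shift: "t (n + k) = t k" for k
  proof (induction k)
    case (Suc k)
    have "(f ^^ Suc (n + k)) b = (f ^^ (Suc k + n)) b" by (simp add: add.commute)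
    also have "\<dots> = (f ^^ Suc k) b" unfolding funpow_add using n(2) by simp
    finally show ?case using Suc by (simp add: t_def)
  qed (simp add: tn t0)
  have "t (m * n + k) = t k" for m k
    by (induction m) (simp_all add: shift add.assoc)
  then have tmod: "t k = t (k mod n)" for k
    by (metis div_mult_mod_eq)
  have fmod: "(f ^^ k) b = (f ^^ (k mod n)) b" for k
    using funpow_mod_eq[OF n(2)] by metis
  have eq: "t k = t l" if "(f ^^ k) b = (f ^^ l) b" for k l
  proof -
    have "(f ^^ (k mod n)) b = (f ^^ (l mod n)) b" using that fmod by metis
    then have "k mod n = l mod n" using n(1,4) by (auto dest: inj_onD)
    then show ?thesis using tmod by metis
  qed
  define s where "s x = t (SOME k. (f ^^ k) b = x)" for x
  have s: "s ((f ^^ k) b) = t k" for k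
    unfolding s_def by (rule eq) (rule someI, rule refl)
  have "s (f x) = s x + h (f x)" if x: "x \<in> S" for x
  proof -
    obtain k where k: "x = (f ^^ k) b" using x n(3) by auto
    then have "f x = (f ^^ Suc k) b" by simp
    then show ?thesis using s[of k] s[of "Suc k"] k by (simp add: t_def)
  qed
  then show ?thesis by blast
qed

text \<open>
  The cyclic order of the three outgoing edges and of the incoming edges between them is encoded in
  a labelling that increases by one exactly at the elements of \<open>P\<close>.
\<close>

locale cyclic_labels =
  fixes f :: "'b \<Rightarrow> 'b" and S P :: "'b set" and lab :: "'b \<Rightarrow> 3"
  assumes cyc: "cyclic_on f S" and PS: "P \<subseteq> S" and card_P: "card P = 3"
    and lab: "x \<in> S \<Longrightarrow> lab (f x) = lab x + of_bool (f x \<in> P)"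
begin

lemma funpow_S: "x \<in> S \<Longrightarrow> (f ^^ k) x \<in> S"
  by (rule cyclic_on_funpow_in[OF cyc])

lemma lab_const:
  assumes "a \<in> S" "\<And>l. 0 < l \<Longrightarrow> l \<le> k \<Longrightarrow> (f ^^ l) a \<notin> P"
  shows "lab ((f ^^ k) a) = lab a"
  using assms(2)
proof (induction k)
  case (Suc k)
  then have "(f ^^ Suc k) a \<notin> P" by blast
  then show ?case using Suc lab[OF funpow_S[OF assms(1), of k]] by simp
qed simp

lemma next_P:
  assumes "a \<in> P"
  shows "\<exists>k>0. (f ^^ k) a \<in> P \<and> lab ((f ^^ k) a) = lab a + 1 \<and>
    (\<forall>l. 0 < l \<longrightarrow> l < k \<longrightarrow> (f ^^ l) a \<notin> P \<and> lab ((f ^^ l) a) = lab a)"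
proof -
  have aS: "a \<in> S" using assms PS by auto
  have ex: "\<exists>k. 0 < k \<and> (f ^^ k) a \<in> P"
    using cyclic_on_obtain[OF cyc aS] assms by metis
  define k where "k = (LEAST k. 0 < k \<and> (f ^^ k) a \<in> P)"
  have k: "0 < k" "(f ^^ k) a \<in> P" using LeastI_ex[OF ex] by (simp_all add: k_def)
  have least: "(f ^^ l) a \<notin> P" if "0 < l" "l < k" for l
    using not_less_Least[of l "\<lambda>k. 0 < k \<and> (f ^^ k) a \<in> P"] that by (auto simp: k_def)
  have const: "lab ((f ^^ l) a) = lab a" if "l < k" for l
    by (rule lab_const[OF aS]) (use least that in auto)
  obtain k' where k': "k = Suc k'" using k by (cases k) auto
  have "lab ((f ^^ k) a) = lab a + 1"
    using lab[OF funpow_S[OF aS, of k']] const[of k'] k by (simp add: k')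
  then show ?thesis using k least const by blast
qed

text \<open>Labels grow by one from an element of \<open>P\<close> to the next, so all three occur,
  and three elements leave no room for repetition.\<close>

lemma lab_bij: "bij_betw lab P UNIV"
proof -
  have step: "i + 1 \<in> lab ` P" if "i \<in> lab ` P" for i
    using that next_P by force
  have "P \<noteq> {}" using card_P by auto
  then obtain i where "i \<in> lab ` P" by auto
  then have "i \<in> lab ` P" "i + 1 \<in> lab ` P" "i + 1 + 1 \<in> lab ` P" using step by blast+
  note i = this
  have "x \<in> lab ` P" for x
  proof -
    have "x = i \<or> x = i + 1 \<or> x = i + 1 + 1"
      using three_cases[of "x - i"] by (auto simp: diff_eq_eq algebra_simps)
    then show ?thesis using i by blast
  qed
  then have "lab ` P = UNIV" by blast
  moreover then have "inj_on lab P"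
    using card_P by (intro eq_card_imp_inj_on) (auto intro: card_ge_0_finite)
  ultimately show ?thesis by (simp add: bij_betw_def)
qed

text \<open>The shift converts an angle label at the tail into the colour of the edge, which is the
  label at its head and larger by one.\<close>

definition out :: "3 \<Rightarrow> 'b" where
  "out i = inv_into P lab (i - 1)"

lemma out_P: "out i \<in> P" and lab_out: "lab (out i) = i - 1"
proof -
  have "i - 1 \<in> lab ` P" using lab_bij by (simp add: bij_betw_def)
  then show "out i \<in> P" "lab (out i) = i - 1"
    unfolding out_def by (rule inv_into_into, rule f_inv_into_f)
qed

lemma out_lab: "x \<in> P \<Longrightarrow> out (lab x + 1) = x"
  using lab_bij by (simp add: out_def bij_betw_def)

lemma P_out: "P = range out"
  using out_P out_lab by (auto simp: image_iff) metis

lemma next_out: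
  "\<exists>k>0. (f ^^ k) (out i) = out (i + 1) \<and>
    (\<forall>l. 0 < l \<longrightarrow> l < k \<longrightarrow> (f ^^ l) (out i) \<notin> P \<and> lab ((f ^^ l) (out i)) = i - 1)"
proof -
  obtain k where k: "k > 0" "(f ^^ k) (out i) \<in> P" "lab ((f ^^ k) (out i)) = i"
    "\<forall>l. 0 < l \<longrightarrow> l < k \<longrightarrow> (f ^^ l) (out i) \<notin> P \<and> lab ((f ^^ l) (out i)) = i - 1"
    using next_P[OF out_P[of i]] lab_out[of i] by auto
  then have "(f ^^ k) (out i) = out (i + 1)" using out_lab[of "(f ^^ k) (out i)"] by simp
  then show ?thesis using k by blast
qed

text \<open>The last element of \<open>P\<close> before \<open>x\<close> shares its label. So an
  incoming edge of colour i comes after the outgoing edge of colour i + 1, as realizers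
  demand.\<close>

lemma between_out:
  assumes "x \<in> S - P"
  shows "\<exists>k>0. (f ^^ k) (out (lab x + 1)) = x \<and> (\<forall>l. 0 < l \<longrightarrow> l \<le> k \<longrightarrow> (f ^^ l) (out (lab x + 1)) \<notin> P)"
proof -
  have "\<exists>k. \<exists>a\<in>P. (f ^^ k) a = x"
  proof -
    obtain a where a: "a \<in> P" using card_P by fastforce
    then have "x \<in> orbit f a" using assms PS cyc by (auto simp: cyclic_on_alldef)
    then show ?thesis using a by (auto simp: orbit_altdef)
  qed
  define k where "k = (LEAST k. \<exists>a\<in>P. (f ^^ k) a = x)"
  obtain a where a: "a \<in> P" "(f ^^ k) a = x"
    using LeastI_ex[OF \<open>\<exists>k. \<exists>a\<in>P. (f ^^ k) a = x\<close>] by (auto simp: k_def)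
  have nP: "(f ^^ l) a \<notin> P" if "0 < l" "l \<le> k" for l
  proof
    assume "(f ^^ l) a \<in> P"
    moreover have "(f ^^ (k - l)) ((f ^^ l) a) = x"
      using a(2) that by (metis comp_apply funpow_add le_add_diff_inverse2)
    ultimately have "k \<le> k - l" unfolding k_def by (intro Least_le) auto
    then show False using that by simp
  qed
  have "lab x = lab a" using lab_const[of a k] nP a PS by auto
  then have "out (lab x + 1) = a" using out_lab a by simp
  moreover have "k > 0" using a assms by (cases k) auto
  ultimately show ?thesis using a nP by blast
qed

end

context triangulated
begin

text \<open>
  \<open>M (x, u)\<close> is the label of the angle at \<open>u\<close> that follows the neighbour \<open>x\<close> in counterclockwise
  order. The label of an edge directed from \<open>x\<close> to \<open>u\<close> is \<open>M (x, u)\<close>, the label of the angles on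
  both sides of its head.
\<close>

definition labelling :: "('a \<times> 'a) set \<Rightarrow> ('a \<times> 'a \<Rightarrow> 3) \<Rightarrow> bool" where
  "labelling Q M \<longleftrightarrow> three_orientation Q \<and>
     (\<forall>(x, u)\<in>D. M (\<rho> u x, u) = M (x, u) + of_bool ((u, \<rho> u x) \<in> Q)) \<and>
     (\<forall>(u, v)\<in>Q. M (u, v) = M (v, u) + 1) \<and>
     (\<forall>i x. (x, r i) \<in> D \<longrightarrow> M (x, r i) = i)"

lemma outer_cycle_asym: "(u, v) \<in> outer_cycle \<Longrightarrow> (v, u) \<notin> outer_cycle"
proof -
  have ne: "r 0 \<noteq> r 1" "r 1 \<noteq> r 2" "r 2 \<noteq> r 0" using r_inj by (auto dest: injD)
  assume "(u, v) \<in> outer_cycle"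
  then consider "u = r 0" "v = r 1" | "u = r 1" "v = r 2" | "u = r 2" "v = r 0" by (auto simp: outer_cycle_eq)
  then show ?thesis unfolding outer_cycle_eq by cases (use ne in auto)
qed

text \<open>Outdegree 0 or 3 allows integration around each vertex, giving \<open>s u\<close> up to
  a constant. The edge rule prescribes the differences \<open>g\<close> of these constants, and a
  potential for \<open>g\<close> supplies them.\<close>

lemma labelling_ex:
  assumes Q: "three_orientation Q"
  shows "\<exists>M. labelling Q M"
proof -
  have orQ: "orientation Q" using Q by (simp add: three_orientation_def)
  note QD = subset_trans[OF orientationD(1)[OF orQ] inner_arcs_D]
  have "\<exists>s. \<forall>x\<in>{x. (u, x) \<in> D}. s (\<rho> u x) = s x + (of_bool ((u, \<rho> u x) \<in> Q) :: 3)" if u: "u \<in> V" for u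
  proof (rule cyclic_cocycle[OF cyc[OF u]])
    have fin: "finite {x. (u, x) \<in> D}" using finite_cyclic_on[OF cyc[OF u]] .
    have "{x. (u, x) \<in> D} \<inter> {x. (u, x) \<in> Q} = Q `` {u}" using QD by auto
    then have "(\<Sum>x\<in>{x. (u, x) \<in> D}. of_bool ((u, x) \<in> Q) :: 3) = of_nat (outdeg Q u)"
      using fin by (simp add: of_bool_def sum.If_cases)
    also have "\<dots> = of_nat (target u)" using Q u by (simp add: three_orientation_def)
    also have "\<dots> = 0" using three_zero by (simp add: target_def)
    finally show "(\<Sum>x\<in>{x. (u, x) \<in> D}. of_bool ((u, x) \<in> Q) :: 3) = 0" .
  qed
  then obtain s :: "'a \<Rightarrow> 'a \<Rightarrow> 3" where s':
    "\<forall>u\<in>V. \<forall>x\<in>{x. (u, x) \<in> D}. s u (\<rho> u x) = s u x + of_bool ((u, \<rho> u x) \<in> Q)"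
    using bchoice[of V "\<lambda>u s. \<forall>x\<in>{x. (u, x) \<in> D}. s (\<rho> u x) = s x + (of_bool ((u, \<rho> u x) \<in> Q) :: 3)"]
    by blast
  have s: "s u (\<rho> u x) = s u x + of_bool ((u, \<rho> u x) \<in> Q)" if "(x, u) \<in> D" for x u
    using s' that DVD(2)[OF that] D_rev by auto
  \<comment> \<open>Along a directed edge the value is \<open>s u v - s v u - 2\<close>, against it
    \<open>s v u - s u v - 1\<close>; these are opposite modulo 3.\<close>
  define g where "g = (\<lambda>(u, v). s u v - s v u - 1 - (of_bool ((u, v) \<in> Q \<union> outer_cycle) :: 3))"
  have "\<exists>p. \<forall>(x, y)\<in>D. g (x, y) = p y - p x"
  proof (rule closed_imp_exact)
    fix d assume d: "d \<in> D"
    obtain u v where uv: "d = (u, v)" by (cases d)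
    have "((u, v) \<in> Q \<union> outer_cycle) \<noteq> ((v, u) \<in> Q \<union> outer_cycle)"
      using orientationD[OF orQ] d outer_cycle_asym unfolding uv inner_arcs_def by blast
    then have "g (v, u) + g (u, v) = 0"
      using three_zero by (auto simp: g_def algebra_simps)
    then show "g (prod.swap d) = - g d" by (simp add: uv eq_neg_iff_add_eq_0)
  next
    fix d assume d: "d \<in> D"
    let ?F = "orbit \<phi> d"
    have F: "?F \<subseteq> D" "\<And>e. e \<in> ?F \<Longrightarrow> \<phi> e \<in> ?F" using orbit_D[OF d] by (auto intro: orbit.intros)
    define \<sigma> where "\<sigma> = (\<lambda>(x, u). s u x)"
    \<comment> \<open>The increment of \<open>s\<close> at an outgoing arc cancels the contribution
      of \<open>Q\<close>. What remains telescopes around a face, apart from the constants and the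
      outer arcs.\<close>
    have g: "g (\<phi> e) = \<sigma> e - \<sigma> (\<phi> e) - 1 - of_bool (\<phi> e \<in> outer_cycle)" if "e \<in> ?F" for e
    proof -
      obtain x u where e: "e = (x, u)" by (cases e)
      have "(x, u) \<in> D" using that F(1) e by auto
      moreover have "\<phi> e \<in> outer_cycle \<Longrightarrow> \<phi> e \<notin> Q" using orientationD(1)[OF orQ] by (auto simp: inner_arcs_def)
      ultimately show ?thesis using s[of x u]
        by (auto simp: g_def \<sigma>_def e phi_simp)
    qed
    have "sum g ?F = (\<Sum>e\<in>?F. g (\<phi> e))" by (rule sum_phi[OF F, symmetric])
    also have "\<dots> = (\<Sum>e\<in>?F. \<sigma> e - \<sigma> (\<phi> e) - 1 - of_bool (\<phi> e \<in> outer_cycle))"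
      using g by (intro sum.cong) auto
    also have "\<dots> = sum \<sigma> ?F - (\<Sum>e\<in>?F. \<sigma> (\<phi> e)) - (\<Sum>e\<in>?F. 1) - (\<Sum>e\<in>?F. of_bool (\<phi> e \<in> outer_cycle))"
      by (simp only: sum_subtractf)
    also have "\<dots> = - of_nat (card ?F) - (\<Sum>e\<in>?F. of_bool (e \<in> outer_cycle))"
      using sum_phi[OF F, of \<sigma>] sum_phi[OF F, of "\<lambda>e. of_bool (e \<in> outer_cycle) :: 3"] by simp
    also have "\<dots> = 0"
    proof -
      \<comment> \<open>A face that meets the outer cycle equals it, so the sum is 0 or 3.\<close>
      have "(\<Sum>e\<in>?F. of_bool (e \<in> outer_cycle)) = (0 :: 3)"
      proof (cases "?F \<inter> outer_cycle = {}")
        case True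
        then show ?thesis by (intro sum.neutral) auto
      next
        case False
        then obtain e where e: "e \<in> ?F" "e \<in> outer_cycle" by blast
        obtain d' where d': "d' \<in> D" "outer_cycle = orbit \<phi> d'" using outer_cycle_face by blast
        have "outer_cycle = ?F" using face_eq[OF d e(1)] face_eq[OF d'(1), of e] e(2) d'(2) by simp
        then have "(\<Sum>e\<in>?F. of_bool (e \<in> outer_cycle)) = (\<Sum>e\<in>?F. 1 :: 3)"
          by (intro sum.cong) auto
        also have "\<dots> = 0" using face3[OF d] three_zero by simp
        finally show ?thesis .
      qed
      then show ?thesis using face3[OF d] three_zero by simp
    qed
    finally show "sum g ?F = 0" .
  qed
  then obtain p where p: "\<And>x y. (x, y) \<in> D \<Longrightarrow> g (x, y) = p y - p x" by blast
  define M' where "M' = (\<lambda>(x, u). p u + s u x)"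
  have rot: "M' (\<rho> u x, u) = M' (x, u) + of_bool ((u, \<rho> u x) \<in> Q)" if "(x, u) \<in> D" for x u
    using s[OF that] by (simp add: M'_def)
  have edge: "M' (u, v) = M' (v, u) + 1" if "(u, v) \<in> Q \<union> outer_cycle" for u v
  proof -
    have "(u, v) \<in> D" using that QD outer_cycle_D by auto
    then have "p v = p u + (s u v - s v u - 1 - 1)" using p[of u v] that by (auto simp: g_def)
    then have "M' (u, v) = M' (v, u) - 2" by (simp add: M'_def)
    also have "\<dots> = M' (v, u) + 1" by (simp add: algebra_simps)
    finally show ?thesis .
  qed
  have const: "M' (x, r i) = M' (y, r i)" if xr: "(x, r i) \<in> D" and yr: "(y, r i) \<in> D" for x y i
  proof -
    obtain k where k: "y = (\<rho> (r i) ^^ k) x" using rho_reach[OF D_rev[OF xr] D_rev[OF yr]] by blast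
    have "M' ((\<rho> (r i) ^^ k) x, r i) = M' (x, r i) \<and> ((\<rho> (r i) ^^ k) x, r i) \<in> D" for k
    proof (induction k)
      case (Suc k)
      then show ?case using rot[of "(\<rho> (r i) ^^ k) x" "r i"] outer_no_out[OF Q] rho_D D_rev by auto
    qed (use xr in simp)
    then show ?thesis using k by simp
  qed
  define c where "c = M' (r 1, r 0)"
  have step: "M' (r (i + 1 + 1), r (i + 1)) = M' (r (i + 1), r i) + 1" for i
  proof -
    have "M' (r i, r (i + 1)) = M' (r (i + 1), r i) + 1"
      using edge[of "r i" "r (i + 1)"] by (auto simp: outer_cycle_def)
    moreover have "M' (r (i + 1 + 1), r (i + 1)) = M' (r i, r (i + 1))"
      by (rule const) (use D_rev[OF r_adj[of "i + 1"]] r_adj[of i] in simp_all)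
    ultimately show ?thesis by simp
  qed
  have outer: "M' (r (i + 1), r i) = c + i" for i
    using three_cases[of i] step[of 0] step[of 1] by (auto simp: c_def)
  have "labelling Q (\<lambda>d. M' d - c)"
    unfolding labelling_def
  proof (intro conjI Q)
    show "\<forall>(x, u)\<in>D. M' (\<rho> u x, u) - c = M' (x, u) - c + of_bool ((u, \<rho> u x) \<in> Q)"
      using rot by auto
    show "\<forall>(u, v)\<in>Q. M' (u, v) - c = M' (v, u) - c + 1"
      using edge by auto
    show "\<forall>i x. (x, r i) \<in> D \<longrightarrow> M' (x, r i) - c = i"
    proof (intro allI impI)
      fix i x assume "(x, r i) \<in> D"
      then have "M' (x, r i) = M' (r (i + 1), r i)" using const r_adj D_rev by blast
      then show "M' (x, r i) - c = i" using outer by simp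
    qed
  qed
  then show ?thesis by blast
qed

end

subsection \<open>Monochromatic trees\<close>

lemma card_filter_pair:
  assumes "a \<noteq> b"
  shows "card {x \<in> {a, b}. P x} = of_bool (P a) + of_bool (P b)"
proof -
  have "{x \<in> {a, b}. P x} = (if P a then {a} else {}) \<union> (if P b then {b} else {})" by auto
  then show ?thesis using assms by auto
qed

context triangulated
begin

lemma labellingD:
  assumes "labelling Q M"
  shows "three_orientation Q" "orientation Q"
    "(x, u) \<in> D \<Longrightarrow> M (\<rho> u x, u) = M (x, u) + of_bool ((u, \<rho> u x) \<in> Q)"
    "(u, v) \<in> Q \<Longrightarrow> M (u, v) = M (v, u) + 1"
    "(x, r i) \<in> D \<Longrightarrow> M (x, r i) = i"
  using assms unfolding labelling_def three_orientation_def by auto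

context
  fixes Q M
  assumes L: "labelling Q M"
begin

lemma QD: "Q \<subseteq> D"
  using orientationD(1)[OF labellingD(2)[OF L]] inner_arcs_D by auto

lemma Q_asym: "(u, v) \<in> Q \<Longrightarrow> (v, u) \<notin> Q"
  by (rule orientationD(2)[OF labellingD(2)[OF L]])

lemma Q_tail: "(u, v) \<in> Q \<Longrightarrow> u \<in> inner_verts"
  by (rule tail_interior[OF labellingD(1)[OF L]])

lemma labels_at:
  assumes "u \<in> inner_verts"
  shows "cyclic_labels (\<rho> u) {x. (u, x) \<in> D} (Q `` {u}) (\<lambda>x. M (x, u))"
proof
  have u: "u \<in> V" using assms by (simp add: inner_verts_def)
  show "cyclic_on (\<rho> u) {x. (u, x) \<in> D}" using u by (rule cyc)
  show "Q `` {u} \<subseteq> {x. (u, x) \<in> D}" using QD by auto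
  show "card (Q `` {u}) = 3"
    using labellingD(1)[OF L] u assms by (simp add: three_orientation_def target_def)
  show "M (\<rho> u x, u) = M (x, u) + of_bool (\<rho> u x \<in> Q `` {u})" if "x \<in> {x. (u, x) \<in> D}" for x
    using that labellingD(3)[OF L D_rev] by simp
qed

definition out :: "'a \<Rightarrow> 3 \<Rightarrow> 'a" where
  "out u = cyclic_labels.out (Q `` {u}) (\<lambda>x. M (x, u))"

definition monochrome :: "3 \<Rightarrow> ('a \<times> 'a) set" where
  "monochrome i = {(x, y) \<in> Q. M (x, y) = i}"

lemma out_Q: "u \<in> inner_verts \<Longrightarrow> (u, out u i) \<in> Q"
  using cyclic_labels.out_P[OF labels_at] by (simp add: out_def)

lemma out_label: "u \<in> inner_verts \<Longrightarrow> M (u, out u i) = i"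
  using cyclic_labels.lab_out[OF labels_at] labellingD(4)[OF L out_Q] by (simp add: out_def)

lemma out_eq: "(u, v) \<in> Q \<Longrightarrow> out u (M (u, v)) = v"
  using cyclic_labels.out_lab[OF labels_at[OF Q_tail], of u v v] labellingD(4)[OF L, of u v]
  by (simp add: out_def)

lemma monochrome_iff: "(u, v) \<in> monochrome i \<longleftrightarrow> u \<in> inner_verts \<and> v = out u i"
  using out_Q out_label out_eq Q_tail by (auto simp: monochrome_def)

lemma Q_out: "u \<in> inner_verts \<Longrightarrow> Q `` {u} = range (out u)"
  using cyclic_labels.P_out[OF labels_at] by (simp add: out_def)

lemma monochrome_D: "monochrome i \<subseteq> D"
  using QD by (auto simp: monochrome_def)

lemma monochrome_single: "single_valued (monochrome i)"
  by (auto simp: single_valued_def monochrome_iff)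

text \<open>Each interior vertex has a unique continuation and outer vertices have none, so reaching
  an outer vertex is a property of the whole component.\<close>

lemma sink_reach_iff:
  assumes "(x, y) \<in> monochrome i"
  shows "(\<exists>j. (x, r j) \<in> (monochrome i)\<^sup>*) \<longleftrightarrow> (\<exists>j. (y, r j) \<in> (monochrome i)\<^sup>*)"
proof
  assume "\<exists>j. (x, r j) \<in> (monochrome i)\<^sup>*"
  then obtain j where "(x, r j) \<in> (monochrome i)\<^sup>*" by blast
  then show "\<exists>j. (y, r j) \<in> (monochrome i)\<^sup>*"
  proof (cases rule: converse_rtranclE)
    case base
    then show ?thesis using assms by (auto simp: monochrome_iff inner_verts_def)
  next
    case (step z)
    then have "z = y" using assms by (simp add: monochrome_iff)
    then show ?thesis using step by blast
  qed
qed (use assms converse_rtrancl_into_rtrancl in metis)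

text \<open>
  A component \<open>K\<close> of \<open>monochrome i\<close> without outer vertices has as many edges as vertices, so it separates
  the plane, and some region \<open>Y\<close> of its complement does not contain the outer face. By the local
  conditions, the numbers of vertices, edges and faces inside \<open>Y\<close> contradict Euler's formula.
\<close>

lemma monochrome_reaches_outer:
  assumes v0: "v0 \<in> V"
  shows "\<exists>j. (v0, r j) \<in> (monochrome i)\<^sup>*"
proof (rule ccontr)
  assume none: "\<not> ?thesis"
  define K where "K = conn (monochrome i) `` {v0}"
  have v0K: "v0 \<in> K" by (simp add: K_def)
  have K_iff: "x \<in> K \<longleftrightarrow> y \<in> K" if "(x, y) \<in> monochrome i" for x y
    using conn_edge_iff[OF that, of v0] by (simp add: K_def)
  have "x \<in> {x \<in> V. \<not> (\<exists>j. (x, r j) \<in> (monochrome i)\<^sup>*)}" if "x \<in> K" for x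
  proof (rule conn_closed)
    show "(v0, x) \<in> conn (monochrome i)" using that by (simp add: K_def)
    show "v0 \<in> {x \<in> V. \<not> (\<exists>j. (x, r j) \<in> (monochrome i)\<^sup>*)}" using none v0 by simp
    fix a b assume ab: "(a, b) \<in> monochrome i"
    then have "a \<in> V" "b \<in> V" using monochrome_D DVD by blast+
    then show "a \<in> {x \<in> V. \<not> (\<exists>j. (x, r j) \<in> (monochrome i)\<^sup>*)} \<longleftrightarrow> b \<in> {x \<in> V. \<not> (\<exists>j. (x, r j) \<in> (monochrome i)\<^sup>*)}"
      using sink_reach_iff[OF ab] by blast
  qed
  then have KI: "K \<subseteq> inner_verts" by (auto simp: inner_verts_def)
  have KV: "K \<subseteq> V" using KI by (auto simp: inner_verts_def)
  have finK: "finite K" using KV finV finite_subset by blast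
  have out_K: "out u i \<in> K" if "u \<in> K" for u
    using K_iff[of u "out u i"] that KI by (auto simp: monochrome_iff)
  define H0 where "H0 = (\<lambda>u. (u, out u i)) ` K \<union> (\<lambda>u. (out u i, u)) ` K"
  have outD: "(u, out u i) \<in> D" "(out u i, u) \<in> D" if "u \<in> K" for u
    using out_Q[of u i] QD D_rev[of u "out u i"] KI that by blast+
  then have H0D: "H0 \<subseteq> D" by (auto simp: H0_def)
  have symH0: "sym H0" by (auto simp: sym_def H0_def)
  have H0K: "x \<in> K \<and> y \<in> K" if "(x, y) \<in> H0" for x y
    using that out_K by (auto simp: H0_def)
  have H0Tr: "(x, y) \<in> monochrome i" if "(x, y) \<in> H0" "(y, x) \<notin> monochrome i" for x y
    using that KI by (auto simp: H0_def monochrome_iff)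
  have H0M: "M (x, u) = i" if "(u, x) \<in> H0" "(u, x) \<notin> Q" for x u
    using H0Tr[OF that(1)] that(2) by (auto simp: monochrome_def)
  have out_H0: "(u, out u j) \<notin> H0" if "u \<in> inner_verts" "j \<noteq> i" for u j
  proof
    assume h: "(u, out u j) \<in> H0"
    have "(out u j, u) \<notin> monochrome i" using Q_asym[OF out_Q[OF that(1)]] by (auto simp: monochrome_def)
    then have "(u, out u j) \<in> monochrome i" using H0Tr h by blast
    then show False using out_label[OF that(1), of j] that by (auto simp: monochrome_def)
  qed
  have inj1: "inj_on (\<lambda>u. (u, out u i)) A" and inj2: "inj_on (\<lambda>u. (out u i, u)) A" for A
    by (auto simp: inj_on_def)
  have disj: "(\<lambda>u. (u, out u i)) ` A \<inter> (\<lambda>u. (out u i, u)) ` B = {}" if "A \<subseteq> K" "B \<subseteq> K" for A B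
    using Q_asym out_Q KI that by (auto; metis subsetD)
  have cardH0: "card H0 = 2 * card K"
    unfolding H0_def using disj[of K K] finK by (simp add: card_Un_disjoint card_image inj1 inj2)
  have cK: "card (V - K) + card K = card V"
    using KV finV finK by (simp add: card_Diff_subset card_mono)
  \<comment> \<open>The component has as many edges as vertices, and all other vertices are isolated
    in \<open>H0\<close>; by Euler's formula there is a second region.\<close>
  have "card (V - K) + 1 \<le> ncomp H0"
    by (rule ncls_ge[OF finV]) (use KV v0K H0K in auto)
  then have nreg2: "2 \<le> nreg H0"
    using euler_subgraph[OF H0D symH0] cardH0 cK by linarith
  have "\<exists>d\<in>D. region H0 d \<noteq> region H0 (r 0, r 1)"
  proof (rule ccontr)
    assume "\<not> ?thesis"
    then have "region H0 ` D \<subseteq> {region H0 (r 0, r 1)}" by auto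
    then have "nreg H0 \<le> 1"
      unfolding nreg_region using card_mono[of "{region H0 (r 0, r 1)}" "region H0 ` D"] by simp
    then show False using nreg2 by simp
  qed
  then obtain d0 where d0: "d0 \<in> D" "region H0 d0 \<noteq> region H0 (r 0, r 1)" by blast
  define Y where "Y = region H0 d0"
  have YD: "Y \<subseteq> D" unfolding Y_def by (rule region_D[OF d0(1)])
  have d0Y: "d0 \<in> Y" by (simp add: Y_def)
  have Yphi: "\<phi> e \<in> Y" if "e \<in> Y" for e
    using that YD unfolding Y_def by (auto intro: region_phi)
  have Yphi_iff: "\<phi> e \<in> Y \<longleftrightarrow> e \<in> Y" if "e \<in> D" for e
    using Yphi face_closed[of "\<phi> e" Y] face_eq[OF that orbit.base] self_in_face[OF that] by blast
  have Yswap: "(y, x) \<in> Y" if "(x, y) \<in> Y" "(x, y) \<notin> H0" for x y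
    using region_swap[of "(x, y)" H0 d0] that YD unfolding Y_def by auto
  have Yswap_iff: "(y, x) \<in> Y \<longleftrightarrow> (x, y) \<in> Y" if "(x, y) \<notin> H0" for x y
    using Yswap[of x y] Yswap[of y x] that symH0 by (auto dest: symD)
  have Yrot: "(u, y) \<in> Y" if "(u, x) \<in> Y" "(u, y) \<in> D" "u \<notin> K" for u x y
    unfolding Y_def
  proof (rule region_rotate[OF _ d0(1) that(2)])
    show "(u, x) \<in> region H0 d0" using that by (simp add: Y_def)
  qed (use H0K that in blast)
  have YOA: "Y \<inter> outer_cycle = {}"
  proof -
    have 0: "(r 0, r 1) \<notin> Y" using d0(2) region_eqI[of "(r 0, r 1)" H0 d0] by (force simp: Y_def)
    have D: "(r 0, r 1) \<in> D" "(r 1, r 2) \<in> D" using r_adj[of 0] r_adj[of 1] by simp_all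
    have "\<phi> (r 0, r 1) = (r 1, r 2)" "\<phi> (r 1, r 2) = (r 2, r 0)"
      using outer_succ[of 0] outer_succ[of 1] three_zero by simp_all
    then show ?thesis
      using 0 Yphi_iff[OF D(1)] Yphi_iff[OF D(2)] by (auto simp: outer_cycle_eq)
  qed
  define I where "I = {u \<in> inner_verts - K. \<exists>x. (u, x) \<in> Y}"
  have IY: "(u, y) \<in> Y" if "u \<in> I" "(u, y) \<in> D" for u y
    using that Yrot by (auto simp: I_def)
  have finI: "finite I" using finV by (auto simp: I_def inner_verts_def intro: finite_subset)
  define N where "N = Y - H0"
  have Nsym: "(y, x) \<in> N" if "(x, y) \<in> N" for x y
    using that Yswap symH0 by (auto simp: N_def dest: symD)
  have NIA: "N \<subseteq> inner_arcs"
  proof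
    fix d assume d: "d \<in> N"
    obtain x y where [simp]: "d = (x, y)" by (cases d)
    have "(y, x) \<in> N" using Nsym d by simp
    then show "d \<in> inner_arcs" using d YD YOA unfolding inner_arcs_def N_def by auto
  qed
  have cardN: "card N = 2 * card (Q \<inter> N)"
    by (rule card_half[OF labellingD(2)[OF L]]) (use Nsym NIA in auto)
  define y where "y = card (orbit \<phi> ` Y)"
  have "card Y = (\<Sum>F\<in>orbit \<phi> ` Y. card F)"
    using sum_faces[OF YD Yphi, of "\<lambda>_. 1::nat"] by simp
  also have "\<dots> = (\<Sum>F\<in>orbit \<phi> ` Y. 3)" using face3 YD by (intro sum.cong) auto
  finally have cardY: "card Y = 3 * y" by (simp add: y_def)
  have finY: "finite Y" using YD finD finite_subset by blast
  have cardYN: "card Y = card (Y \<inter> H0) + card N"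
    unfolding N_def using sum.Int_Diff[OF finY, of "\<lambda>_. 1::nat" H0] by simp
  \<comment> \<open>for \<open>j \<noteq> i + 1\<close>, turning from \<open>out u j\<close> to \<open>out u (j + 1)\<close> crosses no edge of \<open>monochrome i\<close>\<close>
  have walk: "(out u j, u) \<in> Y \<longleftrightarrow> (u, out u (j + 1)) \<in> Y" if u: "u \<in> inner_verts" and j: "j \<noteq> i + 1" for u j
  proof -
    interpret c: cyclic_labels "\<rho> u" "{x. (u, x) \<in> D}" "Q `` {u}" "\<lambda>x. M (x, u)" by (rule labels_at[OF u])
    obtain k where k: "k > 0" "(\<rho> u ^^ k) (out u j) = out u (j + 1)"
      "\<And>l. 0 < l \<Longrightarrow> l < k \<Longrightarrow> (\<rho> u ^^ l) (out u j) \<notin> Q `` {u} \<and> M ((\<rho> u ^^ l) (out u j), u) = j - 1"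
      using c.next_out[of j, folded out_def] by blast
    have D: "((\<rho> u ^^ l) (out u j), u) \<in> D" for l
      using c.funpow_S[of "out u j" l] out_Q[OF u] QD D_rev by auto
    have "(out u j, u) \<in> Y \<longleftrightarrow> (u, (\<rho> u ^^ Suc l) (out u j)) \<in> Y" if "l < k" for l
      using that
    proof (induction l)
      case 0
      then show ?case using Yphi_iff[OF D[of 0]] by (simp add: phi_simp)
    next
      case (Suc l)
      let ?x = "(\<rho> u ^^ Suc l) (out u j)"
      have "(u, ?x) \<notin> H0"
        using H0M[of u ?x] k(3)[of "Suc l"] Suc.prems j by (auto simp: diff_eq_eq)
      then have "(u, ?x) \<in> Y \<longleftrightarrow> (?x, u) \<in> Y" using Yswap_iff by blast
      also have "\<dots> \<longleftrightarrow> (u, (\<rho> u ^^ Suc (Suc l)) (out u j)) \<in> Y"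
        using Yphi_iff[OF D[of "Suc l"]] by (simp add: phi_simp)
      finally show ?case using Suc by simp
    qed
    from this[of "k - 1"] show ?thesis using k(1,2) by simp
  qed
  have ne3: "i - 1 \<noteq> i + 1" "i + 1 \<noteq> i" "i - 1 \<noteq> i" "i \<noteq> i + 1" for i :: 3
    by (simp_all add: diff_eq_eq)
  \<comment> \<open>The two sectors beside the edge from \<open>u\<close> to \<open>out u i\<close>
    contain no incoming edge of colour \<open>i\<close>. Each side of this edge that lies in
    \<open>Y\<close> therefore brings exactly one of the other two outgoing edges into
    \<open>Y\<close>.\<close>
  have next_in: "(u, out u (i + 1)) \<in> Y \<longleftrightarrow> (out u i, u) \<in> Y" if "u \<in> K" for u
    using walk[of u i] that KI by (auto simp: ne3)
  have prev_in: "(u, out u (i - 1)) \<in> Y \<longleftrightarrow> (u, out u i) \<in> Y" if "u \<in> K" for u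
    using walk[of u "i - 1"] that KI Yswap_iff[of u "out u (i - 1)"] out_H0[of u "i - 1"] ne3(1,3)
    by auto
  \<comment> \<open>Edges strictly inside \<open>Y\<close> are counted at their tails: three for
    each vertex of \<open>I\<close>, and at the vertices of \<open>K\<close> one for each boundary
    side in \<open>Y\<close>.\<close>
  have cQN: "card (Q \<inter> N) = 3 * card I + card (Y \<inter> H0)"
  proof -
    define B where "B u = {x. (u, x) \<in> Q \<inter> N}" for u
    have "Q \<inter> N = Sigma (I \<union> K) B"
    proof -
      have "u \<in> I \<union> K" if "(u, x) \<in> Q \<inter> N" for u x
        using that Q_tail by (auto simp: I_def N_def)
      then show ?thesis by (auto simp: B_def)
    qed
    moreover have "finite (B u)" for u
      by (rule finite_subset[of _ "Q `` {u}"])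
         (auto simp: B_def fin_out[OF labellingD(2)[OF L]])
    ultimately have "card (Q \<inter> N) = (\<Sum>u\<in>I \<union> K. card (B u))"
      using finI finK by simp
    also have "\<dots> = (\<Sum>u\<in>I. card (B u)) + (\<Sum>u\<in>K. card (B u))"
      using finI finK by (intro sum.union_disjoint) (auto simp: I_def)
    also have "(\<Sum>u\<in>I. card (B u)) = (\<Sum>u\<in>I. 3)"
    proof (rule sum.cong)
      fix u assume u: "u \<in> I"
      then have uI: "u \<in> inner_verts" by (simp add: I_def)
      have "(u, x) \<in> N" if "(u, x) \<in> Q" for x
        using that u IY[OF u, of x] QD H0K[of u x] by (auto simp: N_def I_def)
      then have "B u = Q `` {u}" by (auto simp: B_def)
      then show "card (B u) = 3" using labels_at[OF uI] by (simp add: cyclic_labels_def)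
    qed simp
    also have "(\<Sum>u\<in>K. card (B u)) = (\<Sum>u\<in>K. of_bool ((out u i, u) \<in> Y) + of_bool ((u, out u i) \<in> Y))"
    proof (rule sum.cong)
      fix u assume u: "u \<in> K"
      then have uI: "u \<in> inner_verts" using KI by auto
      have i: "(u, out u i) \<in> H0" using u by (auto simp: H0_def)
      have UN: "UNIV = {i, i + 1, i - 1}"
      proof -
        have "x = i \<or> x = i + 1 \<or> x = i - 1" for x
          using three_cases[of "x - i"] by (auto simp: diff_eq_eq algebra_simps)
        then show ?thesis by auto
      qed
      have "B u = {x \<in> range (out u). (u, x) \<in> Y \<and> (u, x) \<notin> H0}"
        using Q_out[OF uI] by (auto simp: B_def N_def)
      also have "\<dots> = {x \<in> {out u (i + 1), out u (i - 1)}. (u, x) \<in> Y}"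
      proof -
        have "range (out u) = {out u i, out u (i + 1), out u (i - 1)}" by (simp add: UN)
        moreover have "(u, out u (i + 1)) \<notin> H0" "(u, out u (i - 1)) \<notin> H0"
          using out_H0[OF uI] ne3 by metis+
        ultimately show ?thesis using i by auto
      qed
      finally have B: "B u = {x \<in> {out u (i + 1), out u (i - 1)}. (u, x) \<in> Y}" .
      have "out u (i + 1) \<noteq> out u (i - 1)"
        using out_label[OF uI, of "i + 1"] out_label[OF uI, of "i - 1"] ne3(1)[of i] by auto
      then show "card (B u) = of_bool ((out u i, u) \<in> Y) + of_bool ((u, out u i) \<in> Y)"
        unfolding B next_in[OF u, symmetric] prev_in[OF u, symmetric] by (rule card_filter_pair)
    qed simp
    also have "\<dots> = card {u \<in> K. (out u i, u) \<in> Y} + card {u \<in> K. (u, out u i) \<in> Y}"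
      using finK by (simp add: sum.distrib of_bool_def sum.If_cases Int_def)
    also have "\<dots> = card (Y \<inter> H0)"
    proof -
      have "Y \<inter> H0 = (\<lambda>u. (u, out u i)) ` {u \<in> K. (u, out u i) \<in> Y} \<union>
          (\<lambda>u. (out u i, u)) ` {u \<in> K. (out u i, u) \<in> Y}"
        by (auto simp: H0_def)
      then show ?thesis
        using disj[of "{u \<in> K. (u, out u i) \<in> Y}" "{u \<in> K. (out u i, u) \<in> Y}"] finK
        by (simp add: card_Un_disjoint card_image inj1 inj2)
    qed
    finally show ?thesis by simp
  qed
  \<comment> \<open>Deleting the edges inside \<open>Y\<close> keeps the faces outside as regions
    and leaves at least one region in place of the \<open>y\<close> faces inside.\<close>
  define H1 where "H1 = D - N"
  have H1D: "H1 \<subseteq> D" and symH1: "sym H1"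
    using Nsym D_rev by (auto simp: H1_def sym_def)
  have ND: "N \<subseteq> D" using YD by (auto simp: N_def)
  have cardH1: "card H1 + card N = card D"
    unfolding H1_def using ND finD by (simp add: card_Diff_subset card_mono finite_subset)
  have out_reg: "region H1 d = orbit \<phi> d" if d: "d \<in> D - Y" for d
  proof
    have dY: "e \<notin> Y" if e: "e \<in> orbit \<phi> d" for e
    proof
      assume "e \<in> Y"
      then have "orbit \<phi> e \<subseteq> Y" using Yphi by (rule face_closed)
      then show False using face_eq[OF _ e] self_in_face[of d] d by auto
    qed
    show "region H1 d \<subseteq> orbit \<phi> d"
    proof
      fix e assume "e \<in> region H1 d"
      then have "(d, e) \<in> conn (reg H1)" by (simp add: region_iff)
      then show "e \<in> orbit \<phi> d"
      proof (rule conn_closed)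
        show "d \<in> orbit \<phi> d" using d by (intro self_in_face) auto
        fix a b assume ab: "(a, b) \<in> reg H1"
        show "a \<in> orbit \<phi> d \<longleftrightarrow> b \<in> orbit \<phi> d"
        proof (cases "b = \<phi> a")
          case True
          have "a \<in> D" using ab by (auto simp: reg_def)
          then show ?thesis
            using True face_eq[of a b] face_eq[of d] d self_in_face[of a] self_in_face[of b] phi_D
            by (metis DiffD1 orbit.intros)
        next
          case False
          then have "a \<in> N" "b = prod.swap a" using ab by (auto simp: reg_def H1_def)
          then have "a \<in> Y" "b \<in> Y" using Nsym[of "fst a" "snd a"] by (auto simp: N_def prod.swap_def)
          then show ?thesis using dY by blast
        qed
      qed
    qed
    show "orbit \<phi> d \<subseteq> region H1 d"
      using region_phi[of _ H1 d] region_D[of d H1] d by (intro face_closed) auto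
  qed
  have in_reg: "region H1 d0 \<subseteq> Y"
  proof
    fix e assume "e \<in> region H1 d0"
    then have "(d0, e) \<in> conn (reg H1)" by (simp add: region_iff)
    then show "e \<in> Y"
    proof (rule conn_closed[OF _ d0Y])
      fix a b assume ab: "(a, b) \<in> reg H1"
      show "a \<in> Y \<longleftrightarrow> b \<in> Y"
      proof (cases "b = \<phi> a")
        case True
        then show ?thesis using ab Yphi_iff[of a] by (auto simp: reg_def)
      next
        case False
        then have "a \<in> N" "b = prod.swap a" using ab by (auto simp: reg_def H1_def)
        then show ?thesis using Nsym[of "fst a" "snd a"] by (auto simp: N_def prod.swap_def)
      qed
    qed
  qed
  have "card (orbit \<phi> ` D) + 1 \<le> nreg H1 + y"
  proof -
    have "orbit \<phi> ` D \<subseteq> orbit \<phi> ` Y \<union> orbit \<phi> ` (D - Y)" using YD by auto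
    then have "card (orbit \<phi> ` D) \<le> card (orbit \<phi> ` Y \<union> orbit \<phi> ` (D - Y))"
      using finD finY by (intro card_mono) auto
    also have "\<dots> \<le> y + card (orbit \<phi> ` (D - Y))"
      unfolding y_def by (rule card_Un_le)
    finally have "card (orbit \<phi> ` D) \<le> y + card (orbit \<phi> ` (D - Y))" .
    moreover have "region H1 d0 \<notin> orbit \<phi> ` (D - Y)"
    proof
      assume "region H1 d0 \<in> orbit \<phi> ` (D - Y)"
      then obtain d where d: "d \<in> D - Y" "region H1 d0 = orbit \<phi> d" by auto
      then have "d \<in> region H1 d0" using self_in_face[of d] by simp
      then show False using in_reg d by auto
    qed
    then have "card (insert (region H1 d0) (orbit \<phi> ` (D - Y))) = card (orbit \<phi> ` (D - Y)) + 1"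
      using finD by simp
    moreover have "insert (region H1 d0) (orbit \<phi> ` (D - Y)) \<subseteq> region H1 ` D"
      using d0(1) out_reg by (auto; metis DiffI image_eqI)
    then have "card (insert (region H1 d0) (orbit \<phi> ` (D - Y))) \<le> nreg H1"
      unfolding nreg_region using finD by (intro card_mono) auto
    ultimately show ?thesis by linarith
  qed
  moreover obtain m where m: "card D = 2 * m" using evenD by blast
  moreover have "card V + card (orbit \<phi> ` D) = m + 2" using euler m by simp
  \<comment> \<open>Three arcs per face give \<open>y = 2 * card I + card (Y \<inter> H0)\<close>.
    The size of the boundary then cancels in Euler's formula for \<open>H1\<close>.\<close>
  ultimately have lower: "card I + 2 \<le> ncomp H1"
    using euler_subgraph[OF H1D symH1] cardH1 cardN cQN cardY cardYN by linarith
  have "ncomp H1 \<le> card I + 1"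
  proof (rule ncls_le[OF finV])
    show "I \<subseteq> V" by (auto simp: I_def inner_verts_def)
    have H01: "H0 \<subseteq> H1" using H0D by (auto simp: H1_def N_def)
    have Kcon: "(v0, x) \<in> conn H1" if "x \<in> K" for x
    proof -
      have "x \<in> {x \<in> K. (v0, x) \<in> conn H1}"
      proof (rule conn_closed)
        show "(v0, x) \<in> conn (monochrome i)" using that by (simp add: K_def)
        show "v0 \<in> {x \<in> K. (v0, x) \<in> conn H1}" using v0K by simp
        fix a b assume ab: "(a, b) \<in> monochrome i"
        have "(a, b) \<in> H1" if "a \<in> K"
        proof -
          have "(a, b) \<in> H0" using ab that by (auto simp: H0_def monochrome_iff)
          then show ?thesis using H01 by blast
        qed
        then have "a \<in> K \<Longrightarrow> (v0, a) \<in> conn H1 \<longleftrightarrow> (v0, b) \<in> conn H1" by (simp add: conn_edge_iff)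
        then show "a \<in> {x \<in> K. (v0, x) \<in> conn H1} \<longleftrightarrow> b \<in> {x \<in> K. (v0, x) \<in> conn H1}"
          using K_iff[OF ab] by blast
      qed
      then show ?thesis by simp
    qed
    \<comment> \<open>A bad vertex has no arc in \<open>Y\<close>, so all its edges survive in
      \<open>H1\<close> and its neighbours are bad again. Connectedness of the graph would make
      \<open>v0\<close> bad.\<close>
    define Bad where "Bad = {x \<in> V - I. (v0, x) \<notin> conn H1}"
    have step: "b \<in> Bad" if ab: "(a, b) \<in> D" and a: "a \<in> Bad" for a b
    proof -
      have aK: "a \<notin> K" using a Kcon by (auto simp: Bad_def)
      have aY: "(a, x) \<notin> Y" for x
      proof
        assume ax: "(a, x) \<in> Y"
        then obtain j where j: "a = r j" using a aK by (auto simp: Bad_def I_def inner_verts_def)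
        then have "(a, r (j + 1)) \<in> D" using r_adj by simp
        then have "(r j, r (j + 1)) \<in> Y" using Yrot[OF ax _ aK] j by simp
        then show False using YOA by (auto simp: outer_cycle_def)
      qed
      have "(a, b) \<in> H1" using ab aY by (auto simp: H1_def N_def)
      then have "(v0, b) \<notin> conn H1" using a conn_edge_iff[of a b H1 v0] by (simp add: Bad_def)
      moreover have "b \<notin> I"
      proof
        assume b: "b \<in> I"
        then have "(b, a) \<in> Y" "(b, a) \<notin> H0" using IY D_rev[OF ab] H0K aK by blast+
        then show False using Yswap aY by blast
      qed
      ultimately show ?thesis using ab DVD by (auto simp: Bad_def)
    qed
    fix x assume x: "x \<in> V - I"
    show "(x, v0) \<in> conn H1"
    proof (rule ccontr)
      assume "(x, v0) \<notin> conn H1"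
      then have "x \<in> Bad" using x conn_sym[of v0 x] by (auto simp: Bad_def)
      have "v0 \<in> Bad"
      proof (rule conn_closed[OF connected[of x v0]])
        show "x \<in> V" "v0 \<in> V" "x \<in> Bad" using x v0 \<open>x \<in> Bad\<close> by auto
        show "a \<in> Bad \<longleftrightarrow> b \<in> Bad" if "(a, b) \<in> D" for a b
          using step[OF that] step[OF D_rev[OF that]] by blast
      qed
      then show False by (simp add: Bad_def)
    qed
  qed
  then show False using lower by simp
qed

text \<open>The labels at \<open>r j\<close> are all \<open>j\<close>, so colour \<open>i\<close>
  can enter only the outer vertex \<open>r i\<close>. Since continuations are unique, a cycle would
  trap everything reachable from it, including this sink.\<close>

lemma monochrome_tree: "in_tree (monochrome i) (r i)"
proof -
  have reach: "(v, r i) \<in> (monochrome i)\<^sup>*" if v: "v \<in> inner_verts" for v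
  proof -
    obtain j where j: "(v, r j) \<in> (monochrome i)\<^sup>*"
      using monochrome_reaches_outer[of v i] v by (auto simp: inner_verts_def)
    moreover have "v \<noteq> r j" using v by (auto simp: inner_verts_def)
    ultimately obtain x where "(x, r j) \<in> monochrome i" by (metis rtranclE)
    then have "j = i" using labellingD(5)[OF L, of x j] QD by (auto simp: monochrome_def)
    then show ?thesis using j by simp
  qed
  have "(v, r i) \<in> (monochrome i)\<^sup>*" if v: "v \<in> Field (monochrome i)" for v
  proof (cases "v \<in> inner_verts")
    case False
    then obtain x where x: "(x, v) \<in> monochrome i" using v by (auto simp: Field_def monochrome_iff)
    then have "v \<in> V" using monochrome_D DVD by blast
    then obtain j where "v = r j" using False by (auto simp: inner_verts_def)
    then have "v = r i" using x labellingD(5)[OF L, of x j] QD by (auto simp: monochrome_def)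
    then show ?thesis by simp
  qed (rule reach)
  moreover have "acyclic (monochrome i)"
  proof (rule acyclicI, intro allI notI)
    fix x assume cycle: "(x, x) \<in> (monochrome i)\<^sup>+"
    then obtain y where "(x, y) \<in> monochrome i" by (meson tranclD)
    then have "(x, r i) \<in> (monochrome i)\<^sup>*" using reach by (simp add: monochrome_iff)
    then have "(r i, x) \<in> (monochrome i)\<^sup>+"
    proof (induction rule: rtrancl_induct)
      case (step y z)
      obtain z' where "(y, z') \<in> monochrome i" "(z', x) \<in> (monochrome i)\<^sup>*" using step.IH by (meson tranclD)
      moreover then have "z' = z" using step.hyps by (simp add: monochrome_iff)
      ultimately show ?case using cycle by (metis rtranclD)
    qed (rule cycle)
    then obtain y where "(r i, y) \<in> monochrome i" by (meson tranclD)
    then show False by (simp add: monochrome_iff inner_verts_def)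
  qed
  ultimately show ?thesis using monochrome_single by (simp add: in_tree_def)
qed

end

end

subsection \<open>Realizers from labellings\<close>

lemma connected_iff_conn:
  assumes "parcs G \<subseteq> pverts G \<times> pverts G"
  shows "connected (with_proj G) \<longleftrightarrow>
    pverts G \<noteq> {} \<and> (\<forall>x\<in>pverts G. \<forall>y\<in>pverts G. (x, y) \<in> conn (parcs G))"
proof -
  have arcs: "parcs (mk_symmetric (with_proj G)) = parcs G \<union> (parcs G)\<inverse>"
    by (force simp: mk_symmetric_def)
  have "(x, y) \<in> rtrancl_on (pverts G) (parcs G \<union> (parcs G)\<inverse>) \<longleftrightarrow> (x, y) \<in> conn (parcs G)"
    if "x \<in> pverts G" for x y
  proof
    assume "(x, y) \<in> conn (parcs G)"
    then show "(x, y) \<in> rtrancl_on (pverts G) (parcs G \<union> (parcs G)\<inverse>)"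
      unfolding conn_def
    proof (induction rule: rtrancl_induct)
      case (step y z)
      then have "z \<in> pverts G" using assms by blast
      then show ?case by (rule rtrancl_on_into_rtrancl_on[OF step.IH step.hyps(2)])
    qed (use that in simp)
  qed (simp add: conn_def rtrancl_on_rtranclI)
  then show ?thesis
    unfolding connected_def strongly_connected_def reachable_def by (simp add: arcs)
qed

lemma plane_embedding_iff:
  "plane_embedding G \<rho> \<longleftrightarrow> plane_map (pverts G) (parcs G) \<rho>"
proof -
  have nb: "neighbours G v = {u. (v, u) \<in> parcs G}" for v by (simp add: neighbours_def)
  have fc: "faces G \<rho> = orbit (face_succ \<rho>) ` parcs G" by (auto simp: faces_def)
  show ?thesis
  proof
    assume p: "plane_embedding G \<rho>"
    then interpret pair_graph G by (simp add: plane_embedding_def)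
    have sub: "parcs G \<subseteq> pverts G \<times> pverts G"
      using arc_fst_in_verts arc_snd_in_verts by fastforce
    show "plane_map (pverts G) (parcs G) \<rho>"
    proof
      show "(x, x) \<notin> parcs G" for x using pair_no_loops by fastforce
      show "sym (parcs G)" using pair_sym_arcs by (simp add: symmetric_def)
    qed (use p sub pair_finite_verts in \<open>auto simp: plane_embedding_def nb fc connected_iff_conn[OF sub]\<close>)
  next
    assume "plane_map (pverts G) (parcs G) \<rho>"
    then interpret plane_map "pverts G" "parcs G" \<rho> .
    have "pair_graph G"
    proof
      show "fst e \<in> pverts G" "snd e \<in> pverts G" if "e \<in> parcs G" for e
        using that DV by (cases e; auto)+
      show "finite (pverts G)" "finite (parcs G)" by (rule finV, rule finD)
      show "fst e \<noteq> snd e" if "e \<in> parcs G" for e using that irr by (cases e) auto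
      show "symmetric G" using symmD by (simp add: symmetric_def)
    qed
    then show "plane_embedding G \<rho>"
      using connected nonempty cyc euler by (auto simp: plane_embedding_def nb fc connected_iff_conn[OF DV])
  qed
qed

lemma triangulation_triangulated:
  assumes "triangulation T"
  shows "triangulated (pverts (skeleton T)) (parcs (skeleton T)) (rot T) (outer T)"
proof -
  interpret plane_map "pverts (skeleton T)" "parcs (skeleton T)" "rot T"
    using assms by (simp add: triangulation_def plane_embedding_iff)
  show ?thesis
  proof
    show "card (orbit (face_succ (rot T)) d) = 3" if "d \<in> parcs (skeleton T)" for d
    proof -
      have "orbit (face_succ (rot T)) d \<in> faces (skeleton T) (rot T)"
        unfolding faces_def using that by blast
      then show ?thesis using assms by (simp add: triangulation_def)
    qed
    show "\<exists>d\<in>parcs (skeleton T). {(outer T i, outer T (i + 1)) |i. True} = orbit (face_succ (rot T)) d"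
      using assms by (auto simp: triangulation_def faces_def outer_arcs_def)
    show "face_succ (rot T) (outer T i, outer T (i + 1)) = (outer T (i + 1), outer T (i + 2))" for i
      using assms by (simp add: triangulation_def)
  qed
qed

context triangulated
begin

text \<open>The edge bound holds for a plane supergraph under whatever embedding it has, and
  triangular faces already attain it.\<close>

lemma maximal_planarI:
  assumes "pverts G = V" "parcs G = D"
  shows "maximal_planar G"
  unfolding maximal_planar_def
proof (intro conjI allI impI)
  show "\<exists>\<rho>. plane_embedding G \<rho>"
    using plane_map_axioms assms plane_embedding_iff by blast
  fix H assume H: "pverts H = pverts G \<and> parcs G \<subseteq> parcs H \<and> (\<exists>\<rho>. plane_embedding H \<rho>)"
  then obtain \<sigma> where "plane_map (pverts H) (parcs H) \<sigma>" by (auto simp: plane_embedding_iff)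
  then interpret H: plane_map "pverts H" "parcs H" \<sigma> .
  have "3 \<le> card (pverts H)" using card_V H assms by simp
  then have "card (parcs H \<inter> pverts H \<times> pverts H) + 12 \<le> 6 * card (pverts H)"
    by (intro H.induced_card_le) auto
  moreover have "parcs H \<inter> pverts H \<times> pverts H = parcs H" using H.DV by auto
  ultimately have "card (parcs H) \<le> card (parcs G)" using card_D H assms by simp
  then show "parcs H = parcs G" using H H.finD card_seteq by metis
qed

lemma triangulationI:
  assumes "pverts (skeleton T) = V" "parcs (skeleton T) = D" "rot T = \<rho>" "outer T = r"
  shows "triangulation T"
proof -
  have "plane_embedding (skeleton T) (rot T)"
    using plane_map_axioms assms by (simp add: plane_embedding_iff)
  moreover have "outer_arcs T \<in> faces (skeleton T) (rot T)"
    using outer_cycle_face assms unfolding outer_arcs_def faces_def outer_cycle_def by auto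
  ultimately show ?thesis
    using maximal_planarI face3 outer_succ assms by (auto simp: triangulation_def faces_def)
qed

end

lemma labelling_realizer:
  assumes T: "triangulation T"
    and L: "triangulated.labelling (pverts (skeleton T)) (parcs (skeleton T)) (rot T) (outer T) Q M"
  shows "realizer T (\<lambda>i. {(x, y) \<in> Q. M (x, y) = i})"
proof -
  interpret triangulated "pverts (skeleton T)" "parcs (skeleton T)" "rot T" "outer T"
    by (rule triangulation_triangulated[OF T])
  have monochrome: "{(x, y) \<in> Q. M (x, y) = i} = monochrome Q M i" for i
    by (simp add: monochrome_def[OF L])
  have inner_arcs: "interior_arcs T = inner_arcs" by (auto simp: interior_arcs_def inner_arcs_def outer_arcs_def outer_cycle_def)
  have inner_verts: "interior_verts T = inner_verts" by (simp add: interior_verts_def inner_verts_def)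
  have orQ: "orientation Q" by (rule labellingD(2)[OF L])
  have uniq: "\<exists>!(i, x, y). {x, y} = {u, v} \<and> (x, y) \<in> monochrome Q M i" if uv: "(u, v) \<in> inner_arcs" for u v
  proof -
    consider "(u, v) \<in> Q" "(v, u) \<notin> Q" | "(v, u) \<in> Q" "(u, v) \<notin> Q"
      using orientationD(2,3)[OF orQ] uv by blast
    then show ?thesis
    proof cases
      case 1
      show ?thesis
        by (rule ex1I[of _ "(M (u, v), u, v)"])
           (use 1 in \<open>auto simp: monochrome_def[OF L] doubleton_eq_iff\<close>)
    next
      case 2
      show ?thesis
        by (rule ex1I[of _ "(M (v, u), v, u)"])
           (use 2 in \<open>auto simp: monochrome_def[OF L] doubleton_eq_iff\<close>)
    qed
  qed
  have local_cond: "\<exists>out. (\<forall>i v. (u, v) \<in> monochrome Q M i \<longleftrightarrow> v = out i) \<and>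
        out 1 \<in> sector T u (out 0) (out 2) \<and>
        (\<forall>i x. (x, u) \<in> monochrome Q M i \<longrightarrow> x \<in> sector T u (out (i + 1)) (out (i - 1)))"
    if u: "u \<in> inner_verts" for u
  proof (intro exI conjI allI impI)
    interpret c: cyclic_labels "rot T u" "{x. (u, x) \<in> parcs (skeleton T)}" "Q `` {u}" "\<lambda>x. M (x, u)"
      by (rule labels_at[OF L u])
    note o = out_def[OF L, symmetric]
    show "(u, v) \<in> monochrome Q M i \<longleftrightarrow> v = out Q M u i" for i v
      using monochrome_iff[OF L] u by simp
    have ne: "out Q M u i \<noteq> out Q M u j" if "i \<noteq> j" for i j
      using out_label[OF L u] that by metis
    have outQ: "out Q M u i \<in> Q `` {u}" for i using out_Q[OF L u] by simp
    obtain k where k: "k > 0" "(rot T u ^^ k) (out Q M u 0) = out Q M u 1"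
      "\<And>l. 0 < l \<Longrightarrow> l < k \<Longrightarrow> (rot T u ^^ l) (out Q M u 0) \<notin> Q `` {u}"
      using c.next_out[of 0] unfolding o by auto
    have "(rot T u ^^ l) (out Q M u 0) \<noteq> out Q M u 2" if "0 < l" "l \<le> k" for l
      using k(3)[of l] k(2) ne[of 1 2] outQ[of 2] that by (cases "l = k") auto
    then show "out Q M u 1 \<in> sector T u (out Q M u 0) (out Q M u 2)"
      using k(1,2) unfolding sector_def by (auto intro!: exI[of _ k])
    fix i x assume x: "(x, u) \<in> monochrome Q M i"
    then have "(x, u) \<in> Q" "M (x, u) = i" by (auto simp: monochrome_def[OF L])
    moreover then have "x \<in> {x. (u, x) \<in> parcs (skeleton T)} - Q `` {u}"
      using QD[OF L] Q_asym[OF L] D_rev by auto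
    ultimately obtain k where k: "k > 0" "(rot T u ^^ k) (out Q M u (i + 1)) = x"
      "\<And>l. 0 < l \<Longrightarrow> l \<le> k \<Longrightarrow> (rot T u ^^ l) (out Q M u (i + 1)) \<notin> Q `` {u}"
      using c.between_out[of x] unfolding o by auto
    have "(rot T u ^^ l) (out Q M u (i + 1)) \<noteq> out Q M u (i - 1)" if "0 < l" "l \<le> k" for l
      using k(3)[OF that] outQ[of "i - 1"] by auto
    then show "x \<in> sector T u (out Q M u (i + 1)) (out Q M u (i - 1))"
      using k(1,2) unfolding sector_def by (auto intro!: exI[of _ k])
  qed
  show ?thesis
    unfolding realizer_def monochrome inner_arcs inner_verts
  proof (intro conjI allI ballI)
    show "triangulation T" by (rule T)
    show "monochrome Q M i \<subseteq> inner_arcs" for i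
      using orientationD(1)[OF orQ] by (auto simp: monochrome_def[OF L])
    show "case d of (u, v) \<Rightarrow> \<exists>!(i, x, y). {x, y} = {u, v} \<and> (x, y) \<in> monochrome Q M i" if "d \<in> inner_arcs" for d
      using uniq[of "fst d" "snd d"] that by (cases d) (simp only: prod.case fst_conv snd_conv)
    show "\<exists>out. (\<forall>i v. (u, v) \<in> monochrome Q M i \<longleftrightarrow> v = out i) \<and>
        out 1 \<in> sector T u (out 0) (out 2) \<and>
        (\<forall>i x. (x, u) \<in> monochrome Q M i \<longrightarrow> x \<in> sector T u (out (i + 1)) (out (i - 1)))"
      if "u \<in> inner_verts" for u
      using that by (rule local_cond)
    show "(outer T i, v) \<notin> monochrome Q M j" for i j v
      using outer_no_out[OF labellingD(1)[OF L]] by (auto simp: monochrome_def[OF L])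
    show "in_tree (monochrome Q M i) (outer T i)" for i
      by (rule monochrome_tree[OF L])
  qed
qed

subsection \<open>Flips of triangulations\<close>

text \<open>A flip acts on the rotations at \<open>w\<close> and \<open>z\<close> in this way; its
  counterpart \<open>cyclic_on_remove\<close> serves \<open>u\<close> and \<open>v\<close>.\<close>

lemma cyclic_on_insert:
  assumes cyc: "cyclic_on f S" and p: "p \<in> S" and a: "a \<notin> S"
  shows "cyclic_on (f(p := a, a := f p)) (insert a S)"
proof -
  define g where "g = f(p := a, a := f p)"
  have ap: "a \<noteq> p" using p a by auto
  have g: "g p = a" "g a = f p" "\<And>x. x \<noteq> p \<Longrightarrow> x \<noteq> a \<Longrightarrow> g x = f x"
    using ap by (simp_all add: g_def)
  have fp: "f p \<in> S" using cyclic_on_inI[OF cyc p] .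
  have a_in: "a \<in> orbit g p" using orbit.base[of g p] g by simp
  have fp_in: "f p \<in> orbit g p" using orbit.step[OF a_in] g by simp
  have "x \<in> orbit g p" if "x \<in> orbit f p" for x
    using that
  proof induction
    case (step y)
    have "y \<in> S" using step.hyps p cyc by (metis cyclic_on_alldef)
    then have "y \<noteq> a" using a by auto
    then show ?case
      using fp_in orbit.step[OF step.IH] g(3)[of y] by (cases "y = p") simp_all
  qed (rule fp_in)
  moreover have "S = orbit f p" using cyc p by (simp add: cyclic_on_alldef)
  ultimately have "insert a S \<subseteq> orbit g p" using a_in by auto
  moreover have "x \<in> insert a S" if "x \<in> orbit g p" for x
    using that
  proof induction
    case (step y)
    then show ?case
      using fp g cyclic_on_inI[OF cyc, of y] by (cases "y = p"; cases "y = a") auto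
  qed (simp add: g)
  ultimately have "insert a S = orbit g p" by blast
  then show ?thesis using p unfolding cyclic_on_def g_def by blast
qed

lemma cyclic_on_remove:
  assumes cyc: "cyclic_on f S" and p: "p \<in> S" "p \<noteq> f p"
  shows "cyclic_on (f(p := f (f p))) (S - {f p})"
proof -
  define g where "g = f(p := f (f p))"
  have g: "g p = f (f p)" "\<And>x. x \<noteq> p \<Longrightarrow> g x = f x"
    by (simp_all add: g_def)
  have fS: "f x \<in> S" if "x \<in> S" for x using cyclic_on_inI[OF cyc that] .
  have inj: "x = p" if "x \<in> S" "f x = f p" for x
    using cyclic_on_inj[OF cyc] that p by (auto dest: inj_onD)
  have ffp: "f (f p) \<noteq> f p" using inj[OF fS[OF p(1)]] p(2) by auto
  have "x = f p \<or> x \<in> orbit g p" if "x \<in> orbit f p" for x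
    using that
  proof induction
    case (step y)
    then consider "y = f p" | "y = p" | "y \<noteq> p" "y \<in> orbit g p" by blast
    then show ?case
    proof cases
      case 1
      then show ?thesis using orbit.base[of g p] g(1) by simp
    next
      case 3
      then show ?thesis using orbit.step[OF 3(2)] g(2) by simp
    qed simp
  qed simp
  moreover have "S = orbit f p" using cyc p by (simp add: cyclic_on_alldef)
  ultimately have "S - {f p} \<subseteq> orbit g p" by auto
  moreover have "x \<in> S - {f p}" if "x \<in> orbit g p" for x
    using that
  proof induction
    case base
    then show ?case using ffp fS p(1) g(1) by simp
  next
    case (step y)
    then show ?case
      using ffp fS[of y] fS[of "f p"] fS[of p] p(1) g inj[of y] by (cases "y = p") auto
  qed
  ultimately have "S - {f p} = orbit g p" by blast
  then show ?thesis using p unfolding cyclic_on_def g_def by blast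
qed

context triangulated
begin

lemma face_rot:
  assumes "(x, y) \<in> D"
  shows "\<rho> (\<rho> y x) y = x" "\<rho> x (\<rho> y x) = y" "(y, \<rho> y x) \<in> D" "(x, \<rho> y x) \<in> D"
    "x \<noteq> y" "\<rho> y x \<noteq> x" "\<rho> y x \<noteq> y"
proof -
  show r: "\<rho> (\<rho> y x) y = x" "\<rho> x (\<rho> y x) = y"
    using face_triangleD[OF face3[OF assms] assms] by auto
  show 1: "(y, \<rho> y x) \<in> D" using phi_D[OF assms] by (simp add: phi_simp)
  show 2: "(x, \<rho> y x) \<in> D" using phi_D[OF 1] r D_rev by (simp add: phi_simp)
  show "x \<noteq> y" "\<rho> y x \<noteq> x" "\<rho> y x \<noteq> y" using assms 1 2 irr by auto
qed

end

locale flippable_arc = triangulated V D \<rho> r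
  for V :: "'a set" and D \<rho> and r :: "3 \<Rightarrow> 'a" +
  fixes u v w z
  assumes uv: "(u, v) \<in> inner_arcs" and wz: "(w, z) \<notin> D"
    and w_def: "w = \<rho> v u" and z_def: "z = \<rho> u v"
begin

definition "D' = (D - {(u, v), (v, u)}) \<union> {(w, z), (z, w)}"
definition "\<rho>' = \<rho>(u := (\<rho> u)(w := z), v := (\<rho> v)(z := w),
  w := (\<rho> w)(v := z, z := u), z := (\<rho> z)(u := w, w := v))"

lemma uvD: "(u, v) \<in> D" "(v, u) \<in> D"
  using uv inner_arcs_D D_rev by auto

lemma rot_w: "\<rho> v u = w" "\<rho> w v = u" "\<rho> u w = v"
  and rot_z: "\<rho> u v = z" "\<rho> z u = v" "\<rho> v z = u"
  using face_rot[OF uvD(1)] face_rot[OF uvD(2)] by (auto simp: w_def z_def)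

lemma arcs4: "(u, w) \<in> D" "(w, u) \<in> D" "(v, w) \<in> D" "(w, v) \<in> D"
    "(u, z) \<in> D" "(z, u) \<in> D" "(v, z) \<in> D" "(z, v) \<in> D"
  using face_rot(3,4)[OF uvD(1)] face_rot(3,4)[OF uvD(2)] D_rev by (auto simp: w_def z_def)

lemma wzD: "(w, z) \<notin> D" "(z, w) \<notin> D"
  using wz D_rev by auto

text \<open>For \<open>w = z\<close> the condition that \<open>w\<close> and \<open>z\<close> are
  not adjacent would be vacuous. In that case the rotations at \<open>u\<close>, \<open>v\<close>,
  \<open>w\<close> close up, the graph is a single triangle, and \<open>uv\<close> would be an outer
  edge.\<close>

lemma w_neq_z: "w \<noteq> z"
proof
  assume wz: "w = z"
  have nbrs: "y \<in> {u, v, w}" if xy: "(x, y) \<in> D" and x: "x \<in> {u, v, w}" for x y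
  proof -
    have "(\<rho> x ^^ k) a \<in> {u, v, w}" if "a \<in> {u, v, w}" "a \<noteq> x" "x \<in> {u, v, w}" for k a
    proof -
      have ne: "u \<noteq> v" "u \<noteq> w" "v \<noteq> w" using uvD arcs4 irr by auto
      have "(\<rho> x ^^ k) a \<in> {u, v, w} - {x}"
        by (induction k) (use that rot_w rot_z wz ne in auto)
      then show ?thesis by blast
    qed
    moreover define a where "a = (if x = u then v else u)"
    have a: "a \<in> {u, v, w}" "a \<noteq> x" "(x, a) \<in> D"
      using x uvD arcs4 irr by (auto simp: a_def)
    moreover obtain k where "y = (\<rho> x ^^ k) a" using rho_reach[OF a(3) xy] by blast
    ultimately show ?thesis using x by simp
  qed
  have "x \<in> {u, v, w}" if x: "x \<in> V" for x
  proof (rule conn_closed[OF connected[of u x]])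
    show "u \<in> V" using uvD DVD by blast
    show "a \<in> {u, v, w} \<longleftrightarrow> b \<in> {u, v, w}" if "(a, b) \<in> D" for a b
      using nbrs[OF that] nbrs[OF D_rev[OF that]] by blast
  qed (use x in auto)
  then have "range r \<subseteq> {u, v, w}" using r_V by auto
  moreover have "card {u, v, w} \<le> 3" by (simp add: card_insert_if)
  ultimately have "range r = {u, v, w}"
    using card_range_r by (intro card_seteq) auto
  then obtain i j where ij: "u = r i" "v = r j" by (metis insertCI rangeE)
  have "i \<noteq> j" using ij uvD irr by auto
  then have "j = i + 1 \<or> i = j + 1"
    using three_cases[of i] three_cases[of j] by auto
  then have "(u, v) \<in> outer_cycle \<or> (v, u) \<in> outer_cycle" using ij by (auto simp: outer_cycle_def)
  then show False using uv by (auto simp: inner_arcs_def)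
qed

lemma distinct4: "u \<noteq> v" "v \<noteq> u" "u \<noteq> w" "w \<noteq> u" "v \<noteq> w" "w \<noteq> v" "u \<noteq> z" "z \<noteq> u" "v \<noteq> z" "z \<noteq> v"
    "w \<noteq> z" "z \<noteq> w"
  using uvD arcs4 irr w_neq_z by auto

text \<open>The six arcs \<open>(w, u)\<close>, \<open>(u, z)\<close>, \<open>(z, w)\<close> and
  \<open>(z, v)\<close>, \<open>(v, w)\<close>, \<open>(w, z)\<close> bound the two new faces; only
  there does the face successor change.\<close>

lemma rho'_new:
  "\<rho>' u w = z" "\<rho>' v z = w" "\<rho>' w v = z" "\<rho>' w z = u" "\<rho>' z u = w" "\<rho>' z w = v"
  using distinct4 by (simp_all add: \<rho>'_def)

lemma rho'_old:
  "(x, y) \<notin> {(w, u), (z, v), (v, w), (z, w), (u, z), (w, z)} \<Longrightarrow> \<rho>' y x = \<rho> y x"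
  using distinct4 by (auto simp: \<rho>'_def)

lemma D'_rev: "(x, y) \<in> D' \<Longrightarrow> (y, x) \<in> D'"
  using D_rev by (auto simp: D'_def)

lemma outer_cycle_uv: "(u, v) \<notin> outer_cycle" "(v, u) \<notin> outer_cycle"
  using uv by (auto simp: inner_arcs_def)

lemma phi_outer_cycle: "d \<in> outer_cycle \<Longrightarrow> \<phi> d \<in> outer_cycle"
  using outer_cycle_face by (auto intro: orbit.step)

lemma outer_cycle_old:
  assumes "d \<in> outer_cycle" shows "d \<notin> {(w, u), (z, v), (v, w), (z, w), (u, z), (w, z)}"
proof -
  have 1: "(w, u) \<notin> outer_cycle" "(z, v) \<notin> outer_cycle"
    using phi_outer_cycle[of "(w, u)"] phi_outer_cycle[of "(z, v)"] outer_cycle_uv by (auto simp: phi_simp rot_w rot_z)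
  then have 2: "(v, w) \<notin> outer_cycle" "(u, z) \<notin> outer_cycle"
    using phi_outer_cycle[of "(v, w)"] phi_outer_cycle[of "(u, z)"] by (auto simp: phi_simp rot_w rot_z)
  have 3: "(w, z) \<notin> outer_cycle" "(z, w) \<notin> outer_cycle" using outer_cycle_D wzD by auto
  show ?thesis using 1 2 3 assms by blast
qed

lemma card_D': "card D' = card D"
proof -
  have "card {(u, v), (v, u)} \<le> card D" using uvD finD by (intro card_mono) auto
  then have "card (D - {(u, v), (v, u)}) + 2 = card D"
    using uvD finD distinct4 by (simp add: card_Diff_subset)
  moreover have "D' = insert (w, z) (insert (z, w) (D - {(u, v), (v, u)}))"
    by (auto simp: D'_def)
  ultimately show ?thesis using wzD finD distinct4 by simp
qed

lemma rotation_system_flip: "rotation_system V D' \<rho>'"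
proof
  show "finite V" "V \<noteq> {}" by (rule finV, rule nonempty)
  show "D' \<subseteq> V \<times> V" using DV arcs4 by (auto simp: D'_def)
  show "sym D'" using D'_rev by (auto simp: sym_def)
  show "(x, x) \<notin> D'" for x using irr distinct4 by (auto simp: D'_def)
  have "conn D \<subseteq> conn D'"
  proof (rule conn_least, clarify)
    fix x y assume xy: "(x, y) \<in> D"
    have "(u, w) \<in> D'" "(w, v) \<in> D'" using arcs4 distinct4 by (auto simp: D'_def)
    then have c: "(u, v) \<in> conn D'" by (meson conn_base conn_trans)
    show "(x, y) \<in> conn D'"
      using xy c conn_sym[OF c] conn_base[of x y D'] by (cases "(x, y) \<in> {(u, v), (v, u)}") (auto simp: D'_def)
  qed
  then show "(x, y) \<in> conn D'" if "x \<in> V" "y \<in> V" for x y using connected[OF that] by auto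
  fix x assume x: "x \<in> V"
  let ?N = "{y. (x, y) \<in> D}"
  note cx = cyc[OF x]
  consider "x = u" | "x = v" | "x = w" | "x = z" | "x \<notin> {u, v, w, z}" by blast
  then show "cyclic_on (\<rho>' x) {y. (x, y) \<in> D'}"
  proof cases
    case 1
    have "\<rho>' x = (\<rho> u)(w := \<rho> u (\<rho> u w))" using distinct4 1 by (simp add: \<rho>'_def rot_w rot_z)
    moreover have "{y. (x, y) \<in> D'} = ?N - {\<rho> u w}" using distinct4 1 by (auto simp: D'_def rot_w)
    moreover have "cyclic_on ((\<rho> u)(w := \<rho> u (\<rho> u w))) (?N - {\<rho> u w})"
      by (rule cyclic_on_remove) (use cx 1 arcs4 distinct4 rot_w in auto)
    ultimately show ?thesis by simp
  next
    case 2
    have "\<rho>' x = (\<rho> v)(z := \<rho> v (\<rho> v z))" using distinct4 2 by (simp add: \<rho>'_def rot_w rot_z)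
    moreover have "{y. (x, y) \<in> D'} = ?N - {\<rho> v z}" using distinct4 2 by (auto simp: D'_def rot_z)
    moreover have "cyclic_on ((\<rho> v)(z := \<rho> v (\<rho> v z))) (?N - {\<rho> v z})"
      by (rule cyclic_on_remove) (use cx 2 arcs4 distinct4 rot_z in auto)
    ultimately show ?thesis by simp
  next
    case 3
    have "\<rho>' x = (\<rho> w)(v := z, z := \<rho> w v)" using distinct4 3 by (simp add: \<rho>'_def rot_w rot_z)
    moreover have "{y. (x, y) \<in> D'} = insert z ?N" using distinct4 3 by (auto simp: D'_def)
    moreover have "cyclic_on ((\<rho> w)(v := z, z := \<rho> w v)) (insert z ?N)"
      by (rule cyclic_on_insert) (use cx 3 arcs4 wzD in auto)
    ultimately show ?thesis by simp
  next
    case 4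
    have "\<rho>' x = (\<rho> z)(u := w, w := \<rho> z u)" using distinct4 4 by (simp add: \<rho>'_def rot_w rot_z)
    moreover have "{y. (x, y) \<in> D'} = insert w ?N" using distinct4 4 by (auto simp: D'_def)
    moreover have "cyclic_on ((\<rho> z)(u := w, w := \<rho> z u)) (insert w ?N)"
      by (rule cyclic_on_insert) (use cx 4 arcs4 wzD in auto)
    ultimately show ?thesis by simp
  next
    case 5
    then have "\<rho>' x = \<rho> x" "{y. (x, y) \<in> D'} = ?N" by (auto simp: \<rho>'_def D'_def)
    then show ?thesis using cx by simp
  qed
qed

lemma rot_flip:
  assumes xy: "(x, y) \<in> D'"
  shows "\<rho>' (\<rho>' y x) y = x"
proof (cases "(x, y) \<in> {(w, u), (z, v), (v, w), (z, w), (u, z), (w, z)}")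
  case True
  then show ?thesis by (auto simp: rho'_new)
next
  case False
  then have D: "(x, y) \<in> D" "(x, y) \<noteq> (u, v)" "(x, y) \<noteq> (v, u)" using xy by (auto simp: D'_def)
  have q: "\<rho> (\<rho> y x) y = x" "(y, \<rho> y x) \<in> D" using face_rot[OF D(1)] by auto
  have "(y, \<rho> y x) \<notin> {(w, u), (z, v), (v, w), (z, w), (u, z), (w, z)}"
  proof
    assume "(y, \<rho> y x) \<in> {(w, u), (z, v), (v, w), (z, w), (u, z), (w, z)}"
    then show False
      using q D(2,3) False wzD rot_w rot_z by (elim insertE) auto
  qed
  then show ?thesis using rho'_old[OF False] rho'_old[of y "\<rho> y x"] q by simp
qed

text \<open>Arcs are equally many before and after and all faces are triangles, so the number of
  faces agrees and Euler's formula carries over.\<close>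

lemma triangulated_flip: "triangulated V D' \<rho>' r"
proof -
  interpret F: rotation_system V D' \<rho>' by (rule rotation_system_flip)
  have face3': "card (orbit (face_succ \<rho>') d) = 3" if "d \<in> D'" for d
    using F.face_triangleI[OF rot_flip that] .
  have "card D' = (\<Sum>F\<in>orbit (face_succ \<rho>') ` D'. card F)"
    using F.sum_faces[OF subset_refl F.phi_D, of "\<lambda>_. 1::nat"] by simp
  also have "\<dots> = (\<Sum>F\<in>orbit (face_succ \<rho>') ` D'. 3)" using face3' by (intro sum.cong) auto
  finally have f': "card D' = 3 * card (orbit (face_succ \<rho>') ` D')" by simp
  have "card D = (\<Sum>F\<in>orbit \<phi> ` D. card F)"
    using sum_faces[OF subset_refl phi_D, of "\<lambda>_. 1::nat"] by simp
  also have "\<dots> = (\<Sum>F\<in>orbit \<phi> ` D. 3)" using face3 by (intro sum.cong) auto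
  finally have f: "card D = 3 * card (orbit \<phi> ` D)" by simp
  interpret F: plane_map V D' \<rho>'
    by unfold_locales (use euler f f' card_D' in simp)
  have old: "face_succ \<rho>' d = \<phi> d" if "d \<in> outer_cycle" for d
    using rho'_old[of "fst d" "snd d"] outer_cycle_old[OF that] by (cases d) (simp add: face_succ_def)
  show ?thesis
  proof
    show "card (orbit (face_succ \<rho>') d) = 3" if "d \<in> D'" for d using that by (rule face3')
    obtain d where d: "d \<in> D" "outer_cycle = orbit \<phi> d" using outer_cycle_face by blast
    have "d \<in> outer_cycle" using d self_in_face by simp
    moreover then have "d \<in> D'" using d(1) outer_cycle_uv by (auto simp: D'_def)
    moreover have "orbit (face_succ \<rho>') d = orbit \<phi> d"
      by (rule orbit_cong0[of _ outer_cycle]) (use \<open>d \<in> outer_cycle\<close> old phi_outer_cycle in auto)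
    ultimately show "\<exists>d\<in>D'. {(r i, r (i + 1)) |i. True} = orbit (face_succ \<rho>') d"
      using d(2) unfolding outer_cycle_def by metis
    show "face_succ \<rho>' (r i, r (i + 1)) = (r (i + 1), r (i + 2))" for i
      using old[of "(r i, r (i + 1))"] outer_succ by (auto simp: outer_cycle_def)
  qed
qed

lemma inner_arcs_flip: "triangulated.inner_arcs D' r = (inner_arcs - {(u, v), (v, u)}) \<union> {(w, z), (z, w)}"
proof -
  interpret F: triangulated V D' \<rho>' r by (rule triangulated_flip)
  have "(w, z) \<notin> outer_cycle" "(z, w) \<notin> outer_cycle" using outer_cycle_D wzD by auto
  then show ?thesis unfolding F.inner_arcs_def inner_arcs_def by (auto simp: D'_def)
qed

end

subsection \<open>Flips of labellings\<close>

lemma three_eq_add_one: "(a::3) = b + 1 \<Longrightarrow> b = a + 2"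
  by simp

context flippable_arc
begin

text \<open>\<open>u\<close> exchanges its out-neighbour \<open>v\<close> for \<open>a\<close>, and
  \<open>a\<close> exchanges \<open>u\<close> for \<open>b\<close>, so no outdegree changes. The
  disjunction serves both types of colored flip.\<close>

lemma three_orientation_flip:
  assumes Q: "three_orientation Q" and ab: "(a, b) = (w, z) \<or> (a, b) = (z, w)"
    and uvQ: "(u, v) \<in> Q" and au: "(a, u) \<in> Q"
  shows "triangulated.three_orientation V D' r (Q - {(u, v), (a, u)} \<union> {(u, a), (a, b)})"
proof -
  interpret F: triangulated V D' \<rho>' r by (rule triangulated_flip)
  let ?Q = "Q - {(u, v), (a, u)} \<union> {(u, a), (a, b)}"
  have orQ: "orientation Q" using Q by (simp add: three_orientation_def)
  note QIA = orientationD(1)[OF orQ]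
  have ne: "u \<noteq> v" "a \<noteq> u" "a \<noteq> v" "b \<noteq> u" "b \<noteq> v" "a \<noteq> b" using ab distinct4 by auto
  have nQ: "(v, u) \<notin> Q" "(u, a) \<notin> Q" "(a, b) \<notin> Q" "(b, a) \<notin> Q"
    using orientationD(2)[OF orQ uvQ] orientationD(2)[OF orQ au] QIA inner_arcs_D wzD ab by auto
  have inner_arcs': "F.inner_arcs = inner_arcs - {(u, v), (v, u)} \<union> {(a, b), (b, a)}"
    using inner_arcs_flip ab by auto
  have auIA: "(a, u) \<in> inner_arcs" "(u, a) \<in> inner_arcs" using au QIA inner_arcs_rev by auto
  have orF: "F.orientation ?Q"
    unfolding F.orientation_def
  proof (intro conjI ballI)
    show "?Q \<subseteq> F.inner_arcs" using QIA auIA nQ ne unfolding inner_arcs' by auto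
    fix d assume d: "d \<in> F.inner_arcs"
    obtain x y where xy: "d = (x, y)" by (cases d)
    consider "(x, y) \<in> {(a, b), (b, a)}" | "(x, y) \<in> {(u, a), (a, u)}"
      | "(x, y) \<in> inner_arcs - {(u, v), (v, u), (u, a), (a, u), (a, b), (b, a)}"
      using d unfolding xy inner_arcs' by blast
    then have "((x, y) \<in> ?Q) \<noteq> ((y, x) \<in> ?Q)"
    proof cases
      case 1
      then show ?thesis using ne nQ by auto
    next
      case 2
      then show ?thesis using ne nQ by auto
    next
      case 3
      then have "(x, y) \<in> ?Q \<longleftrightarrow> (x, y) \<in> Q" "(y, x) \<in> ?Q \<longleftrightarrow> (y, x) \<in> Q" by auto
      then show ?thesis
        using orientationD(2)[OF orQ, of x y] orientationD(3)[OF orQ, of x y] 3 by blast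
    qed
    then show "case d of (x, y) \<Rightarrow> ((x, y) \<in> ?Q) \<noteq> ((y, x) \<in> ?Q)" by (simp add: xy)
  qed
  have "outdeg ?Q x = outdeg Q x" for x
  proof -
    have swap: "card (insert d (A - {c})) = card A" if "finite A" "c \<in> A" "d \<notin> A" for A :: "'a set" and c d
      using that by (metis Diff_iff card.remove card_insert_disjoint finite_Diff)
    consider "x = u" | "x = a" | "x \<noteq> u" "x \<noteq> a" by blast
    then show ?thesis
    proof cases
      case 1
      then have "?Q `` {x} = insert a (Q `` {x} - {v})" using ne nQ by auto
      then show ?thesis using 1 uvQ nQ fin_out[OF orQ] swap by simp
    next
      case 2
      then have "?Q `` {x} = insert b (Q `` {x} - {u})" using ne nQ by auto
      then show ?thesis using 2 au nQ fin_out[OF orQ] swap by simp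
    next
      case 3
      then have "?Q `` {x} = Q `` {x}" by auto
      then show ?thesis by simp
    qed
  qed
  then show ?thesis
    using orF Q by (simp add: F.three_orientation_def three_orientation_def)
qed

context
  fixes Q M i
  assumes L: "labelling Q M" and uvQ: "(u, v) \<in> Q" and i: "i = M (u, v)"
begin

text \<open>With \<open>M (u, v) = i\<close>, the first five values are the angles of the two
  triangles at \<open>uv\<close>, each showing all three labels. Where an edge may have either
  direction, both cases lead to the same value. Thus \<open>w \<rightarrow> u\<close> has colour i +
  1 and \<open>z \<rightarrow> u\<close> has colour i + 2.\<close>

lemma quad_labels:
  "M (v, u) = i + 2" "M (w, u) = i + 1" "M (z, v) = i" "M (v, w) = i + 2" "M (u, z) = i + 1"
  "(w, u) \<in> Q \<Longrightarrow> M (u, w) = i" "(z, u) \<in> Q \<Longrightarrow> M (z, u) = i + 2"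
proof -
  note rot = labellingD(3)[OF L] and edge = labellingD(4)[OF L] and or = labellingD(2)[OF L]
  note asym = orientationD(2)[OF or]
  have uI: "u \<in> inner_verts" using tail_interior[OF labellingD(1)[OF L] uvQ] .
  have oriented: "(u, x) \<in> Q \<or> (x, u) \<in> Q" if "(u, x) \<in> D" for x
    using orientationD(3)[OF or inner_arcs_I[OF that]] uI by (auto simp: inner_verts_def)
  show vu: "M (v, u) = i + 2" using edge[OF uvQ] i by (simp add: three_eq_add_one)
  have "M (v, u) = M (w, u) + 1" using rot[OF arcs4(2)] uvQ by (simp add: rot_w)
  then have "M (w, u) = M (v, u) + 2" by (rule three_eq_add_one)
  then show wu: "M (w, u) = i + 1" using vu by simp
  show "M (z, v) = i" using rot[OF arcs4(8)] asym[OF uvQ] i by (simp add: rot_z)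
  show wuQ: "M (u, w) = i" if "(w, u) \<in> Q" using edge[OF that] wu by simp
  have zu: "M (z, u) = i + 2 + of_bool ((u, z) \<in> Q)"
    using rot[OF uvD(2)] vu by (simp add: rot_z)
  then show "M (z, u) = i + 2" if "(z, u) \<in> Q" using asym[OF that] by simp
  have vw: "M (u, w) = M (v, w) + of_bool ((w, u) \<in> Q)" using rot[OF arcs4(3)] by (simp add: rot_w)
  show "M (v, w) = i + 2"
  proof (cases "(w, u) \<in> Q")
    case True
    then show ?thesis using vw wuQ by (simp add: three_eq_add_one)
  next
    case False
    then show ?thesis using vw edge[of u w] oriented[OF arcs4(1)] wu by simp
  qed
  show "M (u, z) = i + 1"
  proof (cases "(z, u) \<in> Q")
    case True
    then show ?thesis using three_eq_add_one[OF edge[OF True]] zu asym[OF True] by simp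
  next
    case False
    then show ?thesis using edge[of u z] oriented[OF arcs4(5)] zu by simp
  qed
qed

text \<open>The hypotheses \<open>new\<close> are the rotation rule at the six arcs bounding the new
  faces; elsewhere \<open>\<rho>'\<close> agrees with \<open>\<rho>\<close>.\<close>

lemma flip_labellingI:
  assumes Q': "triangulated.three_orientation V D' r Q'"
    and old: "\<And>x y. (x, y) \<in> D \<Longrightarrow> (x, y) \<notin> {(u, v), (v, u)} \<Longrightarrow>
        (x, y) \<notin> {(w, u), (z, v), (v, w), (z, w), (u, z), (w, z)} \<Longrightarrow>
        M' (\<rho> y x, y) = M' (x, y) + of_bool ((y, \<rho> y x) \<in> Q')"
    and new: "M' (z, u) = M' (w, u) + of_bool ((u, z) \<in> Q')"
      "M' (w, v) = M' (z, v) + of_bool ((v, w) \<in> Q')"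
      "M' (z, w) = M' (v, w) + of_bool ((w, z) \<in> Q')"
      "M' (u, w) = M' (z, w) + of_bool ((w, u) \<in> Q')"
      "M' (w, z) = M' (u, z) + of_bool ((z, w) \<in> Q')"
      "M' (v, z) = M' (w, z) + of_bool ((z, v) \<in> Q')"
    and edge: "\<And>x y. (x, y) \<in> Q' \<Longrightarrow> M' (x, y) = M' (y, x) + 1"
    and outer: "\<And>x j. (x, r j) \<in> D' \<Longrightarrow> M' (x, r j) = j"
  shows "triangulated.labelling V D' \<rho>' r Q' M'"
proof -
  interpret F: triangulated V D' \<rho>' r by (rule triangulated_flip)
  have "M' (\<rho>' y x, y) = M' (x, y) + of_bool ((y, \<rho>' y x) \<in> Q')" if xy: "(x, y) \<in> D'" for x y
  proof (cases "(x, y) \<in> {(w, u), (z, v), (v, w), (z, w), (u, z), (w, z)}")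
    case True
    then show ?thesis using new rho'_new by auto
  next
    case False
    then have "(x, y) \<in> D" "(x, y) \<notin> {(u, v), (v, u)}" using xy by (auto simp: D'_def)
    then show ?thesis using old[OF _ _ False] rho'_old[OF False] by simp
  qed
  then show ?thesis unfolding F.labelling_def using Q' edge outer by blast
qed

text \<open>The edge rule forces the values: \<open>(u, w)\<close> keeps the label \<open>i\<close>,
  so \<open>(w, u)\<close> gets i + 2; the new edge from \<open>w\<close> to \<open>z\<close>
  inherits colour i + 1, so \<open>(z, w)\<close> gets \<open>i\<close>.\<close>

lemma flip_labelling_w:
  assumes wu: "(w, u) \<in> Q"
  shows "triangulated.labelling V D' \<rho>' r (Q - {(u, v), (w, u)} \<union> {(u, w), (w, z)})
    (M((w, u) := i + 2, (z, w) := i, (w, z) := i + 1))" (is "triangulated.labelling V D' \<rho>' r ?Q ?M")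
proof (rule flip_labellingI)
  note rot = labellingD(3)[OF L] and edge = labellingD(4)[OF L] and or = labellingD(2)[OF L]
  note asym = orientationD(2)[OF or] and ql = quad_labels
  have QD: "Q \<subseteq> D" using orientationD(1)[OF or] inner_arcs_D by auto
  have nQ: "(v, u) \<notin> Q" "(u, w) \<notin> Q" "(w, z) \<notin> Q" "(z, w) \<notin> Q"
    using asym uvQ wu QD wzD by auto
  show "triangulated.three_orientation V D' r ?Q"
    by (rule three_orientation_flip) (use labellingD(1)[OF L] uvQ wu in auto)
  show "?M (\<rho> y x, y) = ?M (x, y) + of_bool ((y, \<rho> y x) \<in> ?Q)"
    if D: "(x, y) \<in> D" "(x, y) \<notin> {(u, v), (v, u)}"
      and n: "(x, y) \<notin> {(w, u), (z, v), (v, w), (z, w), (u, z), (w, z)}" for x y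
  \<comment> \<open>Among the angles outside the new faces, only the one before \<open>w\<close> at
    \<open>u\<close> has a changed successor: the label must now increase there, since
    \<open>(u, w)\<close> has become outgoing.\<close>
  proof (cases "\<rho> y x = w \<and> y = u")
    case True
    then have y: "y = u" "\<rho> u x = w" by auto
    have "M (x, u) = i + 1" using rot[OF D(1)] ql(2) nQ y by simp
    then show ?thesis using y n distinct4 by simp
  next
    case False
    note q = face_rot[OF D(1)]
    have 1: "(\<rho> y x, y) \<notin> {(z, w), (w, z)}" using q(3) D_rev wzD by auto
    have "(y, \<rho> y x) \<notin> {(u, v), (w, u)}" using q(1) n rot_w by auto
    then have "(y, \<rho> y x) \<in> ?Q \<longleftrightarrow> (y, \<rho> y x) \<in> Q" using 1 False by blast
    moreover have M: "?M e = M e" if "e \<notin> {(z, w), (w, z)}" "e \<noteq> (w, u)" for e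
      using that by simp
    have "?M (\<rho> y x, y) = M (\<rho> y x, y)" by (rule M[OF 1]) (use False in blast)
    moreover have "?M (x, y) = M (x, y)" by (rule M) (use n in blast)+
    ultimately show ?thesis using rot[OF D(1)] by (simp only:)
  qed
  show "?M (x, y) = ?M (y, x) + 1" if "(x, y) \<in> ?Q" for x y
    using that edge[of x y] ql(6)[OF wu] distinct4 nQ asym[of x y] by (auto simp: wu uvQ)
  \<comment> \<open>If \<open>z\<close> is an outer vertex, the new arc \<open>(w, z)\<close> needs
    the label that \<open>(u, z)\<close> already has, namely i + 1.\<close>
  show "?M (x, r j) = j" if x: "(x, r j) \<in> D'" for x j
  proof -
    have "u \<in> inner_verts" "w \<in> inner_verts" using tail_interior[OF labellingD(1)[OF L]] uvQ wu by auto
    then have "r j \<noteq> u" "r j \<noteq> w" by (auto simp: inner_verts_def)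
    then show ?thesis
      using labellingD(5)[OF L, of x j] labellingD(5)[OF L, of u j] arcs4 ql(5) x distinct4
      by (auto simp: D'_def)
  qed
  show "?M (z, u) = ?M (w, u) + of_bool ((u, z) \<in> ?Q)"
    using rot[OF uvD(2)] ql(1) distinct4 by (simp add: rot_z)
  show "?M (w, v) = ?M (z, v) + of_bool ((v, w) \<in> ?Q)"
    using rot[OF uvD(1)] ql(3) i distinct4 by (simp add: rot_w)
  show "?M (z, w) = ?M (v, w) + of_bool ((w, z) \<in> ?Q)"
    using ql(4) distinct4 by simp
  show "?M (u, w) = ?M (z, w) + of_bool ((w, u) \<in> ?Q)"
    using ql(6)[OF wu] distinct4 by simp
  show "?M (w, z) = ?M (u, z) + of_bool ((z, w) \<in> ?Q)"
    using ql(5) nQ distinct4 by simp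
  show "?M (v, z) = ?M (w, z) + of_bool ((z, v) \<in> ?Q)"
    using rot[OF arcs4(5)] ql(5) distinct4 by (simp add: rot_z)
qed

text \<open>Here \<open>u \<rightarrow> z\<close> takes over colour \<open>i\<close> and the new
  edge from \<open>z\<close> to \<open>w\<close> inherits i + 2. At \<open>z\<close> the label no
  longer increases when passing \<open>u\<close>, so \<open>M (u, z)\<close> drops from i + 1 to
  \<open>i\<close>.\<close>

lemma flip_labelling_z:
  assumes zu: "(z, u) \<in> Q"
  shows "triangulated.labelling V D' \<rho>' r (Q - {(u, v), (z, u)} \<union> {(u, z), (z, w)})
    (M((u, z) := i, (w, z) := i + 1, (z, w) := i + 2))" (is "triangulated.labelling V D' \<rho>' r ?Q ?M")
proof (rule flip_labellingI)
  note rot = labellingD(3)[OF L] and edge = labellingD(4)[OF L] and or = labellingD(2)[OF L]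
  note asym = orientationD(2)[OF or] and ql = quad_labels
  have QD: "Q \<subseteq> D" using orientationD(1)[OF or] inner_arcs_D by auto
  have nQ: "(v, u) \<notin> Q" "(u, z) \<notin> Q" "(w, z) \<notin> Q" "(z, w) \<notin> Q"
    using asym uvQ zu QD wzD by auto
  show "triangulated.three_orientation V D' r ?Q"
    by (rule three_orientation_flip) (use labellingD(1)[OF L] uvQ zu in auto)
  show "?M (\<rho> y x, y) = ?M (x, y) + of_bool ((y, \<rho> y x) \<in> ?Q)"
    if D: "(x, y) \<in> D" "(x, y) \<notin> {(u, v), (v, u)}"
      and n: "(x, y) \<notin> {(w, u), (z, v), (v, w), (z, w), (u, z), (w, z)}" for x y
  proof (cases "\<rho> y x = u \<and> y = z")
    case True
    then have y: "y = z" "\<rho> z x = u" by auto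
    have "M (u, z) = M (x, z) + 1" using rot[OF D(1)] zu y by simp
    then have "M (x, z) = i" using ql(5) by simp
    then show ?thesis using y n distinct4 by simp
  next
    case False
    note q = face_rot[OF D(1)]
    have 1: "(\<rho> y x, y) \<notin> {(z, w), (w, z)}" using q(3) D_rev wzD by auto
    have 2: "(y, \<rho> y x) \<notin> {(u, v), (u, z)}" using q(1) n D(2) rot_w rot_z by auto
    have 3: "(y, \<rho> y x) \<notin> {(z, u), (z, w)}" using 1 False by auto
    have "e \<in> ?Q \<longleftrightarrow> e \<in> Q" if "e \<notin> {(u, v), (u, z)}" "e \<notin> {(z, u), (z, w)}" for e
      using that by blast
    note this[OF 2 3]
    moreover have M: "?M e = M e" if "e \<notin> {(z, w), (w, z)}" "e \<noteq> (u, z)" for e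
      using that by simp
    have "?M (\<rho> y x, y) = M (\<rho> y x, y)" by (rule M[OF 1]) (use False in blast)
    moreover have "?M (x, y) = M (x, y)" by (rule M) (use n in blast)+
    ultimately show ?thesis using rot[OF D(1)] by (simp only:)
  qed
  show "?M (x, y) = ?M (y, x) + 1" if "(x, y) \<in> ?Q" for x y
    using that edge[of x y] ql(7)[OF zu] distinct4 nQ asym[of x y] by (auto simp: zu uvQ)
  show "?M (x, r j) = j" if x: "(x, r j) \<in> D'" for x j
  proof -
    have "u \<in> inner_verts" "z \<in> inner_verts" using tail_interior[OF labellingD(1)[OF L]] uvQ zu by auto
    then have "r j \<noteq> u" "r j \<noteq> z" by (auto simp: inner_verts_def)
    then show ?thesis
      using labellingD(5)[OF L, of x j] labellingD(5)[OF L, of v j] arcs4 ql(4) x distinct4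
      by (auto simp: D'_def)
  qed
  show "?M (z, u) = ?M (w, u) + of_bool ((u, z) \<in> ?Q)"
    using ql(2) ql(7)[OF zu] distinct4 by simp
  show "?M (w, v) = ?M (z, v) + of_bool ((v, w) \<in> ?Q)"
    using rot[OF uvD(1)] ql(3) i distinct4 by (simp add: rot_w)
  show "?M (z, w) = ?M (v, w) + of_bool ((w, z) \<in> ?Q)"
    using ql(4) nQ distinct4 by simp
  show "?M (u, w) = ?M (z, w) + of_bool ((w, u) \<in> ?Q)"
    using rot[OF arcs4(3)] ql(4) distinct4 by (simp add: rot_w)
  show "?M (w, z) = ?M (u, z) + of_bool ((z, w) \<in> ?Q)"
    using distinct4 by simp
  show "?M (v, z) = ?M (w, z) + of_bool ((z, v) \<in> ?Q)"
    using rot[OF arcs4(5)] ql(5) distinct4 by (simp add: rot_z)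
qed

end

end

lemma colored_flippable_if_oriented:
  assumes T: "triangulation T" and flip: "flippable T u v"
    and Q0: "triangulated.three_orientation (pverts (skeleton T)) (parcs (skeleton T)) (outer T) Q0"
    and uvQ0: "(u, v) \<in> Q0"
  shows "\<exists>R. realizer T R \<and> colored_flippable T R u v"
proof -
  define w z where apex_w: "w = apex T u v" and apex_z: "z = apex T v u"
  interpret triangulated "pverts (skeleton T)" "parcs (skeleton T)" "rot T" "outer T"
    by (rule triangulation_triangulated[OF T])
  have inner_arcs: "interior_arcs T = inner_arcs" by (auto simp: interior_arcs_def inner_arcs_def outer_arcs_def outer_cycle_def)
  interpret flippable_arc "pverts (skeleton T)" "parcs (skeleton T)" "rot T" "outer T" u v w z
    by unfold_locales (use flip in \<open>simp_all add: flippable_def inner_arcs apex_w apex_z apex_def\<close>)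
  interpret F: triangulated "pverts (skeleton T)" D' \<rho>' "outer T" by (rule triangulated_flip)
  have fl: "pverts (skeleton (flip T u v)) = pverts (skeleton T)" "parcs (skeleton (flip T u v)) = D'"
    "rot (flip T u v) = \<rho>'" "outer (flip T u v) = outer T"
    by (simp_all add: flip_def Let_def D'_def \<rho>'_def apex_w[symmetric] apex_z[symmetric])
  have T': "triangulation (flip T u v)" by (rule F.triangulationI) (rule fl)+
  obtain Q where Q: "three_orientation Q" "(u, v) \<in> Q" "(w, u) \<in> Q \<or> (z, u) \<in> Q"
    using three_orientation_reversal[OF Q0 uvQ0, of w z] arcs4 wzD distinct4 by blast
  obtain M where L: "labelling Q M" using labelling_ex[OF Q(1)] by blast
  define R where "R k = {(x, y) \<in> Q. M (x, y) = k}" for k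
  define i where "i = M (u, v)"
  have uv: "(u, v) \<in> R i" using Q(2) by (simp add: R_def i_def)
  have QD: "Q \<subseteq> parcs (skeleton T)" using orientationD(1)[OF labellingD(2)[OF L]] inner_arcs_D by auto
  have R: "realizer T R"
    using labelling_realizer[OF T L] by (simp add: R_def[abs_def])
  have "\<exists>j a b. {a, b} = {w, z} \<and> (a, u) \<in> R j \<and> realizer (flip T u v) (colored_flip R i j u v a b)"
    using Q(3)
  proof
    assume wu: "(w, u) \<in> Q"
    let ?Q = "Q - {(u, v), (w, u)} \<union> {(u, w), (w, z)}"
    let ?M = "M((w, u) := i + 2, (z, w) := i, (w, z) := i + 1)"
    have "realizer (flip T u v) (\<lambda>k. {(x, y) \<in> ?Q. ?M (x, y) = k})"
      by (rule labelling_realizer[OF T', unfolded fl, OF flip_labelling_w[OF L Q(2) i_def wu]])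
    \<comment> \<open>The edge \<open>w \<rightarrow> u\<close> has colour i + 1: this flip is of
      the second type.\<close>
    moreover have "{(x, y) \<in> ?Q. ?M (x, y) = k} = colored_flip R i (i + 1) u v w z k" for k
      using QD wzD distinct4 quad_labels(6)[OF L Q(2) i_def wu]
      by (auto simp: colored_flip_def R_def split: if_splits)
    ultimately have "realizer (flip T u v) (colored_flip R i (i + 1) u v w z)" by (simp add: eta_contract_eq)
    then show ?thesis
      using wu quad_labels(2)[OF L Q(2) i_def] by (intro exI[of _ "i + 1"] exI[of _ w] exI[of _ z]) (simp add: R_def)
  next
    assume zu: "(z, u) \<in> Q"
    let ?Q = "Q - {(u, v), (z, u)} \<union> {(u, z), (z, w)}"
    let ?M = "M((u, z) := i, (w, z) := i + 1, (z, w) := i + 2)"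
    have "realizer (flip T u v) (\<lambda>k. {(x, y) \<in> ?Q. ?M (x, y) = k})"
      by (rule labelling_realizer[OF T', unfolded fl, OF flip_labelling_z[OF L Q(2) i_def zu]])
    \<comment> \<open>The edge \<open>z \<rightarrow> u\<close> has colour i + 2 = i - 1: this flip
      is of the first type.\<close>
    moreover have "{(x, y) \<in> ?Q. ?M (x, y) = k} = colored_flip R i (i + 2) u v z w k" for k
      using QD wzD distinct4 orientationD(2)[OF labellingD(2)[OF L] zu]
      by (auto simp: colored_flip_def R_def split: if_splits)
    ultimately have "realizer (flip T u v) (colored_flip R i (i + 2) u v z w)" by (simp add: eta_contract_eq)
    then show ?thesis
      using zu quad_labels(7)[OF L Q(2) i_def zu]
      by (intro exI[of _ "i + 2"] exI[of _ z] exI[of _ w]) (auto simp: R_def)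
  qed
  then have "colored_flippable T R u v"
    using flip uv unfolding colored_flippable_def apex_w apex_z by blast
  then show ?thesis using R by blast
qed

theorem theorem1:
  fixes T :: "'a plane_graph" and u v :: 'a
  assumes "triangulation T"
    and "flippable T u v"
  shows "\<exists>R. realizer T R \<and> (colored_flippable T R u v \<or> colored_flippable T R v u)"
proof -
  interpret triangulated "pverts (skeleton T)" "parcs (skeleton T)" "rot T" "outer T"
    by (rule triangulation_triangulated[OF assms(1)])
  obtain Q where Q: "three_orientation Q" using three_orientation_ex by blast
  have inner_arcs: "interior_arcs T = inner_arcs" by (auto simp: interior_arcs_def inner_arcs_def outer_arcs_def outer_cycle_def)
  have "(u, v) \<in> inner_arcs" using assms(2) by (simp add: flippable_def inner_arcs)
  \<comment> \<open>The orientation found by minimisation decides the direction of the edge, and the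
    later cycle reversal preserves it.\<close>
  then have "(u, v) \<in> Q \<or> (v, u) \<in> Q"
    using Q orientationD(3) by (auto simp: three_orientation_def)
  moreover have "flippable T v u"
    using assms(2) inner_arcs_rev D_rev by (auto simp: flippable_def inner_arcs)
  ultimately show ?thesis
    using colored_flippable_if_oriented[OF assms(1) _ Q] assms(2) by blast
qed

end
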